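(* Let $n\ge 2$ be an integer, let $1<p<n$, $p<q\le \frac{p(n-1)}{n-p}$, and set $r=p\,\frac{q-1}{p-1}$, $\theta=\frac{(q-p)n}{(q-1)(np-(n-p)q)}$. Let $\Phi=\Phi(n,p,q)$ be the best constant in the Euclidean Gagliardo-Nirenberg inequality on $\mathbb{R}^n$ with these exponents (see context). Let $(X,d,\mu)$ be a proper metric measure space, let $x_0\in X$, $C\ge \Phi$ and $C_0\ge 1$. Assume: (i) for every $u\in \mathrm{Lip}_0(X)$, $$\left(\int_X |u(x)|^r\,d\mu(x)\right)^{\frac1r}\le C\left(\int_X |Du|^p(x)\,d\mu(x)\right)^{\frac{\theta}{p}}\left(\int_X |u(x)|^q\,d\mu(x)\right)^{\frac{1-\theta}{q}};$$ (ii) $$\frac{\mu(B(x,R))}{\mu(B(x,s))}\le C_0\left(\frac{R}{s}\right)^n\quad\text{for all } x\in X \text{ and all } 0<s<R;$$ (iii) $$\liminf_{s\to 0^+}\frac{\mu(B(x_0,s))}{\mu_E(\mathbb{B}_n(s))}=1.$$ Then for every $x\in X$ and every $\rho>0$, $$\mu(B(x,\rho))\ge C_0^{-1}\left(C^{-1}\Phi\right)^{\left(\frac{\theta}{p}+\frac{1-\theta}{q}-\frac1r\right)^{-1}}\mu_E(\mathbb{B}_n(\rho)).$$ In particular, $(X,d,\mu)$ has the $n$-dimensional volume growth $$C_0^{-1}\left(C^{-1}\Phi\right)^{\left(\frac{\theta}{p}+\frac{1-\theta}{q}-\frac1r\right)^{-1}}w_n\rho^n\le \mu(B(x_0,\rho))\le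 C_0\,w_n\rho^n\quad\text{for all }\rho>0.$$
   Context: A metric measure space $(X,d,\mu)$ is a metric space $(X,d)$ with a Borel measure $\mu$ such that $0<\mu(U)<\infty$ for every nonempty bounded open set $U\subset X$. It is proper if closed bounded subsets of $X$ are compact. $B(x,s)=\{y\in X: d(x,y)<s\}$, $\mathbb{B}_n(s)=\{x\in\mathbb{R}^n:|x|<s\}$, $\mu_E$ is the $n$-dimensional Lebesgue measure, and $w_n=\mu_E(\mathbb{B}_n(1))$. $\mathrm{Lip}_0(X)$ is the space of Lipschitz functions $u:X\to\mathbb{R}$ with compact support. For such $u$, the local Lipschitz constant at $x$ is $|Du|(x)=\limsup_{y\to x}\frac{|u(y)-u(x)|}{d(x,y)}$ (equal to $0$ at isolated points). $\Phi$ is the best (smallest) constant such that $$\left(\int_{\mathbb{R}^n}|u|^r\,dx\right)^{1/r}\le \Phi\left(\int_{\mathbb{R}^n}|\nabla u|^p\,dx\right)^{\theta/p}\left(\int_{\mathbb{R}^n}|u|^q\,dx\right)^{(1-\theta)/q}$$ for all $u\in\mathcal{D}^{p,q}(\mathbb{R}^n)$, where $\mathcal{D}^{p,q}(\mathbb{R}^n)$ is the completion of the smooth compactly supported functions on $\mathbb{R}^n$ under the norm $\|\nabla u\|_p+\|u\|_q$. (By Del Pino-Dolbeault, $\Phi$ is finite and positive, and equality holds exactly for $u(x)=\alpha(1+\beta|x-\bar x|^{p/(p-1)})^{-(p-1)/(q-p)}$ with $\alpha\in\mathbb{R}$, $\beta>0$, $\bar x\in\mathbb{R}^n$.) When $\theta=1$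 (i.e. $q=\frac{p(n-1)}{n-p}$), the last factor in the inequalities is understood as $1$. *)

theory Defs
  imports "HOL-Analysis.Analysis"
begin

definition metric_measure_space :: "'a::metric_space measure \<Rightarrow> bool" where
  "metric_measure_space M \<longleftrightarrow> sets M = sets borel \<and>
     (\<forall>U. open U \<and> bounded U \<and> U \<noteq> {} \<longrightarrow> 0 < emeasure M U \<and> emeasure M U < \<infinity>)"

definition Lip0 :: "('a::metric_space \<Rightarrow> real) set" where
  "Lip0 = {u. (\<exists>L. L-lipschitz_on UNIV u) \<and> compact (closure {x. u x \<noteq> 0})}"

text \<open>For Lipschitz functions the upper limit below is finite at every non-isolated point, so
  the conversion from extended reals loses nothing.\<close>

definition local_lip :: "('a::metric_space \<Rightarrow> real) \<Rightarrow> 'a \<Rightarrow> real" where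
  "local_lip u x = (if x islimpt UNIV
     then real_of_ereal (Limsup (at x) (\<lambda>y. ereal (\<bar>u y - u x\<bar> / dist x y))) else 0)"

primrec Ck :: "nat \<Rightarrow> (real ^ 'n::finite \<Rightarrow> real) \<Rightarrow> bool" where
  "Ck 0 f \<longleftrightarrow> continuous_on UNIV f"
| "Ck (Suc k) f \<longleftrightarrow> (\<forall>x. f differentiable (at x)) \<and>
     (\<forall>v. Ck k (\<lambda>x. frechet_derivative f (at x) v))"

definition test_function :: "(real ^ 'n::finite \<Rightarrow> real) \<Rightarrow> bool" where
  "test_function f \<longleftrightarrow> (\<forall>k. Ck k f) \<and> compact (closure {x. f x \<noteq> 0})"

definition gradient :: "(real ^ 'n::finite \<Rightarrow> real) \<Rightarrow> real ^ 'n \<Rightarrow> real ^ 'n" where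
  "gradient f x = (THE D. GDERIV f x :> D)"

text \<open>The completion of the test functions under the norm
  \<open>\<parallel>\<nabla>f\<parallel>\<^sub>p + \<parallel>f\<parallel>\<^sub>q\<close>, realised as the closure of the set of all pairs \<open>(f, \<nabla>f)\<close> in
  \<open>L\<^sup>q \<times> L\<^sup>p\<close>. In a pair \<open>(u, g)\<close> the field \<open>g\<close> is the weak gradient of \<open>u\<close>, hence
  determined by \<open>u\<close> almost everywhere. The integrals are taken in the extended nonnegative
  reals, so convergence to 0 forces \<open>u\<close> and \<open>g\<close> to lie in \<open>L\<^sup>q\<close> and \<open>L\<^sup>p\<close>.\<close>

definition Dpq :: "real \<Rightarrow> real \<Rightarrow> ((real ^ 'n::finite \<Rightarrow> real) \<times> (real ^ 'n \<Rightarrow> real ^ 'n)) set" where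
  "Dpq p q = {(u, g). u \<in> borel_measurable lborel \<and> g \<in> borel_measurable lborel \<and>
     (\<exists>f :: nat \<Rightarrow> real ^ 'n \<Rightarrow> real. (\<forall>k. test_function (f k)) \<and>
        (\<lambda>k. \<integral>\<^sup>+x. ennreal (norm (gradient (f k) x - g x) powr p) \<partial>lborel) \<longlonglongrightarrow> 0 \<and>
        (\<lambda>k. \<integral>\<^sup>+x. ennreal (\<bar>f k x - u x\<bar> powr q) \<partial>lborel) \<longlonglongrightarrow> 0)}"

text \<open>The Gagliardo--Nirenberg inequality for a function \<open>u\<close>, where \<open>h\<close> is the length of its
  gradient. The case distinction is the convention that the last factor is 1 for
  \<open>\<theta> = 1\<close>; note that \<open>0 powr 0 = 0\<close>.\<close>

definition gn_inequality ::
  "'a measure \<Rightarrow> real \<Rightarrow> real \<Rightarrow> real \<Rightarrow> real \<Rightarrow> real \<Rightarrow> ('a \<Rightarrow> real) \<Rightarrow> ('a \<Rightarrow> real) \<Rightarrow> bool" where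
  "gn_inequality M p q r \<theta> C u h \<longleftrightarrow>
     (\<integral>x. \<bar>u x\<bar> powr r \<partial>M) powr (1 / r) \<le>
       C * (\<integral>x. h x powr p \<partial>M) powr (\<theta> / p) *
       (if \<theta> = 1 then 1 else (\<integral>x. \<bar>u x\<bar> powr q \<partial>M) powr ((1 - \<theta>) / q))"

text \<open>The integrability condition says that the left-hand side of the inequality is finite; a
  Bochner integral of a non-integrable function would be 0.\<close>

definition gn_best_const :: "'n::finite itself \<Rightarrow> real \<Rightarrow> real \<Rightarrow> real \<Rightarrow> real \<Rightarrow> real" where
  "gn_best_const (_ :: 'n itself) p q r \<theta> = Inf {C. 0 \<le> C \<and>
     (\<forall>(u, g) \<in> (Dpq p q :: ((real ^ 'n \<Rightarrow> real) \<times> (real ^ 'n \<Rightarrow> real ^ 'n)) set).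
        integrable lborel (\<lambda>x. \<bar>u x\<bar> powr r) \<and>
        gn_inequality lborel p q r \<theta> C u (\<lambda>x. norm (g x)))}"

end

theory Submission
  imports Defs "HOL-Real_Asymp.Real_Asymp"
begin

text \<open>
  The sharp Euclidean inequality is obtained from Knothe's triangular transport of \<open>|f|\<^sup>r\<close> to the
  \<open>r\<close>-th power of the extremal profile \<open>(l + |y|\<^sup>b)\<^sup>-\<^sup>\<sigma>\<close>, \<open>b = p/(p-1)\<close>: the arithmetic-geometric
  mean inequality bounds the Jacobian by the divergence, an integration by parts moves the
  derivative to \<open>|f|\<^sup>q\<close>, and Young's inequality followed by optimisation over the scales gives an
  upper bound for \<open>\<Phi>\<close> that the profile attains.

  On \<open>X\<close> the inequality is applied to the profile composed with the distance from \<open>x\<^sub>0\<close>. All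
  integrals that occur are expressed by \<open>w(l) = \<integral> (l + d(x\<^sub>0,x)\<^sup>b)\<^sup>-\<^sup>s d\<mu>\<close> and its derivative, so
  \<open>w\<close> satisfies a differential inequality for which every multiple \<open>c W\<close>, \<open>c < (\<Phi>/C)\<^sup>r\<^sup>e\<close>, of the
  Euclidean counterpart \<open>W\<close> is a strict supersolution. Condition (iii) yields \<open>w \<ge> c W\<close> for small
  \<open>l\<close>, hence for all \<open>l\<close>. Letting \<open>l \<rightarrow> \<infinity>\<close> produces arbitrarily large balls around \<open>x\<^sub>0\<close> of volume
  more than \<open>c \<omega> t\<^sup>n\<close>, and condition (ii) transports this bound to every ball.
\<close>

section \<open>Iterated integrals and monotone transport\<close>

text \<open>The exponents are tied together by one number: with \<open>m = \<sigma> * r\<close> and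
  \<open>\<gamma> = 1 - 1 / m\<close>, the power \<open>\<gamma>\<close> turns \<open>|f|^r\<close>
  into \<open>|f|^q\<close> and the \<open>r\<close>-th power of the profile into its
  \<open>q\<close>-th power. As \<open>m\<close> is a real number that may exceed \<open>n\<close>,
  the arithmetic-geometric mean inequality carries the weight \<open>m - n\<close> on the number 1;
  this produces the term with the integral of \<open>|f|^q\<close>, and it vanishes exactly when
  \<open>\<theta> = 1\<close>. Regularity shapes the Euclidean part: transport wants positive
  continuous densities on boxes, while \<open>|f|^r\<close> vanishes outside a compact set. Hence
  \<open>|f|\<close> is lifted by an amount of order \<open>1 / j\<close> while the target cube
  grows with \<open>j\<close>, and the boundary terms are estimated explicitly. On \<open>X\<close>
  the supersolution property is a matter of homogeneity: replacing \<open>W\<close> by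
  \<open>c W\<close> multiplies one side of the relation by \<open>c^e\<close> and the other by
  \<open>c^(e+1)\<close>. The spare factor \<open>c\<close> pays for a constant \<open>C\<close>
  above \<open>\<Phi>\<close>.\<close>

definition upd :: "'a::euclidean_space \<Rightarrow> 'a \<Rightarrow> real \<Rightarrow> 'a" where
  "upd z i t = z + (t - z \<bullet> i) *\<^sub>R i"

lemma upd_inner: "i \<in> Basis \<Longrightarrow> k \<in> Basis \<Longrightarrow> upd z i t \<bullet> k = (if k = i then t else z \<bullet> k)"
  by (simp add: upd_def inner_simps inner_Basis)

lemma upd_commute: "i \<in> Basis \<Longrightarrow> j \<in> Basis \<Longrightarrow> i \<noteq> j \<Longrightarrow> upd (upd z i t) j u = upd (upd z j u) i t"
  by (simp add: upd_def inner_simps inner_Basis)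

lemma continuous_on_upd [continuous_intros]:
  assumes "continuous_on S f" "continuous_on S g"
  shows "continuous_on S (\<lambda>x. upd (f x) i (g x))"
  unfolding upd_def by (intro continuous_intros assms)

text \<open>The list says which coordinates are integrated over \<open>[-R, R]\<close>; the others
  stay as in \<open>z\<close>. Recursion on a list lets an induction remove one coordinate at a
  time.\<close>

primrec iterint :: "real \<Rightarrow> 'a::euclidean_space list \<Rightarrow> ('a \<Rightarrow> real) \<Rightarrow> 'a \<Rightarrow> real" where
  "iterint R [] f z = f z"
| "iterint R (i # is) f z = integral {-R..R} (\<lambda>t. iterint R is f (upd z i t))"

lemma continuous_on_compose_UNIV:
  "continuous_on UNIV f \<Longrightarrow> continuous_on S g \<Longrightarrow> continuous_on S (\<lambda>x. f (g x))"
  using continuous_on_compose2 by blast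

lemma continuous_iterint: "continuous_on UNIV f \<Longrightarrow> continuous_on UNIV (iterint R is f)"
proof (induction "is")
  case (Cons i "is")
  have "continuous_on UNIV (\<lambda>z. integral (cbox (-R) R) (\<lambda>t. iterint R is f (upd z i t)))"
    by (rule integral_continuous_on_param)
      (auto simp: split_beta intro!: continuous_intros continuous_on_compose_UNIV[OF Cons.IH[OF Cons.prems]])
  then show ?case by simp
qed simp

lemma continuous_iterint_upd [continuous_intros]:
  "continuous_on UNIV f \<Longrightarrow> continuous_on S g \<Longrightarrow> continuous_on S (\<lambda>t. iterint R is f (upd z i (g t)))"
  by (intro continuous_on_compose_UNIV[OF continuous_iterint] continuous_intros)

lemma integrable_iterint_upd:
  "continuous_on UNIV f \<Longrightarrow> (\<lambda>t. iterint R is f (upd z i t)) integrable_on {a..b}"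
  by (intro integrable_continuous_interval continuous_intros)

text \<open>The comparison is asked only on the slice through \<open>z\<close>. The bound on a face
  of the cube relies on this, since there the function is small only for one fixed value of a
  coordinate.\<close>

lemma iterint_mono:
  assumes "set is \<subseteq> Basis" "distinct is" "continuous_on UNIV f" "continuous_on UNIV g"
    "\<And>x. (\<forall>k\<in>Basis - set is. x \<bullet> k = z \<bullet> k) \<Longrightarrow> f x \<le> g x"
  shows "iterint R is f z \<le> iterint R is g z"
  using assms
proof (induction "is" arbitrary: z)
  case Nil
  then show ?case by simp
next
  case (Cons i "is")
  have "iterint R is f (upd z i t) \<le> iterint R is g (upd z i t)" for t
  proof (rule Cons.IH)
    fix x assume x: "\<forall>k\<in>Basis - set is. x \<bullet> k = upd z i t \<bullet> k"
    show "f x \<le> g x"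
      by (rule Cons.prems(5)) (use x Cons.prems in \<open>auto simp: upd_inner\<close>)
  qed (use Cons.prems in auto)
  then show ?case
    by (auto intro!: integral_le integrable_iterint_upd Cons.prems)
qed

lemma iterint_pos:
  assumes "R > 0" "continuous_on UNIV f" "\<And>x. f x > 0"
  shows "iterint R is f z > 0"
proof (induction "is" arbitrary: z)
  case (Cons i "is")
  have "integral {-R..R} (\<lambda>t. iterint R is f (upd z i t)) \<noteq> 0"
  proof
    assume "integral {-R..R} (\<lambda>t. iterint R is f (upd z i t)) = 0"
    then have "iterint R is f (upd z i 0) = 0"
      by (subst (asm) integral_eq_0_iff) (use assms Cons in \<open>auto intro!: continuous_intros less_imp_le\<close>)
    then show False using Cons by (metis less_irrefl)
  qed
  moreover have "integral {-R..R} (\<lambda>t. iterint R is f (upd z i t)) \<ge> 0"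
    using Cons by (intro integral_nonneg integrable_iterint_upd assms less_imp_le)
  ultimately show ?case by simp
qed (use assms in simp)

lemma iterint_cmult: "iterint R is (\<lambda>x. c * f x) z = c * iterint R is f z"
  by (induction "is" arbitrary: z) simp_all

lemma iterint_diff:
  assumes "continuous_on UNIV f" "continuous_on UNIV g"
  shows "iterint R is (\<lambda>x. f x - g x) z = iterint R is f z - iterint R is g z"
  by (induction "is" arbitrary: z) (simp_all add: integral_diff integrable_iterint_upd assms)

lemma iterint_const: "R \<ge> 0 \<Longrightarrow> iterint R is (\<lambda>x. c) z = c * (2 * R) ^ length is"
  by (induction "is" arbitrary: z) (simp_all add: algebra_simps)

text \<open>Leibniz rule under each inner integral; the update at \<open>i\<close> commutes with
  those of the list because \<open>i\<close> does not occur in it.\<close>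

lemma iterint_has_derivative:
  assumes "i \<in> Basis" "set is \<subseteq> Basis" "i \<notin> set is"
    and "continuous_on UNIV E" "continuous_on UNIV D"
    and "\<And>z t. ((\<lambda>t. E (upd z i t)) has_real_derivative D (upd z i t)) (at t)"
  shows "((\<lambda>t. iterint R is E (upd z i t)) has_real_derivative iterint R is D (upd z i t)) (at t)"
  using assms
proof (induction "is" arbitrary: z t)
  case Nil
  then show ?case by simp
next
  case (Cons j js)
  have ij: "i \<noteq> j" "j \<in> Basis" using Cons.prems by auto
  have "((\<lambda>t. integral (cbox (-R) R) (\<lambda>u. iterint R js E (upd (upd z j u) i t))) has_real_derivative
        integral (cbox (-R) R) (\<lambda>u. iterint R js D (upd (upd z j u) i t))) (at t within UNIV)"
  proof (rule leibniz_rule_field_derivative)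
    show "((\<lambda>x. iterint R js E (upd (upd z j u) i x)) has_real_derivative iterint R js D (upd (upd z j u) i x)) (at x within UNIV)" for x u
      using Cons by auto
    show "continuous_on (UNIV \<times> cbox (-R) R) (\<lambda>(x, u). iterint R js D (upd (upd z j u) i x))"
      unfolding split_beta
      by (intro continuous_on_compose_UNIV[OF continuous_iterint] continuous_intros Cons.prems)
    show "(\<lambda>u. iterint R js E (upd (upd z j u) i x)) integrable_on cbox (- R) R" for x
      unfolding cbox_interval
      by (intro integrable_continuous_interval continuous_on_compose_UNIV[OF continuous_iterint] continuous_intros Cons.prems)
  qed auto
  then show ?case
    using upd_commute[OF Cons.prems(1) ij(2) ij(1)] by simp
qed

text \<open>\<open>T\<close> matches the distribution functions, \<open>P t = Q (T t)\<close>, so it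
  is the inverse of \<open>Q\<close> after \<open>P\<close>. Equal masses make the endpoints
  correspond. The derivative is claimed only inside, where both distribution functions have
  two-sided derivatives.\<close>

lemma monotone_transport:
  fixes f g :: "real \<Rightarrow> real"
  assumes "a < b" "c < d" and cont: "continuous_on {a..b} f" "continuous_on {c..d} g"
    and pos: "\<And>x. x \<in> {a..b} \<Longrightarrow> f x > 0" "\<And>x. x \<in> {c..d} \<Longrightarrow> g x > 0"
    and mass: "integral {a..b} f = integral {c..d} g"
  obtains T where "continuous_on {a..b} T" "T a = c" "T b = d" "\<And>t. t \<in> {a..b} \<Longrightarrow> T t \<in> {c..d}"
    "\<And>t. t \<in> {a<..<b} \<Longrightarrow> (T has_real_derivative f t / g (T t)) (at t)"
proof -
  define P where "P t = integral {a..t} f" for t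
  define Q where "Q s = integral {c..s} g" for s
  have dP: "(P has_real_derivative f t) (at t within {a..b})" if "t \<in> {a..b}" for t
    unfolding P_def has_real_derivative_iff_has_vector_derivative
    by (rule integral_has_vector_derivative[OF cont(1) that])
  have dQ: "(Q has_real_derivative g t) (at t within {c..d})" if "t \<in> {c..d}" for t
    unfolding Q_def has_real_derivative_iff_has_vector_derivative
    by (rule integral_has_vector_derivative[OF cont(2) that])
  have contP: "continuous_on {a..b} P" and contQ: "continuous_on {c..d} Q"
    by (rule DERIV_continuous_on[OF dP], assumption) (rule DERIV_continuous_on[OF dQ], assumption)
  have monP: "P x < P y" if "a \<le> x" "x < y" "y \<le> b" for x y
  proof (rule DERIV_pos_imp_increasing_open[OF that(2)])
    fix z assume "x < z" "z < y"
    then show "\<exists>y. DERIV P z :> y \<and> 0 < y"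
      using dP[of z] pos(1)[of z] that at_within_interior[of z "{a..b}"] by (auto intro!: exI[of _ "f z"])
  qed (use contP that in \<open>auto intro: continuous_on_subset\<close>)
  have monQ: "Q x < Q y" if "c \<le> x" "x < y" "y \<le> d" for x y
  proof (rule DERIV_pos_imp_increasing_open[OF that(2)])
    fix z assume "x < z" "z < y"
    then show "\<exists>y. DERIV Q z :> y \<and> 0 < y"
      using dQ[of z] pos(2)[of z] that at_within_interior[of z "{c..d}"] by (auto intro!: exI[of _ "g z"])
  qed (use contQ that in \<open>auto intro: continuous_on_subset\<close>)
  have PQ: "P a = 0" "Q c = 0" "P b = Q d" using mass by (auto simp: P_def Q_def)
  have inj: "inj_on Q {c..d}"
    by (rule linorder_inj_onI) (use monQ in fastforce)+
  have img: "Q ` {c..d} = {0..Q d}"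
  proof (intro equalityI subsetI)
    fix y assume "y \<in> Q ` {c..d}"
    then obtain x where x: "x \<in> {c..d}" "y = Q x" by auto
    then show "y \<in> {0..Q d}"
      using monQ[of c x] monQ[of x d] PQ by (cases "x = c"; cases "x = d") auto
  next
    fix y assume "y \<in> {0..Q d}"
    then obtain x where "c \<le> x" "x \<le> d" "Q x = y"
      using IVT'[of Q c y d] contQ assms PQ by auto
    then show "y \<in> Q ` {c..d}" by auto
  qed
  define S where "S = the_inv_into {c..d} Q"
  have S: "S y \<in> {c..d}" "Q (S y) = y" if "y \<in> {0..Q d}" for y
    unfolding S_def using inj img that by (metis the_inv_into_into order_refl, metis f_the_inv_into_f)
  have SQ: "S (Q x) = x" if "x \<in> {c..d}" for x
    unfolding S_def using inj that by (simp add: the_inv_into_f_f)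
  have contS: "continuous_on {0..Q d} S"
    using continuous_on_inv[OF contQ, of S] SQ img by auto
  have PI: "P t \<in> {0..Q d}" if "t \<in> {a..b}" for t
    using monP[of a t] monP[of t b] PQ that by (cases "t = a"; cases "t = b") auto
  have PI': "P t \<in> {0<..<Q d}" if "t \<in> {a<..<b}" for t
    using monP[of a t] monP[of t b] PQ that by auto
  have SI': "S y \<in> {c<..<d}" if "y \<in> {0<..<Q d}" for y
    using S[of y] that PQ by (cases "S y = c"; cases "S y = d") auto
  have dS: "(S has_real_derivative inverse (g (S y))) (at y)" if y: "y \<in> {0<..<Q d}" for y
  proof (rule DERIV_inverse_function)
    show "(Q has_real_derivative g (S y)) (at (S y))"
      using dQ[of "S y"] SI'[OF y] at_within_interior[of "S y" "{c..d}"] by auto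
    show "g (S y) \<noteq> 0" using pos(2)[of "S y"] SI'[OF y] by auto
    show "0 < y" "y < Q d" using y by auto
    show "isCont S y"
      using contS y continuous_on_interior[of "{0..Q d}" S y] by auto
  qed (use S in auto)
  show thesis
  proof (rule that[of "S \<circ> P"])
    show "continuous_on {a..b} (S \<circ> P)"
      by (rule continuous_on_compose[OF contP continuous_on_subset[OF contS]]) (use PI in auto)
    show "(S \<circ> P) a = c" "(S \<circ> P) b = d"
      using SQ[of c] SQ[of d] PQ assms by auto
    show "(S \<circ> P) t \<in> {c..d}" if "t \<in> {a..b}" for t using S PI that by auto
    fix t assume t: "t \<in> {a<..<b}"
    have "(P has_real_derivative f t) (at t)"
      using dP[of t] t at_within_interior[of t "{a..b}"] by auto
    from DERIV_chain[OF dS[OF PI'[OF t]] this]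
    show "(S \<circ> P has_real_derivative f t / g ((S \<circ> P) t)) (at t)"
      by (simp add: field_simps)
  qed
qed

section \<open>Knothe's transport argument\<close>

text \<open>
  Instead of constructing Knothe's map, the inequality it gives is proved by peeling off one
  coordinate at a time; only the monotone rearrangement of the marginals is needed.
  For the coordinates already peeled off, \<open>a\<close> is the product of the diagonal derivatives, \<open>b\<close> is
  \<open>m - n\<close> plus their sum, \<open>c\<close> is the ratio of the masses of the current slices, and \<open>\<beta>\<close> collects
  the terms \<open>- D\<^sub>k x * y\<^sub>k\<close> from the integrations by parts.
\<close>

lemma knothe_inequality:
  fixes F G \<phi> \<psi> :: "'a::euclidean_space \<Rightarrow> real" and D :: "'a \<Rightarrow> 'a \<Rightarrow> real"
    and R K m \<gamma> \<eta> a b c :: real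
  assumes RK: "R > 0" "K > 0" and m: "m > 0" and \<gamma>: "\<gamma> = 1 - 1 / m" and \<eta>: "\<eta> \<ge> 0"
    and cont: "continuous_on UNIV F" "continuous_on UNIV G" "continuous_on UNIV \<phi>" "continuous_on UNIV \<psi>"
      "\<And>k. k \<in> Basis \<Longrightarrow> continuous_on UNIV (D k)"
    and pos: "\<And>x. F x > 0" "\<And>x. G x > 0"
    and deriv: "\<And>k z t. k \<in> Basis \<Longrightarrow>
      ((\<lambda>t. F (upd z k t) powr \<gamma>) has_real_derivative D k (upd z k t)) (at t)"
    and bdry: "\<And>x k. k \<in> Basis \<Longrightarrow> \<bar>x \<bullet> k\<bar> = R \<Longrightarrow> F x powr \<gamma> \<le> \<eta>"
  shows "set is \<subseteq> Basis \<Longrightarrow> distinct is \<Longrightarrow> a > 0 \<Longrightarrow> c > 0 \<Longrightarrow> continuous_on UNIV \<beta> \<Longrightarrow>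
    (\<And>s. (\<And>k. s k > 0) \<Longrightarrow> m * (a * (\<Prod>k\<in>set is. s k)) powr (1 / m) \<le> b + (\<Sum>k\<in>set is. s k)) \<Longrightarrow>
    iterint R is F z = c * iterint K is G z' \<Longrightarrow>
    (\<And>x y. (\<forall>k\<in>Basis - set is. x \<bullet> k = z \<bullet> k) \<Longrightarrow> (\<forall>k\<in>Basis - set is. y \<bullet> k = z' \<bullet> k) \<Longrightarrow>
       \<beta> x - (\<Sum>k\<in>set is. D k x * (y \<bullet> k)) \<le> F x * \<psi> y + \<phi> x) \<Longrightarrow>
    m * a powr (1 / m) * c powr \<gamma> * iterint K is (\<lambda>y. G y powr \<gamma>) z' + iterint R is \<beta> z
    \<le> b * iterint R is (\<lambda>x. F x powr \<gamma>) z + c * iterint K is (\<lambda>y. G y * \<psi> y) z' + iterint R is \<phi> z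
      + length is * (2 * K * \<eta> * (2 * R) ^ (length is - 1))"
proof (induction "is" arbitrary: a b c \<beta> z z')
  case Nil
  have "m * a powr (1 / m) \<le> b" using Nil.prems(6)[of "\<lambda>_. 1"] by simp
  then have "m * a powr (1 / m) * F z powr \<gamma> \<le> b * F z powr \<gamma>"
    by (rule mult_right_mono) simp
  moreover have Fz: "F z = c * G z'" using Nil.prems by simp
  moreover have "F z powr \<gamma> = c powr \<gamma> * G z' powr \<gamma>"
    unfolding Fz by (simp add: powr_mult)
  moreover have "\<beta> z \<le> F z * \<psi> z' + \<phi> z" using Nil.prems(8)[of z z'] by simp
  ultimately show ?case by (simp add: mult.assoc)
next
  case (Cons i "is")
  have i: "i \<in> Basis" "set is \<subseteq> Basis" "i \<notin> set is" "distinct is" using Cons.prems by auto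
  define E where "E x = F x powr \<gamma>" for x
  define H where "H y = G y powr \<gamma>" for y
  define f where "f t = iterint R is F (upd z i t)" for t
  define g where "g s = c * iterint K is G (upd z' i s)" for s
  have contE: "continuous_on UNIV E"
    unfolding E_def using pos by (intro continuous_intros cont) (metis less_irrefl)
  have contH: "continuous_on UNIV H"
    unfolding H_def using pos by (intro continuous_intros cont) (metis less_irrefl)
  have contGp: "continuous_on UNIV (\<lambda>y. G y * \<psi> y)" by (intro continuous_intros cont)
  have contfg: "continuous_on S f" "continuous_on S g" for S
    unfolding f_def g_def by (intro continuous_intros cont)+
  have fpos: "f t > 0" and gpos: "g t > 0" for t
    unfolding f_def g_def using Cons.prems(4)
    by (auto intro!: iterint_pos mult_pos_pos RK cont pos)
  \<comment> \<open>The hypothesis on the full slices says that the marginals along \<open>i\<close>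
    have equal mass once \<open>c\<close> is put into \<open>g\<close>.\<close>
  have mass: "integral {-R..R} f = integral {-K..K} g"
    using Cons.prems(7) by (simp add: f_def[abs_def] g_def[abs_def])
  obtain T where T: "continuous_on {-R..R} T" "T (-R) = -K" "T R = K" "\<And>t. t \<in> {-R..R} \<Longrightarrow> T t \<in> {-K..K}"
    "\<And>t. t \<in> {-R<..<R} \<Longrightarrow> (T has_real_derivative f t / g (T t)) (at t)"
    by (rule monotone_transport[of "-R" R "-K" K f g]) (use RK contfg fpos gpos mass in auto)
  define d where "d t = f t / g (T t)" for t
  have dpos: "d t > 0" for t unfolding d_def using fpos gpos by auto
  have contd: "continuous_on {-R..R} d"
    unfolding d_def using gpos
    by (intro continuous_intros contfg continuous_on_compose_UNIV[OF contfg(2) T(1)]) (metis less_irrefl)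
  define L where "L = length is * (2 * K * \<eta> * (2 * R) ^ (length is - 1))"
  define IH where "IH s = iterint K is H (upd z' i s)" for s
  define IG where "IG s = iterint K is (\<lambda>y. G y * \<psi> y) (upd z' i s)" for s
  define I\<beta> where "I\<beta> t = iterint R is \<beta> (upd z i t)" for t
  define I\<phi> where "I\<phi> t = iterint R is \<phi> (upd z i t)" for t
  define IE where "IE t = iterint R is E (upd z i t)" for t
  define ID where "ID t = iterint R is (D i) (upd z i t)" for t
  have contI: "continuous_on S IH" "continuous_on S IG" "continuous_on S I\<beta>" "continuous_on S I\<phi>"
     "continuous_on S IE" "continuous_on S ID" for S
    unfolding IH_def IG_def I\<beta>_def I\<phi>_def IE_def ID_def
    by (intro continuous_intros contGp contH contE cont i Cons.prems)+
  \<comment> \<open>The induction hypothesis on the slices at \<open>t\<close> and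
    \<open>T t\<close>: their mass ratio is \<open>c * d t\<close>, the new diagonal derivative
    \<open>d t\<close> is multiplied into \<open>a\<close> and added to \<open>b\<close>, and since
    \<open>y\<close> has the coordinate \<open>T t\<close> on its slice, the term
    \<open>- T t * D i x\<close> moves into \<open>\<beta>\<close>.\<close>
  have step: "m * a powr (1 / m) * c powr \<gamma> * (IH (T t) * d t) + I\<beta> t
      \<le> b * IE t + c * (IG (T t) * d t) + I\<phi> t + L + (d t * IE t + ID t * T t)" for t
  proof -
    have "m * (a * d t) powr (1 / m) * (c * d t) powr \<gamma> * iterint K is (\<lambda>y. G y powr \<gamma>) (upd z' i (T t))
       + iterint R is (\<lambda>x. \<beta> x - T t * D i x) (upd z i t)
      \<le> (b + d t) * iterint R is (\<lambda>x. F x powr \<gamma>) (upd z i t)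
        + (c * d t) * iterint K is (\<lambda>y. G y * \<psi> y) (upd z' i (T t)) + iterint R is \<phi> (upd z i t)
      + length is * (2 * K * \<eta> * (2 * R) ^ (length is - 1))"
    proof (rule Cons.IH)
      show "set is \<subseteq> Basis" "distinct is" using i by auto
      show "a * d t > 0" "c * d t > 0" using dpos Cons.prems by auto
      show "continuous_on UNIV (\<lambda>x. \<beta> x - T t * D i x)"
        by (intro continuous_intros Cons.prems cont i)
      show "iterint R is F (upd z i t) = c * d t * iterint K is G (upd z' i (T t))"
      proof -
        have "f t = d t * g (T t)" using gpos[of "T t"] by (simp add: d_def)
        then show ?thesis by (simp add: f_def g_def mult_ac)
      qed
    next
      fix s :: "'a \<Rightarrow> real" assume s: "\<And>k. s k > 0"
      have e: "(\<Prod>k\<in>set is. (s(i := d t)) k) = (\<Prod>k\<in>set is. s k)" "(\<Sum>k\<in>set is. (s(i := d t)) k) = (\<Sum>k\<in>set is. s k)"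
        using i by (auto intro!: prod.cong sum.cong)
      show "m * (a * d t * (\<Prod>k\<in>set is. s k)) powr (1 / m) \<le> b + d t + (\<Sum>k\<in>set is. s k)"
        using Cons.prems(6)[of "s(i := d t)"] s dpos i e by (simp add: mult.assoc add.assoc)
    next
      fix x y
      assume x: "\<forall>k\<in>Basis - set is. x \<bullet> k = upd z i t \<bullet> k"
        and y: "\<forall>k\<in>Basis - set is. y \<bullet> k = upd z' i (T t) \<bullet> k"
      have "\<beta> x - (\<Sum>k\<in>set (i # is). D k x * (y \<bullet> k)) \<le> F x * \<psi> y + \<phi> x"
        by (rule Cons.prems(8)) (use x y i in \<open>auto simp: upd_inner\<close>)
      moreover have "y \<bullet> i = T t" using y i by (auto simp: upd_inner)
      ultimately show "\<beta> x - T t * D i x - (\<Sum>k\<in>set is. D k x * (y \<bullet> k)) \<le> F x * \<psi> y + \<phi> x"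
        using i by (simp add: algebra_simps)
    qed
    moreover have "m * (a * d t) powr (1 / m) * (c * d t) powr \<gamma> * IH (T t) = m * a powr (1 / m) * c powr \<gamma> * (IH (T t) * d t)"
    proof -
      \<comment> \<open>Here the choice of \<open>\<gamma>\<close> matters: the two powers of
        \<open>d t\<close> combine to the density of the substitution by \<open>T\<close>.\<close>
      have "d t powr (1 / m) * d t powr \<gamma> = d t"
        using dpos[of t] by (simp add: \<gamma> powr_add[symmetric])
      then have "(a * d t) powr (1 / m) * (c * d t) powr \<gamma> = a powr (1 / m) * c powr \<gamma> * d t"
        using dpos[of t] Cons.prems by (simp add: powr_mult algebra_simps)
      then have "m * ((a * d t) powr (1 / m) * (c * d t) powr \<gamma>) * IH (T t) = m * (a powr (1 / m) * c powr \<gamma> * d t) * IH (T t)"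
        by (rule arg_cong)
      then show ?thesis by (simp only: mult_ac)
    qed
    moreover have "iterint R is (\<lambda>x. \<beta> x - T t * D i x) (upd z i t) = I\<beta> t - T t * ID t"
      unfolding I\<beta>_def ID_def
      by (subst iterint_diff) (intro continuous_intros Cons.prems cont i | simp add: iterint_cmult)+
    ultimately show ?thesis
      unfolding H_def[symmetric] E_def[symmetric] IH_def[symmetric] IG_def[symmetric] I\<phi>_def[symmetric] IE_def[symmetric] L_def[symmetric]
      by (simp only: distrib_right) argo
  qed
  have subst: "((\<lambda>t. J (T t) * d t) has_integral integral {-K..K} J) {-R..R}"
    if J: "continuous_on UNIV J" for J
  proof -
    define P where "P s = integral {-K..s} J" for s
    have dP: "(P has_real_derivative J s) (at s within {-K..K})" if "s \<in> {-K..K}" for s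
      unfolding P_def has_real_derivative_iff_has_vector_derivative
      by (rule integral_has_vector_derivative[OF continuous_on_subset[OF J] that]) auto
    have contP: "continuous_on {-K..K} P" by (rule DERIV_continuous_on[OF dP], assumption)
    \<comment> \<open>\<open>P\<close> has only one-sided derivatives at the ends of
      \<open>[-K, K]\<close>, so the chain rule needs \<open>T t\<close> strictly inside; strict
      monotonicity of \<open>T\<close> gives this.\<close>
    have TI: "T t \<in> {-K<..<K}" if t: "t \<in> {-R<..<R}" for t
    proof -
      have "T x < T y" if "-R \<le> x" "x < y" "y \<le> R" for x y
      proof (rule DERIV_pos_imp_increasing_open[OF that(2)])
        show "\<exists>w. (T has_real_derivative w) (at z) \<and> 0 < w" if "x < z" "z < y" for z
          using T(5)[of z] dpos[of z] that \<open>-R \<le> x\<close> \<open>y \<le> R\<close> by (auto simp: d_def intro!: exI)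
      qed (use that in \<open>auto intro: continuous_on_subset[OF T(1)]\<close>)
      from this[of "-R" t] this[of t R] show ?thesis using T t by auto
    qed
    have "((\<lambda>t. J (T t) * d t) has_integral (P (T R) - P (T (-R)))) {-R..R}"
    proof (rule fundamental_theorem_of_calculus_interior)
      show "continuous_on {-R..R} (\<lambda>t. P (T t))"
        by (rule continuous_on_compose2[OF contP T(1)]) (use T in auto)
      fix t assume t: "t \<in> {-R<..<R}"
      have "(P has_real_derivative J (T t)) (at (T t))"
        using dP[of "T t"] TI[OF t] at_within_interior[of "T t" "{-K..K}"] by auto
      from DERIV_chain2[OF this T(5)[OF t]]
      show "((\<lambda>t. P (T t)) has_vector_derivative J (T t) * d t) (at t)"
        by (simp add: d_def has_real_derivative_iff_has_vector_derivative)
    qed (use RK in auto)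
    then show ?thesis by (simp add: T P_def)
  qed
  \<comment> \<open>The integrand is the derivative of \<open>T t * IE t\<close>. What remains is
    the boundary value, where \<open>T\<close> is \<open>K\<close> or \<open>- K\<close>.\<close>
  have parts: "((\<lambda>t. d t * IE t + ID t * T t) has_integral (K * IE R + K * IE (-R))) {-R..R}"
  proof -
    have "((\<lambda>t. d t * IE t + ID t * T t) has_integral (T R * IE R - T (-R) * IE (-R))) {-R..R}"
    proof (rule fundamental_theorem_of_calculus_interior)
      show "continuous_on {-R..R} (\<lambda>t. T t * IE t)" by (intro continuous_intros T contI)
      fix t assume t: "t \<in> {-R<..<R}"
      have "(IE has_real_derivative ID t) (at t)"
        unfolding IE_def ID_def
        by (rule iterint_has_derivative[OF i(1-3) contE]) (use cont i deriv in \<open>auto simp: E_def\<close>)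
      from DERIV_mult[OF T(5)[OF t] this]
      show "((\<lambda>t. T t * IE t) has_vector_derivative d t * IE t + ID t * T t) (at t)"
        by (simp add: d_def has_real_derivative_iff_has_vector_derivative)
    qed (use RK in auto)
    then show ?thesis by (simp add: T)
  qed
  have face: "IE t \<le> \<eta> * (2 * R) ^ length is" if "\<bar>t\<bar> = R" for t
  proof -
    have "IE t \<le> iterint R is (\<lambda>x. \<eta>) (upd z i t)"
      unfolding IE_def
    proof (rule iterint_mono[OF i(2,4) contE])
      fix x assume "\<forall>k\<in>Basis - set is. x \<bullet> k = upd z i t \<bullet> k"
      then have "x \<bullet> i = t" using i by (auto simp: upd_inner)
      then show "E x \<le> \<eta>" unfolding E_def using bdry[OF i(1)] that by simp
    qed simp
    then show ?thesis using RK by (simp add: iterint_const)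
  qed
  have int: "h integrable_on {-R..R}" if "continuous_on UNIV h" for h :: "real \<Rightarrow> real"
    using that by (intro integrable_continuous_interval) (auto intro: continuous_on_subset)
  note hi = integrable_integral[OF int]
  have "m * a powr (1 / m) * c powr \<gamma> * integral {-K..K} IH + integral {-R..R} I\<beta>
    \<le> b * integral {-R..R} IE + c * integral {-K..K} IG + integral {-R..R} I\<phi> + L * (2 * R)
      + (K * IE R + K * IE (-R))"
  proof (rule has_integral_le)
    show "((\<lambda>t. m * a powr (1 / m) * c powr \<gamma> * (IH (T t) * d t) + I\<beta> t) has_integral
        m * a powr (1 / m) * c powr \<gamma> * integral {-K..K} IH + integral {-R..R} I\<beta>) {-R..R}"
      by (intro has_integral_add has_integral_mult_right subst hi contI)
    have "((\<lambda>t. L) has_integral L * (2 * R)) {-R..R}"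
      using has_integral_const_real[of L "-R" R] RK by (simp add: mult.commute)
    then show "((\<lambda>t. b * IE t + c * (IG (T t) * d t) + I\<phi> t + L + (d t * IE t + ID t * T t)) has_integral
        (b * integral {-R..R} IE + c * integral {-K..K} IG + integral {-R..R} I\<phi> + L * (2 * R)
      + (K * IE R + K * IE (-R)))) {-R..R}"
      by (intro has_integral_add has_integral_mult_right subst parts hi contI)
  qed (use step in auto)
  also have "K * IE R + K * IE (-R) \<le> 2 * K * \<eta> * (2 * R) ^ length is"
  proof -
    have "K * IE R + K * IE (-R) \<le> K * (\<eta> * (2 * R) ^ length is) + K * (\<eta> * (2 * R) ^ length is)"
      using RK by (intro add_mono mult_left_mono face) auto
    then show ?thesis by (simp add: algebra_simps)
  qed
  \<comment> \<open>For an empty list the factor \<open>length is\<close> is 0, which hides the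
    truncated subtraction in the exponent.\<close>
  also have "L * (2 * R) = length is * (2 * K * \<eta> * (2 * R) ^ length is)"
    by (cases "is") (simp_all add: L_def)
  finally show ?case
    by (simp add: IH_def[abs_def] H_def[abs_def] IG_def[abs_def] I\<phi>_def[abs_def] I\<beta>_def[abs_def] IE_def[abs_def] E_def[abs_def] algebra_simps)
qed

text \<open>The number 1 enters with the real weight \<open>m - card S\<close>. With
  \<open>A\<close> the weighted mean, \<open>ln x \<le> x - 1\<close> is applied to each
  \<open>s k / A\<close> and to \<open>1 / A\<close>.\<close>

lemma amgm_weighted:
  fixes s :: "'b \<Rightarrow> real" and m :: real
  assumes "finite S" "m \<ge> card S" "m > 0" "\<And>k. s k > 0"
  shows "m * (\<Prod>k\<in>S. s k) powr (1 / m) \<le> m - card S + (\<Sum>k\<in>S. s k)"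
proof -
  define A where "A = (m - card S + (\<Sum>k\<in>S. s k)) / m"
  have "A > 0"
  proof (cases "S = {}")
    case False
    then have "(\<Sum>k\<in>S. s k) > 0" using assms by (intro sum_pos) auto
    then show ?thesis using assms by (simp add: A_def)
  qed (use assms in \<open>simp add: A_def\<close>)
  have ex: "ln x \<le> x - 1" if "x > 0" for x :: real using ln_le_minus_one[OF that] .
  have "ln (\<Prod>k\<in>S. s k) = (\<Sum>k\<in>S. ln (s k))"
    by (intro ln_prod) (metis assms(1,4) less_irrefl)+
  also have "\<dots> = (\<Sum>k\<in>S. ln (s k / A)) + card S * ln A"
  proof -
    have "ln (s k / A) = ln (s k) - ln A" for k
      using \<open>A > 0\<close> assms(4)[of k] by (simp add: ln_div)
    then show ?thesis by (simp add: sum_subtractf)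
  qed
  also have "(\<Sum>k\<in>S. ln (s k / A)) \<le> (\<Sum>k\<in>S. s k / A - 1)"
    using \<open>A > 0\<close> assms(4) by (intro sum_mono ex) auto
  also have "\<dots> = (\<Sum>k\<in>S. s k) / A - card S"
    by (simp add: sum_subtractf sum_divide_distrib)
  also have "\<dots> = (m - card S) * (1 - 1 / A)"
  proof -
    have "(\<Sum>k\<in>S. s k) = m * A - (m - card S)" using assms by (simp add: A_def)
    then show ?thesis using \<open>A > 0\<close> by (simp add: field_simps)
  qed
  also have "\<dots> \<le> (m - card S) * ln A"
    using ex[of "1 / A"] \<open>A > 0\<close> assms by (intro mult_left_mono) (auto simp: ln_div)
  finally have "ln (\<Prod>k\<in>S. s k) \<le> m * ln A" by (simp add: algebra_simps)
  then have "(1 / m) * ln (\<Prod>k\<in>S. s k) \<le> ln A" using assms by (simp add: field_simps)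
  then have "(\<Prod>k\<in>S. s k) powr (1 / m) \<le> A"
    using \<open>A > 0\<close> assms(4) prod_pos[of S s] by (simp add: powr_def ln_ge_iff)
  then show ?thesis using assms by (simp add: A_def field_simps)
qed

section \<open>Iterated integrals as Lebesgue integrals over cubes\<close>

lemma nn_integral_iterint:
  assumes f: "continuous_on UNIV f" "\<And>x. f x \<ge> 0"
  shows "set is \<subseteq> Basis \<Longrightarrow> distinct is \<Longrightarrow>
    (\<integral>\<^sup>+x. ennreal (f (z + (\<Sum>b\<in>set is. (x b - z \<bullet> b) *\<^sub>R b))) * (\<Prod>b\<in>set is. indicator {-R..R} (x b))
      \<partial>(\<Pi>\<^sub>M b\<in>set is. lborel)) = ennreal (iterint R is f z)"
proof (induction "is" arbitrary: z)
  case Nil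
  then show ?case by (simp add: space_PiM)
next
  case (Cons i "is")
  interpret product_sigma_finite "\<lambda>_::'a. lborel :: real measure" ..
  have i: "i \<in> Basis" "set is \<subseteq> Basis" "i \<notin> set is" "distinct is" using Cons.prems by auto
  have [measurable]: "f \<in> borel_measurable borel" using f by (intro borel_measurable_continuous_onI)
  have nonneg: "iterint R is f z \<ge> 0" for z
    by (induction "is" arbitrary: z) (auto intro!: f integral_nonneg integrable_iterint_upd)
  have "(\<integral>\<^sup>+x. ennreal (f (z + (\<Sum>b\<in>insert i (set is). (x b - z \<bullet> b) *\<^sub>R b))) * (\<Prod>b\<in>insert i (set is). indicator {-R..R} (x b))
      \<partial>(\<Pi>\<^sub>M b\<in>insert i (set is). lborel)) =
    (\<integral>\<^sup>+y. (\<integral>\<^sup>+x. ennreal (f (z + (\<Sum>b\<in>insert i (set is). ((x(i := y)) b - z \<bullet> b) *\<^sub>R b))) * (\<Prod>b\<in>insert i (set is). indicator {-R..R} ((x(i := y)) b))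
      \<partial>(\<Pi>\<^sub>M b\<in>set is. lborel)) \<partial>lborel)"
    by (rule product_nn_integral_insert_rev) (use i in measurable)
  also have "\<dots> = (\<integral>\<^sup>+y. (\<integral>\<^sup>+x. indicator {-R..R} y * (ennreal (f (upd z i y + (\<Sum>b\<in>set is. (x b - upd z i y \<bullet> b) *\<^sub>R b))) * (\<Prod>b\<in>set is. indicator {-R..R} (x b)))
      \<partial>(\<Pi>\<^sub>M b\<in>set is. lborel)) \<partial>lborel)"
  proof (intro nn_integral_cong)
    fix x y
    have "(\<Sum>b\<in>set is. ((x(i := y)) b - z \<bullet> b) *\<^sub>R b) = (\<Sum>b\<in>set is. (x b - upd z i y \<bullet> b) *\<^sub>R b)"
      using i by (intro sum.cong) (auto simp: upd_inner)
    moreover have "(\<Prod>b\<in>set is. indicator {-R..R} ((x(i := y)) b)) = (\<Prod>b\<in>set is. indicator {-R..R} (x b) :: ennreal)"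
      using i by (intro prod.cong) auto
    ultimately show "ennreal (f (z + (\<Sum>b\<in>insert i (set is). ((x(i := y)) b - z \<bullet> b) *\<^sub>R b))) * (\<Prod>b\<in>insert i (set is). indicator {-R..R} ((x(i := y)) b))
       = indicator {-R..R} y * (ennreal (f (upd z i y + (\<Sum>b\<in>set is. (x b - upd z i y \<bullet> b) *\<^sub>R b))) * (\<Prod>b\<in>set is. indicator {-R..R} (x b)))"
      using i by (simp add: upd_def add.assoc mult_ac)
  qed
  also have "\<dots> = (\<integral>\<^sup>+y. indicator {-R..R} y * ennreal (iterint R is f (upd z i y)) \<partial>lborel)"
    using i by (subst nn_integral_cmult) (simp_all add: Cons.IH)
  also have "\<dots> = (\<integral>\<^sup>+y. ennreal (indicator {-R..R} y * iterint R is f (upd z i y)) \<partial>lborel)"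
    by (intro nn_integral_cong) (auto simp: indicator_def)
  also have "\<dots> = ennreal (integral {-R..R} (\<lambda>y. iterint R is f (upd z i y)))"
  proof (rule nn_integral_has_integral_lborel)
    have "continuous_on UNIV (\<lambda>y. iterint R is f (upd z i y))" by (intro continuous_intros f)
    then show "(\<lambda>y. indicator {-R..R} y * iterint R is f (upd z i y)) \<in> borel_measurable borel"
      by (intro borel_measurable_times borel_measurable_indicator borel_measurable_continuous_onI) auto
    have "((\<lambda>y. if y \<in> {-R..R} then iterint R is f (upd z i y) else 0) has_integral integral {-R..R} (\<lambda>y. iterint R is f (upd z i y))) UNIV"
      unfolding has_integral_restrict_UNIV by (intro integrable_integral integrable_iterint_upd f)
    then show "((\<lambda>y. indicator {-R..R} y * iterint R is f (upd z i y)) has_integral integral {-R..R} (\<lambda>y. iterint R is f (upd z i y))) UNIV"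
      by (rule has_integral_eq[rotated]) (auto simp: indicator_def)
  qed (use nonneg in auto)
  finally show ?case by simp
qed

abbreviation cube :: "real \<Rightarrow> 'a::euclidean_space set" where
  "cube R \<equiv> cbox (- (R *\<^sub>R One)) (R *\<^sub>R One)"

lemma mem_cube: "x \<in> cube R \<longleftrightarrow> (\<forall>b\<in>Basis. \<bar>x \<bullet> b\<bar> \<le> R)"
  by (auto simp: mem_box abs_le_iff)

text \<open>Once the list exhausts \<open>Basis\<close>, the base point \<open>z\<close> is
  overwritten completely, so the value does not depend on it.\<close>

lemma cube_integral_iterint:
  assumes f: "continuous_on UNIV f" "\<And>x. f x \<ge> 0" and "is": "set is = Basis" "distinct is"
  shows "has_bochner_integral lborel (\<lambda>x. indicator (cube R) x * f x) (iterint R is f z)"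
proof -
  have [measurable]: "f \<in> borel_measurable borel" using f by (intro borel_measurable_continuous_onI)
  have nonneg: "iterint R is f z \<ge> 0" for z
    by (induction "is" arbitrary: z) (auto intro!: f integral_nonneg integrable_iterint_upd)
  have eq: "z + (\<Sum>b\<in>Basis. (x b - z \<bullet> b) *\<^sub>R b) = (\<Sum>b\<in>Basis. x b *\<^sub>R b)" for x :: "'a \<Rightarrow> real"
    by (simp add: scaleR_diff_left sum_subtractf euclidean_representation)
  have ind: "indicator (cube R) (\<Sum>b\<in>Basis. x b *\<^sub>R b :: 'a) = (\<Prod>b\<in>(Basis :: 'a set). indicator {-R..R} (x b) :: ennreal)" for x
  proof (cases "\<forall>b\<in>(Basis :: 'a set). x b \<in> {-R..R}")
    case True
    then have "(\<Prod>b\<in>(Basis :: 'a set). indicator {-R..R} (x b) :: ennreal) = (\<Prod>b\<in>(Basis :: 'a set). 1)"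
      by (intro prod.cong) auto
    then show ?thesis using True by (auto simp: indicator_def mem_box)
  next
    case False
    then obtain b where "b \<in> (Basis :: 'a set)" "x b \<notin> {-R..R}" by auto
    then have "(\<Prod>b\<in>(Basis :: 'a set). indicator {-R..R} (x b) :: ennreal) = 0"
      by (intro prod_zero bexI[of _ b]) auto
    then show ?thesis using False by (auto simp: indicator_def mem_box)
  qed
  have "(\<integral>\<^sup>+x. ennreal (f x) * indicator (cube R) x \<partial>lborel) = 
    (\<integral>\<^sup>+x. ennreal (f (\<Sum>b\<in>Basis. x b *\<^sub>R b)) * indicator (cube R) (\<Sum>b\<in>Basis. x b *\<^sub>R b :: 'a) \<partial>(\<Pi>\<^sub>M b\<in>Basis. lborel))"
    by (subst lborel_eq, subst nn_integral_distr) auto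
  also have "\<dots> = ennreal (iterint R is f z)"
    using nn_integral_iterint[OF f, of "is" z R] "is" by (simp only: eq ind)
  also have "(\<integral>\<^sup>+x. ennreal (f x) * indicator (cube R) x \<partial>lborel) = (\<integral>\<^sup>+x. ennreal (indicator (cube R) x * f x) \<partial>lborel)"
    by (intro nn_integral_cong) (auto simp: indicator_def)
  finally have "(\<integral>\<^sup>+x. ennreal (indicator (cube R) x * f x) \<partial>lborel) = ennreal (iterint R is f z)" .
  then show ?thesis
    by (intro has_bochner_integral_nn_integral) (auto simp: f nonneg)
qed

text \<open>The induction of \<open>knothe_inequality\<close> starts with \<open>a = 1\<close>,
  \<open>b = m - DIM('a)\<close> and \<open>\<beta> = 0\<close>; \<open>amgm_weighted\<close> is
  then the required relation between product and sum. The last summand accounts for the faces of the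
  source cube.\<close>

lemma euclidean_transport_inequality:
  fixes F G \<phi> \<psi> :: "'a::euclidean_space \<Rightarrow> real" and D :: "'a \<Rightarrow> 'a \<Rightarrow> real"
    and R K m \<gamma> \<eta> c :: real
  assumes RK: "R > 0" "K > 0" and m: "m \<ge> DIM('a)" and \<gamma>: "\<gamma> = 1 - 1 / m" and \<eta>: "\<eta> \<ge> 0" and c: "c > 0"
    and cont: "continuous_on UNIV F" "continuous_on UNIV G" "continuous_on UNIV \<phi>" "continuous_on UNIV \<psi>"
      "\<And>k. k \<in> Basis \<Longrightarrow> continuous_on UNIV (D k)"
    and pos: "\<And>x. F x > 0" "\<And>x. G x > 0"
    and nonneg: "\<And>x. \<phi> x \<ge> 0" "\<And>x. \<psi> x \<ge> 0"
    and deriv: "\<And>k z t. k \<in> Basis \<Longrightarrow>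
      ((\<lambda>t. F (upd z k t) powr \<gamma>) has_real_derivative D k (upd z k t)) (at t)"
    and bdry: "\<And>x k. k \<in> Basis \<Longrightarrow> \<bar>x \<bullet> k\<bar> = R \<Longrightarrow> F x powr \<gamma> \<le> \<eta>"
    and mass: "(\<integral>x. indicator (cube R) x * F x \<partial>lborel) = c * (\<integral>y. indicator (cube K) y * G y \<partial>lborel)"
    and hyp: "\<And>x y. - (\<Sum>k\<in>Basis. D k x * (y \<bullet> k)) \<le> F x * \<psi> y + \<phi> x"
  shows "m * c powr \<gamma> * (\<integral>y. indicator (cube K) y * G y powr \<gamma> \<partial>lborel)
    \<le> (m - DIM('a)) * (\<integral>x. indicator (cube R) x * F x powr \<gamma> \<partial>lborel)
      + c * (\<integral>y. indicator (cube K) y * (G y * \<psi> y) \<partial>lborel) + (\<integral>x. indicator (cube R) x * \<phi> x \<partial>lborel)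
      + DIM('a) * (2 * K * \<eta> * (2 * R) ^ (DIM('a) - 1))"
proof -
  obtain bs :: "'a list" where bs: "set bs = Basis" "distinct bs"
    using finite_distinct_list[OF finite_Basis] by blast
  then have len: "length bs = DIM('a)" using distinct_card by metis
  have m0: "m > 0" using m DIM_positive[where 'a='a] by linarith
  have I: "(\<integral>x. indicator (cube R) x * f x \<partial>lborel) = iterint R bs f 0"
    if "continuous_on UNIV f" "\<And>x. f x \<ge> 0" for f and R :: real
    by (rule has_bochner_integral_integral_eq[OF cube_integral_iterint]) (use that bs in auto)
  have nz: "F x \<noteq> 0" "G x \<noteq> 0" for x using pos[of x] by auto
  have "m * 1 powr (1 / m) * c powr \<gamma> * iterint K bs (\<lambda>y. G y powr \<gamma>) 0 + iterint R bs (\<lambda>x. 0) 0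
    \<le> (m - DIM('a)) * iterint R bs (\<lambda>x. F x powr \<gamma>) 0 + c * iterint K bs (\<lambda>y. G y * \<psi> y) 0 + iterint R bs \<phi> 0
      + length bs * (2 * K * \<eta> * (2 * R) ^ (length bs - 1))"
  proof (rule knothe_inequality[OF RK m0 \<gamma> \<eta> cont pos deriv bdry])
    fix s :: "'a \<Rightarrow> real" assume "\<And>k. 0 < s k"
    then show "m * (1 * prod s (set bs)) powr (1 / m) \<le> m - real DIM('a) + sum s (set bs)"
      using amgm_weighted[of Basis m s] m m0 bs by simp
  next
    show "iterint R bs F 0 = c * iterint K bs G 0"
      using mass I[OF cont(1)] I[OF cont(2)] pos by (simp add: less_imp_le)
  qed (use bs hyp c in auto)
  moreover have "iterint R bs (\<lambda>x. 0) 0 = 0" using RK by (simp add: iterint_const)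
  moreover have "(\<integral>y. indicator (cube K) y * G y powr \<gamma> \<partial>lborel) = iterint K bs (\<lambda>y. G y powr \<gamma>) 0"
    "(\<integral>x. indicator (cube R) x * F x powr \<gamma> \<partial>lborel) = iterint R bs (\<lambda>y. F y powr \<gamma>) 0"
    using nz by (intro I continuous_intros cont; simp)+
  moreover have "(\<integral>y. indicator (cube K) y * (G y * \<psi> y) \<partial>lborel) = iterint K bs (\<lambda>y. G y * \<psi> y) 0"
    using pos nonneg by (intro I continuous_intros cont mult_nonneg_nonneg) (auto simp: less_imp_le)
  moreover have "(\<integral>x. indicator (cube R) x * \<phi> x \<partial>lborel) = iterint R bs \<phi> 0"
    using nonneg by (intro I cont)
  ultimately show ?thesis by (simp add: len)
qed

section \<open>Radial kernels\<close>

text \<open>The extremal profile is the case \<open>a = \<sigma>\<close>. Powers of kernels are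
  kernels, and the \<open>q\<close>-th and \<open>r\<close>-th powers of the profile have
  \<open>a = s\<close> and \<open>a = m\<close>.\<close>

definition kernel :: "real \<Rightarrow> real \<Rightarrow> real \<Rightarrow> real \<Rightarrow> real" where
  "kernel b a l t = (l + t powr b) powr (- a)"

text \<open>Minus the derivative of the kernel in \<open>t\<close>. It is the weight of the ball of
  radius \<open>t\<close> in the layer-cake formula and, for \<open>a = \<sigma>\<close>, the slope
  of the extremal profile.\<close>

definition kernel_density :: "real \<Rightarrow> real \<Rightarrow> real \<Rightarrow> real \<Rightarrow> real" where
  "kernel_density b a l t = a * b * t powr (b - 1) * (l + t powr b) powr (- a - 1)"

lemma kernel_pos: "l > 0 \<Longrightarrow> kernel b a l t > 0"
  using add_pos_nonneg[of l "t powr b"] by (simp add: kernel_def)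

lemma kernel_density_nonneg: "a > 0 \<Longrightarrow> b > 0 \<Longrightarrow> kernel_density b a l t \<ge> 0"
  by (simp add: kernel_density_def)

lemma measurable_kernel [measurable]:
  "kernel b a l \<in> borel_measurable borel" "kernel_density b a l \<in> borel_measurable borel"
  unfolding kernel_def[abs_def] kernel_density_def[abs_def] by measurable

text \<open>The absolute value makes the power an even function, so that a two-sided derivative
  exists at 0 too; it is 0 there because \<open>b > 1\<close>.\<close>

lemma has_derivative_abs_powr:
  fixes t :: real
  assumes "b > 1" "t \<ge> 0"
  shows "((\<lambda>x. \<bar>x\<bar> powr b) has_real_derivative b * t powr (b - 1)) (at t)"
proof (cases "t = 0")
  case True
  have "((\<lambda>h :: real. \<bar>h\<bar> powr (b - 1)) \<longlongrightarrow> 0) (at 0)"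
    by (rule tendsto_zero_powrI) (use assms in \<open>auto intro!: tendsto_eq_intros\<close>)
  then have "((\<lambda>h :: real. \<bar>h\<bar> powr b / h) \<longlongrightarrow> 0) (at 0)"
  proof (rule Lim_null_comparison[rotated])
    have "norm (\<bar>h\<bar> powr b / h) \<le> \<bar>h\<bar> powr (b - 1)" if "h \<noteq> 0" for h :: real
      using that by (simp add: powr_diff)
    then show "\<forall>\<^sub>F h in at 0. norm (\<bar>h\<bar> powr b / h) \<le> \<bar>h\<bar> powr (b - 1)"
      by (auto simp: eventually_at intro!: exI[of _ 1])
  qed
  then show ?thesis using True assms by (simp add: DERIV_def)
next
  case False
  then have t: "t > 0" using assms by simp
  have "((\<lambda>x. x powr b) has_real_derivative b * t powr (b - 1)) (at t)"
    using t by (rule has_real_derivative_powr)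
  then show ?thesis
    by (rule has_field_derivative_transform_within_open[of _ _ _ "{0<..}"]) (use t in auto)
qed

lemma has_derivative_kernel_abs:
  assumes b: "b > 1" and l: "l > 0" and t: "t \<ge> 0"
  shows "((\<lambda>t. kernel b a l \<bar>t\<bar>) has_real_derivative - kernel_density b a l t) (at t)"
proof -
  have pos: "l + \<bar>t\<bar> powr b > 0" using l by (simp add: add_pos_nonneg)
  have "((\<lambda>t. l + \<bar>t\<bar> powr b) has_real_derivative 0 + b * t powr (b - 1)) (at t)"
    using b t by (intro DERIV_add DERIV_const has_derivative_abs_powr) auto
  from DERIV_chain2[OF has_real_derivative_powr[OF pos, of "- a"] this]
  show ?thesis using t by (simp add: kernel_def kernel_density_def mult_ac)
qed

lemma kernel_layer:
  assumes b: "b > 1" and a: "a > 0" and l: "l > 0" and d: "d \<ge> 0"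
  shows "(\<integral>\<^sup>+t. ennreal (kernel_density b a l t) * indicator {d<..} t \<partial>lborel) = ennreal (kernel b a l d)"
proof -
  have "(\<integral>\<^sup>+t. ennreal (kernel_density b a l t) * indicator {d..} t \<partial>lborel) = ennreal (0 - (- kernel b a l \<bar>d\<bar>))"
    unfolding ennreal_minus[symmetric]
  proof (rule nn_integral_FTC_atLeast)
    fix t assume t: "d \<le> t"
    show "((\<lambda>t. - kernel b a l \<bar>t\<bar>) has_real_derivative kernel_density b a l t) (at t)"
      using DERIV_minus[OF has_derivative_kernel_abs[OF b l]] t d by simp
  next
    have "((\<lambda>t :: real. (l + \<bar>t\<bar> powr b) powr (- a)) \<longlongrightarrow> 0) at_top"
    proof (rule tendsto_neg_powr)
      have "filterlim (\<lambda>t :: real. l + t powr b) at_top at_top"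
        using b by (intro filterlim_tendsto_add_at_top[OF tendsto_const]) real_asymp
      then show "filterlim (\<lambda>t :: real. l + \<bar>t\<bar> powr b) at_top at_top"
        by (rule filterlim_mono_eventually) (auto intro: eventually_mono[OF eventually_ge_at_top[of 0]])
    qed (use a in auto)
    from tendsto_minus[OF this] show "((\<lambda>t. - kernel b a l \<bar>t\<bar>) \<longlongrightarrow> 0) at_top"
      by (simp add: kernel_def)
  qed (use a b in \<open>auto intro: kernel_density_nonneg\<close>)
  \<comment> \<open>The half-line without its endpoint fits open balls: a point at distance
    \<open>d\<close> lies in \<open>ball x0 t\<close> exactly for \<open>t > d\<close>.\<close>
  also have "(\<integral>\<^sup>+t. ennreal (kernel_density b a l t) * indicator {d..} t \<partial>lborel)
      = (\<integral>\<^sup>+t. ennreal (kernel_density b a l t) * indicator {d<..} t \<partial>lborel)"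
    by (intro nn_integral_cong_AE eventually_mono[OF AE_lborel_singleton[of d]]) (auto simp: indicator_def)
  finally show ?thesis using d by simp
qed

text \<open>Write \<open>f\<close> of the distance as an integral over the larger radii and exchange
  the integrals: the inner one becomes the measure of a ball. Radial integrals on \<open>X\<close>
  thus reduce to volumes of balls.\<close>

lemma nn_integral_layer:
  fixes M :: "'a::metric_space measure" and g f :: "real \<Rightarrow> real"
  assumes "sigma_finite_measure M" and sets: "sets M = sets borel"
    and [measurable]: "g \<in> borel_measurable borel"
    and layer: "\<And>d. d \<ge> 0 \<Longrightarrow> (\<integral>\<^sup>+t. ennreal (g t) * indicator {d<..} t \<partial>lborel) = ennreal (f d)"
  shows "(\<integral>\<^sup>+x. ennreal (f (dist x0 x)) \<partial>M) = (\<integral>\<^sup>+t. ennreal (g t) * emeasure M (ball x0 t) \<partial>lborel)"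
proof -
  interpret M: sigma_finite_measure M by fact
  interpret pair_sigma_finite M "lborel :: real measure" ..
  have [measurable]: "(\<lambda>x. dist x0 x) \<in> borel_measurable M"
    by (subst measurable_cong_sets[OF sets refl]) (intro borel_measurable_continuous_onI continuous_intros)
  have "(\<integral>\<^sup>+x. ennreal (f (dist x0 x)) \<partial>M) = (\<integral>\<^sup>+x. (\<integral>\<^sup>+t. ennreal (g t) * (if dist x0 x < t then 1 else 0) \<partial>lborel) \<partial>M)"
    by (intro nn_integral_cong, subst layer[symmetric]) (auto intro!: nn_integral_cong simp: indicator_def)
  also have "\<dots> = (\<integral>\<^sup>+t. (\<integral>\<^sup>+x. ennreal (g t) * (if dist x0 x < t then 1 else 0) \<partial>M) \<partial>lborel)"
    by (rule Fubini'[symmetric]) measurable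
  also have "\<dots> = (\<integral>\<^sup>+t. ennreal (g t) * emeasure M (ball x0 t) \<partial>lborel)"
  proof (intro nn_integral_cong)
    fix t
    have "(\<integral>\<^sup>+x. ennreal (g t) * (if dist x0 x < t then 1 else 0) \<partial>M) = ennreal (g t) * (\<integral>\<^sup>+x. indicator (ball x0 t) x \<partial>M)"
      by (subst nn_integral_cmult[symmetric], rule borel_measurable_indicator) (auto simp: sets intro!: nn_integral_cong)
    then show "(\<integral>\<^sup>+x. ennreal (g t) * (if dist x0 x < t then 1 else 0) \<partial>M) = ennreal (g t) * emeasure M (ball x0 t)"
      by (simp add: sets)
  qed
  finally show ?thesis .
qed

lemma nn_integral_kernel:
  fixes M :: "'a::metric_space measure"
  assumes "sigma_finite_measure M" "sets M = sets borel" "b > 1" "a > 0" "l > 0"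
  shows "(\<integral>\<^sup>+x. ennreal (kernel b a l (dist x0 x)) \<partial>M)
    = (\<integral>\<^sup>+t. ennreal (kernel_density b a l t) * emeasure M (ball x0 t) \<partial>lborel)"
  using assms by (intro nn_integral_layer kernel_layer) auto

lemma measurable_kernel_dist [measurable]:
  assumes "sets M = sets (borel :: 'a::metric_space measure)"
  shows "(\<lambda>x. kernel b a l (dist x0 x)) \<in> borel_measurable M"
proof -
  have [measurable]: "(\<lambda>x. dist x0 x) \<in> borel_measurable M"
    by (subst measurable_cong_sets[OF assms refl]) (intro borel_measurable_continuous_onI continuous_intros)
  show ?thesis by measurable
qed

text \<open>Differentiation under the integral sign: the derivative of the kernel in
  \<open>l\<close> is \<open>- a\<close> times the kernel with exponent \<open>a + 1\<close>, which
  is integrable as it is at most the original kernel divided by \<open>l\<close>.\<close>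

lemma has_derivative_integral_kernel:
  fixes M :: "'a::metric_space measure"
  assumes sets: "sets M = sets borel" and a: "a > 0" and l: "l > 0"
    and int: "\<And>l. l > 0 \<Longrightarrow> integrable M (\<lambda>x. kernel b a l (dist x0 x))"
  shows "integrable M (\<lambda>x. kernel b (a + 1) l (dist x0 x))"
    and "((\<lambda>l. \<integral>x. kernel b a l (dist x0 x) \<partial>M) has_real_derivative
       - a * (\<integral>x. kernel b (a + 1) l (dist x0 x) \<partial>M)) (at l)"
proof -
  note [measurable] = measurable_kernel_dist[OF sets]
  have int1: "integrable M (\<lambda>x. kernel b (a + 1) l (dist x0 x))" if "l > 0" for l
  proof (rule Bochner_Integration.integrable_bound)
    show "integrable M (\<lambda>x. kernel b a l (dist x0 x) / l)" using int[OF that] by simp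
    show "AE x in M. norm (kernel b (a + 1) l (dist x0 x)) \<le> norm (kernel b a l (dist x0 x) / l)"
    proof (intro AE_I2)
      fix x
      have y: "l + dist x0 x powr b \<ge> l" by simp
      then have "kernel b (a + 1) l (dist x0 x) = kernel b a l (dist x0 x) / (l + dist x0 x powr b)"
        using that by (simp add: kernel_def powr_diff powr_minus_divide field_simps powr_add)
      also have "\<dots> \<le> kernel b a l (dist x0 x) / l"
        using that y by (intro divide_left_mono mult_pos_pos add_pos_nonneg) (auto simp: less_imp_le kernel_pos)
      finally show "norm (kernel b (a + 1) l (dist x0 x)) \<le> norm (kernel b a l (dist x0 x) / l)"
        using that kernel_pos by (simp add: less_imp_le)
    qed
  qed measurable
  show "integrable M (\<lambda>x. kernel b (a + 1) l (dist x0 x))" by (rule int1[OF l])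
  have dk: "((\<lambda>l. kernel b a l t) has_real_derivative - a * kernel b (a + 1) l t) (at l)" if "l > 0" for l t
  proof -
    have "l + t powr b > 0" using that by (simp add: add_pos_nonneg)
    note D = has_real_derivative_powr[OF this, of "- a"]
    have "((\<lambda>l. l + t powr b) has_real_derivative 1) (at l)" by (auto intro!: derivative_eq_intros)
    from DERIV_chain2[OF D this] show ?thesis by (simp add: kernel_def)
  qed
  \<comment> \<open>For \<open>|h| < l / 2\<close> the parameter stays above \<open>l / 2\<close>,
    and there the derivative is bounded by its value at \<open>l / 2\<close>. This is the dominating
    function.\<close>
  have bound: "\<bar>(kernel b a (l + h) t - kernel b a l t) / h\<bar> \<le> a * kernel b (a + 1) (l / 2) t"
    if h: "\<bar>h\<bar> < l / 2" "h \<noteq> 0" for h t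
  proof -
    have anti: "kernel b (a + 1) y t \<le> kernel b (a + 1) (l / 2) t" if "y \<ge> l / 2" for y
      unfolding kernel_def using that l a by (intro powr_mono2') (auto simp: add_pos_nonneg)
    have "norm (kernel b a (l + h) t - kernel b a l t) \<le> (a * kernel b (a + 1) (l / 2) t) * norm (l + h - l)"
    proof (rule field_differentiable_bound[of "{l/2<..}"])
      fix y assume y: "y \<in> {l/2<..}"
      show "((\<lambda>l. kernel b a l t) has_field_derivative - a * kernel b (a + 1) y t) (at y within {l/2<..})"
        by (rule has_field_derivative_at_within[OF dk]) (use y l in auto)
      show "norm (- a * kernel b (a + 1) y t) \<le> a * kernel b (a + 1) (l / 2) t"
        using anti[of y] y a l kernel_pos[of y b "a + 1" t] by (simp add: abs_mult)
    qed (use h l in \<open>auto simp: abs_if split: if_splits\<close>)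
    then show ?thesis using h by (simp add: divide_simps)
  qed
  show "((\<lambda>l. \<integral>x. kernel b a l (dist x0 x) \<partial>M) has_real_derivative
       - a * (\<integral>x. kernel b (a + 1) l (dist x0 x) \<partial>M)) (at l)"
    unfolding DERIV_def LIMSEQ_SEQ_conv[symmetric]
  proof (intro allI impI, elim conjE)
    fix S :: "nat \<Rightarrow> real" assume S: "\<forall>n. S n \<noteq> 0" "S \<longlonglongrightarrow> 0"
    have "\<forall>\<^sub>F n in sequentially. \<bar>S n\<bar> < l / 2"
      using S(2)[unfolded tendsto_iff, rule_format, of "l / 2"] l by (simp add: dist_real_def)
    then obtain N where N: "\<And>n. n \<ge> N \<Longrightarrow> \<bar>S n\<bar> < l / 2" by (auto simp: eventually_sequentially)
    have "(\<lambda>n. \<integral>x. (kernel b a (l + S (n + N)) (dist x0 x) - kernel b a l (dist x0 x)) / S (n + N) \<partial>M)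
        \<longlonglongrightarrow> (\<integral>x. - a * kernel b (a + 1) l (dist x0 x) \<partial>M)"
    proof (rule integral_dominated_convergence)
      show "integrable M (\<lambda>x. a * kernel b (a + 1) (l / 2) (dist x0 x))" using int1[of "l / 2"] l by simp
      show "AE x in M. (\<lambda>n. (kernel b a (l + S (n + N)) (dist x0 x) - kernel b a l (dist x0 x)) / S (n + N))
          \<longlonglongrightarrow> - a * kernel b (a + 1) l (dist x0 x)"
      proof (intro AE_I2)
        fix x
        have "(\<lambda>n. (kernel b a (l + S n) (dist x0 x) - kernel b a l (dist x0 x)) / S n) \<longlonglongrightarrow> - a * kernel b (a + 1) l (dist x0 x)"
          using dk[OF l, of "dist x0 x", unfolded DERIV_def LIMSEQ_SEQ_conv[symmetric], rule_format, of S] S by blast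
        then show "(\<lambda>n. (kernel b a (l + S (n + N)) (dist x0 x) - kernel b a l (dist x0 x)) / S (n + N)) \<longlonglongrightarrow> - a * kernel b (a + 1) l (dist x0 x)"
          by (rule LIMSEQ_ignore_initial_segment)
      qed
      show "AE x in M. norm ((kernel b a (l + S (n + N)) (dist x0 x) - kernel b a l (dist x0 x)) / S (n + N))
         \<le> a * kernel b (a + 1) (l / 2) (dist x0 x)" for n
        using bound[OF N[of "n + N"]] S by auto
    qed measurable
    also have "(\<lambda>n. \<integral>x. (kernel b a (l + S (n + N)) (dist x0 x) - kernel b a l (dist x0 x)) / S (n + N) \<partial>M)
       = (\<lambda>n. ((\<integral>x. kernel b a (l + S (n + N)) (dist x0 x) \<partial>M) - (\<integral>x. kernel b a l (dist x0 x) \<partial>M)) / S (n + N))"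
    proof
      fix k
      have "l + S (k + N) > 0" using N[of "k + N"] l by (auto simp: abs_if split: if_splits)
      then show "(\<integral>x. (kernel b a (l + S (k + N)) (dist x0 x) - kernel b a l (dist x0 x)) / S (k + N) \<partial>M)
       = ((\<integral>x. kernel b a (l + S (k + N)) (dist x0 x) \<partial>M) - (\<integral>x. kernel b a l (dist x0 x) \<partial>M)) / S (k + N)"
        using int l by (simp add: Bochner_Integration.integral_diff)
    qed
    finally show "(\<lambda>n. ((\<integral>x. kernel b a (l + S n) (dist x0 x) \<partial>M) - (\<integral>x. kernel b a l (dist x0 x) \<partial>M)) / S n)
        \<longlonglongrightarrow> - a * (\<integral>x. kernel b (a + 1) l (dist x0 x) \<partial>M)"
      by (simp add: LIMSEQ_offset)
  qed
qed

section \<open>Kernels on Euclidean space: scaling and integrability\<close>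

lemma emeasure_ball_le0: "t \<le> 0 \<Longrightarrow> emeasure M (ball x t) = 0"
  by (simp add: ball_empty)

text \<open>After the layer-cake formula only the substitution of \<open>l powr (1 / b) * t\<close>
  for \<open>t\<close> in one dimension remains: \<open>l + t^b\<close> becomes
  \<open>l (1 + t^b)\<close>, and the volume of the ball gains the factor \<open>l^(n/b)\<close>
  with \<open>n = DIM('a)\<close>.\<close>

lemma euclidean_kernel_scale:
  fixes a b l :: real
  assumes b: "b > 1" and a: "a > 0" and l: "l > 0"
  shows "(\<integral>\<^sup>+y. ennreal (kernel b a l (dist 0 y)) \<partial>(lborel :: 'a::euclidean_space measure))
    = ennreal (l powr (DIM('a) / b - a)) * (\<integral>\<^sup>+y. ennreal (kernel b a 1 (dist 0 y)) \<partial>(lborel :: 'a measure))"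
proof -
  define \<omega> where "\<omega> = unit_ball_vol (real DIM('a))"
  have \<omega>: "\<omega> \<ge> 0" by (simp add: \<omega>_def)
  define V where "V t = (if t \<le> 0 then 0 else \<omega> * t ^ DIM('a))" for t
  have V: "emeasure lborel (ball (0 :: 'a) t) = ennreal (V t)" for t
    by (cases "t \<le> 0") (simp_all add: V_def emeasure_ball_le0 emeasure_ball \<omega>_def)
  have [measurable]: "V \<in> borel_measurable borel" unfolding V_def[abs_def] by measurable
  have V0: "V t \<ge> 0" for t using \<omega> by (simp add: V_def)
  have eq: "(\<integral>\<^sup>+y. ennreal (kernel b a l (dist 0 y)) \<partial>(lborel :: 'a measure))
    = (\<integral>\<^sup>+t. ennreal (kernel_density b a l t * V t) \<partial>lborel)" if "l > 0" for l
    using nn_integral_kernel[OF lborel.sigma_finite_measure_axioms sets_lborel b a that, of "0::'a"] V a b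
    by (simp add: ennreal_mult kernel_density_nonneg V0)
  define c where "c = l powr (1 / b)"
  have c: "c > 0" using l by (simp add: c_def)
  have cb: "c powr b = l" using l b by (simp add: c_def powr_powr)
  have "(\<integral>\<^sup>+t. ennreal (kernel_density b a l t * V t) \<partial>lborel)
    = ennreal \<bar>c\<bar> * (\<integral>\<^sup>+t. ennreal (kernel_density b a l (0 + c * t) * V (0 + c * t)) \<partial>lborel)"
    by (rule nn_integral_real_affine) (use c in auto)
  also have "\<dots> = (\<integral>\<^sup>+t. ennreal c * ennreal (kernel_density b a l (c * t) * V (c * t)) \<partial>lborel)"
    using c by (subst nn_integral_cmult[symmetric]) auto
  also have "\<dots> = (\<integral>\<^sup>+t. ennreal (l powr (DIM('a) / b - a)) * ennreal (kernel_density b a 1 t * V t) \<partial>lborel)"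
  proof (intro nn_integral_cong)
    fix t :: real
    have "c * (kernel_density b a l (c * t) * V (c * t)) = l powr (DIM('a) / b - a) * (kernel_density b a 1 t * V t)"
    proof (cases "t \<le> 0")
      case True
      then have "c * t \<le> 0" using c by (simp add: mult_nonneg_nonpos)
      then show ?thesis using True by (simp add: V_def)
    next
      case False
      then have t: "t > 0" "c * t > 0" using c by auto
      have 1: "(c * t) powr b = l * t powr b" by (simp add: powr_mult cb)
      have 2: "(l + (c * t) powr b) powr (- a - 1) = l powr (- a - 1) * (1 + t powr b) powr (- a - 1)"
        unfolding 1 powr_mult[symmetric] by (simp add: algebra_simps)
      have e1: "c ^ DIM('a) = l powr (DIM('a) / b)"
        using c l b by (simp add: powr_realpow[symmetric] c_def powr_powr)
      have e2: "c * (c * t) powr (b - 1) = l * t powr (b - 1)"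
      proof -
        have "c * c powr (b - 1) = l" using c by (simp add: powr_mult_base cb)
        then show ?thesis by (simp add: powr_mult)
      qed
      have e3: "l * (l powr (- a - 1) * l powr (DIM('a) / b)) = l powr (DIM('a) / b - a)"
      proof -
        have "l * (l powr (- a - 1) * l powr (DIM('a) / b)) = l powr 1 * (l powr (- a - 1) * l powr (DIM('a) / b))"
          using l by simp
        also have "\<dots> = l powr (DIM('a) / b - a)" by (simp only: powr_add[symmetric]) simp
        finally show ?thesis .
      qed
      have e4: "c * (kernel_density b a l (c * t) * V (c * t)) =
         a * b * (c * (c * t) powr (b - 1)) * l powr (- a - 1) * (1 + t powr b) powr (- a - 1) * (\<omega> * (c ^ DIM('a) * t ^ DIM('a)))"
      proof -
        have "V (c * t) = \<omega> * (c ^ DIM('a) * t ^ DIM('a))"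
          using not_le[THEN iffD2, OF t(2)] unfolding V_def by (simp only: if_False power_mult_distrib)
        then show ?thesis by (simp add: kernel_density_def 2)
      qed
      have e5: "l powr (DIM('a) / b - a) * (kernel_density b a 1 t * V t) =
         l powr (DIM('a) / b - a) * (a * b * t powr (b - 1) * (1 + t powr b) powr (- a - 1) * (\<omega> * t ^ DIM('a)))"
        using t by (simp add: kernel_density_def V_def)
      have "c * (kernel_density b a l (c * t) * V (c * t)) =
         (a * b * t powr (b - 1) * (1 + t powr b) powr (- a - 1) * (\<omega> * t ^ DIM('a)))
           * (l * (l powr (- a - 1) * l powr (DIM('a) / b)))"
        unfolding e4 unfolding e1 e2 by (simp only: mult_ac)
      then show ?thesis unfolding e3 e5 by (simp only: mult_ac)
    qed
    then show "ennreal c * ennreal (kernel_density b a l (c * t) * V (c * t))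
       = ennreal (l powr (DIM('a) / b - a)) * ennreal (kernel_density b a 1 t * V t)"
      using c by (simp add: ennreal_mult'[symmetric])
  qed
  also have "\<dots> = ennreal (l powr (DIM('a) / b - a)) * (\<integral>\<^sup>+t. ennreal (kernel_density b a 1 t * V t) \<partial>lborel)"
    by (rule nn_integral_cmult) measurable
  finally show ?thesis using eq l by simp
qed

text \<open>Split the radii at 1. Below, the volume is at most \<open>\<omega>\<close> and the
  density integrates to the kernel at 0; above, the integrand is at most a multiple of
  \<open>t powr (DIM('a) - 1 - a * b)\<close>, integrable because
  \<open>b * a > DIM('a)\<close>.\<close>

lemma euclidean_kernel_finite:
  fixes a b :: real
  assumes b: "b > 1" and a: "a > 0" "b * a > DIM('a)"
  shows "(\<integral>\<^sup>+y. ennreal (kernel b a 1 (dist 0 y)) \<partial>(lborel :: 'a::euclidean_space measure)) < \<infinity>"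
proof -
  define \<omega> where "\<omega> = unit_ball_vol (real DIM('a))"
  have \<omega>: "\<omega> \<ge> 0" by (simp add: \<omega>_def)
  define f where "f t = a * b * \<omega> * t powr (DIM('a) - 1 - a * b)" for t :: real
  have "(\<integral>\<^sup>+y. ennreal (kernel b a 1 (dist 0 y)) \<partial>(lborel :: 'a measure))
    = (\<integral>\<^sup>+t. ennreal (kernel_density b a 1 t) * emeasure lborel (ball (0 :: 'a) t) \<partial>lborel)"
    using a b by (intro nn_integral_kernel) (auto simp: lborel.sigma_finite_measure_axioms)
  also have "\<dots> \<le> (\<integral>\<^sup>+t. ennreal (kernel_density b a 1 t) * indicator {0<..} t * ennreal \<omega> + ennreal (indicator {1..} t * f t) \<partial>lborel)"
  proof (intro nn_integral_mono)
    fix t :: real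
    consider "t \<le> 0" | "0 < t" "t < 1" | "t \<ge> 1" by linarith
    then show "ennreal (kernel_density b a 1 t) * emeasure lborel (ball (0 :: 'a) t)
       \<le> ennreal (kernel_density b a 1 t) * indicator {0<..} t * ennreal \<omega> + ennreal (indicator {1..} t * f t)"
    proof cases
      case 2
      then have "\<omega> * t ^ DIM('a) \<le> \<omega> * 1" using \<omega> by (intro mult_left_mono power_le_one) auto
      then have "emeasure lborel (ball (0 :: 'a) t) \<le> ennreal \<omega>"
        using 2 by (auto simp: emeasure_ball \<omega>_def[symmetric] intro!: ennreal_leI)
      then show ?thesis using 2 by (auto intro!: mult_left_mono)
    next
      case 3
      have "kernel_density b a 1 t \<le> a * b * t powr (b - 1) * (t powr b) powr (- a - 1)"
        unfolding kernel_density_def using 3 a b by (intro mult_left_mono powr_mono2') auto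
      also have "\<dots> = a * b * (t powr (b - 1) * t powr (b * (- a - 1)))"
        by (simp add: powr_powr)
      also have "\<dots> = a * b * t powr (-1 - a * b)"
        by (simp add: powr_add[symmetric] algebra_simps)
      finally have "kernel_density b a 1 t * (\<omega> * t ^ DIM('a)) \<le> a * b * t powr (-1 - a * b) * (\<omega> * t ^ DIM('a))"
        using \<omega> 3 by (intro mult_right_mono) auto
      also have "t ^ DIM('a) = t powr DIM('a)" using 3 by (simp add: powr_realpow)
      also have "a * b * t powr (-1 - a * b) * (\<omega> * t powr DIM('a)) = a * b * \<omega> * (t powr (-1 - a * b) * t powr DIM('a))"
        by simp
      also have "t powr (-1 - a * b) * t powr DIM('a) = t powr (DIM('a) - 1 - a * b)"
        by (simp add: powr_add[symmetric] algebra_simps)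
      finally have "kernel_density b a 1 t * (\<omega> * t ^ DIM('a)) \<le> f t"
        using 3 by (simp add: f_def powr_realpow)
      then have "ennreal (kernel_density b a 1 t) * emeasure lborel (ball (0 :: 'a) t) \<le> ennreal (f t)"
        using 3 \<omega> a b by (simp add: emeasure_ball \<omega>_def[symmetric] ennreal_mult[symmetric] kernel_density_nonneg ennreal_leI)
      also have "\<dots> \<le> ennreal (kernel_density b a 1 t) * indicator {0<..} t * ennreal \<omega> + ennreal (indicator {1..} t * f t)"
        using 3 by simp
      finally show ?thesis .
    qed (simp add: emeasure_ball_le0)
  qed
  also have "\<dots> = ennreal (kernel b a 1 0) * ennreal \<omega> + (\<integral>\<^sup>+t. ennreal (indicator {1..} t * f t) \<partial>lborel)"
  proof -
    have [measurable]: "f \<in> borel_measurable borel" unfolding f_def[abs_def] by measurable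
    show ?thesis
      using a b by (subst nn_integral_add) (auto simp: nn_integral_multc kernel_layer)
  qed
  also have "(\<integral>\<^sup>+t. ennreal (indicator {1..} t * f t) \<partial>lborel) = ennreal (a * b * \<omega> * (- (1 powr (DIM('a) - 1 - a * b + 1)) / (DIM('a) - 1 - a * b + 1)))"
  proof (rule nn_integral_has_integral_lborel)
    have "(f has_integral a * b * \<omega> * (- (1 powr (DIM('a) - 1 - a * b + 1)) / (DIM('a) - 1 - a * b + 1))) {1..}"
      unfolding f_def using a by (intro has_integral_mult_right has_integral_powr_to_inf) (auto simp: mult.commute)
    then have "((\<lambda>t. if t \<in> {1..} then f t else 0) has_integral a * b * \<omega> * (- (1 powr (DIM('a) - 1 - a * b + 1)) / (DIM('a) - 1 - a * b + 1))) UNIV"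
      unfolding has_integral_restrict_UNIV .
    then show "((\<lambda>t. indicator {1..} t * f t) has_integral a * b * \<omega> * (- (1 powr (DIM('a) - 1 - a * b + 1)) / (DIM('a) - 1 - a * b + 1))) UNIV"
      by (rule has_integral_eq[rotated]) (auto simp: indicator_def)
  qed (use a b \<omega> in \<open>auto simp: f_def\<close>)
  also have "ennreal (kernel b a 1 0) * ennreal \<omega> + ennreal (a * b * \<omega> * (- (1 powr (DIM('a) - 1 - a * b + 1)) / (DIM('a) - 1 - a * b + 1))) < \<infinity>"
    by (simp add: ennreal_mult_less_top)
  finally show ?thesis .
qed

lemma euclidean_kernel_integral:
  fixes a b l :: real
  assumes b: "b > 1" and a: "a > 0" "b * a > DIM('a)" and l: "l > 0"
  shows "integrable lborel (\<lambda>y :: 'a::euclidean_space. kernel b a l (dist 0 y))"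
    and "(\<integral>y. kernel b a l (dist 0 y) \<partial>(lborel :: 'a measure))
      = l powr (DIM('a) / b - a) * (\<integral>y. kernel b a 1 (dist 0 y) \<partial>(lborel :: 'a measure))"
    and "(\<integral>y. kernel b a l (dist 0 y) \<partial>(lborel :: 'a measure)) > 0"
proof -
  note [measurable] = measurable_kernel_dist[of "lborel :: 'a measure", OF sets_lborel]
  have int: "integrable lborel (\<lambda>y :: 'a. kernel b a l (dist 0 y))" if "l > 0" for l
  proof (rule integrableI_nonneg)
    show "(\<integral>\<^sup>+y. ennreal (kernel b a l (dist 0 y)) \<partial>(lborel :: 'a measure)) < \<infinity>"
      unfolding euclidean_kernel_scale[OF b a(1) that]
      using euclidean_kernel_finite[OF b a] by (simp add: ennreal_mult_less_top)
  qed (auto simp: less_imp_le kernel_pos that)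
  show "integrable lborel (\<lambda>y :: 'a. kernel b a l (dist 0 y))" by (rule int[OF l])
  show "(\<integral>y. kernel b a l (dist 0 y) \<partial>(lborel :: 'a measure))
      = l powr (DIM('a) / b - a) * (\<integral>y. kernel b a 1 (dist 0 y) \<partial>(lborel :: 'a measure))"
    using euclidean_kernel_scale[where 'a='a, OF b a(1) l] l
    by (simp add: integral_eq_nn_integral less_imp_le kernel_pos enn2real_mult)
  have "(\<integral>y. kernel b a l (dist 0 y) \<partial>(lborel :: 'a measure)) \<noteq> 0"
  proof
    assume "(\<integral>y. kernel b a l (dist 0 y) \<partial>(lborel :: 'a measure)) = 0"
    then have "AE y in (lborel :: 'a measure). kernel b a l (dist 0 y) = 0"
      using int[OF l] l by (subst (asm) integral_nonneg_eq_0_iff_AE) (auto simp: less_imp_le kernel_pos)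
    then have "AE y in (lborel :: 'a measure). False"
      by eventually_elim (metis kernel_pos l less_irrefl)
    then show False by (simp add: eventually_False ae_filter_eq_bot_iff)
  qed
  moreover have "(\<integral>y. kernel b a l (dist 0 y) \<partial>(lborel :: 'a measure)) \<ge> 0"
    using l by (intro integral_nonneg_AE) (simp add: less_imp_le kernel_pos)
  ultimately show "(\<integral>y. kernel b a l (dist 0 y) \<partial>(lborel :: 'a measure)) > 0" by simp
qed

section \<open>Exponents\<close>

locale gn_exponents =
  fixes n :: nat and p q :: real
  assumes p: "1 < p" "p < real n" and q: "p < q" "q \<le> p * (real n - 1) / (real n - p)"
begin

text \<open>\<open>b\<close> is conjugate to \<open>p\<close>, and \<open>\<sigma>\<close> is the
  exponent of the profile, with \<open>s = \<sigma> * q\<close> and \<open>m = \<sigma> * r\<close>.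
  The Euclidean integral of the kernel with exponent \<open>s\<close> is a multiple of
  \<open>l powr (- e)\<close>. The identities below express the exponents of the theorem by these
  numbers, for example \<open>\<theta> = n / (r * e)\<close>.\<close>

definition "b = p / (p - 1)"
definition "s = q * (p - 1) / (q - p)"
definition "m = s + 1"
definition "e = s - real n / b"
definition "r = p * ((q - 1) / (p - 1))"
definition "\<sigma> = (p - 1) / (q - p)"
definition "\<theta> = (q - p) * real n / ((q - 1) * (real n * p - (real n - p) * q))"

lemma b_gt_1: "b > 1" using p by (simp add: b_def)

lemma b_conj: "1 / p + 1 / b = 1" using p by (simp add: b_def field_simps)

lemma n_conj: "real n / p + real n / b = real n"
  using b_conj by (metis distrib_left mult.right_neutral times_divide_eq_right)

lemma s_pos: "s > 0" using p q by (simp add: s_def)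

lemma q_sub: "q * (real n - p) \<le> p * (real n - 1)" using p q by (simp add: field_simps)

text \<open>This is the upper bound on \<open>q\<close> rewritten: it makes the weight in
  \<open>amgm_weighted\<close> nonnegative.\<close>

lemma m_ge_n: "m \<ge> real n"
  using p q q_sub by (simp add: m_def s_def field_simps)

lemma m_gt_1: "m > 1" using s_pos by (simp add: m_def)

lemma e_eq: "e = (real n * p - (real n - p) * q) * (p - 1) / (p * (q - p))"
  using p q by (simp add: e_def s_def b_def field_simps)

text \<open>By \<open>q_sub\<close> the difference is at least \<open>p\<close>.\<close>

lemma denom_pos: "real n * p - (real n - p) * q > 0"
  using q_sub p by (simp add: algebra_simps)

lemma e_pos: "e > 0"
  unfolding e_eq using denom_pos p q by simp

lemma r_pos: "r > 0"
  using p q by (simp add: r_def)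

lemma m_eq: "m = p * (q - 1) / (q - p)"
  using p q by (simp add: m_def s_def field_simps)

text \<open>With \<open>\<gamma> = 1 - 1 / m\<close> this says that the power
  \<open>\<gamma>\<close> of the density \<open>|f|^r\<close> is \<open>|f|^q\<close>.\<close>

lemma r_q: "r * (1 - 1 / m) = q"
proof -
  have "r / m = (q - p) / (p - 1)" using p q by (simp add: r_def m_eq)
  then have "r * (1 - 1 / m) = r - (q - p) / (p - 1)" by (simp add: algebra_simps)
  also have "\<dots> = (p * (q - 1) - (q - p)) / (p - 1)"
    unfolding r_def times_divide_eq_right by (rule diff_divide_distrib[symmetric])
  also have "p * (q - 1) - (q - p) = q * (p - 1)" by (simp add: algebra_simps)
  finally show ?thesis using p by simp
qed

text \<open>Young's inequality raises \<open>|f|^(q-1) |y|\<close> to the power \<open>b\<close>;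
  the result is \<open>|f|^r |y|^b\<close>, the source density times a weight on the target
  side.\<close>

lemma qb: "(q - 1) * b = r" using p by (simp add: r_def b_def)

lemma sigma_q: "\<sigma> * q = s" by (simp add: \<sigma>_def s_def)

lemma sigma_r: "\<sigma> * r = m"
  using p q by (simp add: \<sigma>_def r_def m_eq)

lemma theta_re: "\<theta> * (r * e) = real n"
proof -
  have "r * e = (q - 1) * (real n * p - (real n - p) * q) / (q - p)"
    using p q by (simp add: r_def e_eq)
  then show ?thesis using p q denom_pos by (simp add: \<theta>_def)
qed

lemma theta_eq: "\<theta> = real n / (r * e)"
  using theta_re r_pos e_pos by (simp add: field_simps)

lemma one_minus_theta: "(1 - \<theta>) / q = (m - real n) / (r * e)"
proof -
  have "r * e - real n = q * (m - real n)"
  proof -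
    have "r * e = r * s - real n * (r / b)" by (simp add: e_def right_diff_distrib)
    moreover have "r * s = q * m" using r_q m_gt_1 by (simp add: m_def field_simps)
    moreover have "r / b = q - 1" using qb b_gt_1 by (simp add: field_simps)
    ultimately show ?thesis by (simp add: algebra_simps)
  qed
  moreover have "1 - \<theta> = (r * e - real n) / (r * e)"
    using r_pos e_pos by (simp add: theta_eq diff_divide_distrib)
  ultimately show ?thesis using p q by simp
qed

lemma bs_gt_n: "b * s > real n"
  using e_pos b_gt_1 by (simp add: e_def field_simps)

lemma bm_gt_n: "b * m > real n"
  using bs_gt_n b_gt_1 by (simp add: m_def algebra_simps)

end

definition kernel_mass :: "'a::euclidean_space itself \<Rightarrow> real \<Rightarrow> real \<Rightarrow> real" where
  "kernel_mass (_ :: 'a itself) b a = (\<integral>y. kernel b a 1 (dist 0 y) \<partial>(lborel :: 'a measure))"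

lemma young_weighted:
  fixes p b x y \<tau> :: real
  assumes "p > 1" "b > 1" "1 / p + 1 / b = 1" "x \<ge> 0" "y \<ge> 0" "\<tau> > 0"
  shows "x * y \<le> \<tau> powr p / p * x powr p + \<tau> powr (- b) / b * y powr b"
proof -
  have "x * y = (\<tau> * x) * (y / \<tau>)" using assms by simp
  also have "\<dots> \<le> (\<tau> * x) powr p / p + (y / \<tau>) powr b / b"
    using assms by (intro Youngs_inequality) auto
  also have "\<dots> = \<tau> powr p / p * x powr p + \<tau> powr (- b) / b * y powr b"
    by (simp add: powr_mult powr_divide powr_minus_divide)
  finally show ?thesis .
qed

section \<open>Limits of integrals over cubes and of regularised powers\<close>

lemma tendsto_integral_cube:
  fixes h :: "'a::euclidean_space \<Rightarrow> real"
  assumes "integrable lborel h"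
  shows "(\<lambda>j. \<integral>x. indicator (cube (real j + 1)) x * h x \<partial>lborel) \<longlonglongrightarrow> (\<integral>x. h x \<partial>lborel)"
proof (rule integral_dominated_convergence[where w = "\<lambda>x. norm (h x)"])
  note [measurable] = borel_measurable_integrable[OF assms]
  show "h \<in> borel_measurable lborel" "(\<lambda>x. indicator (cube (real j + 1)) x * h x) \<in> borel_measurable lborel" for j
    by measurable
  show "integrable lborel (\<lambda>x. norm (h x))" using assms by simp
  show "AE x in lborel. (\<lambda>j. indicator (cube (real j + 1)) x * h x) \<longlonglongrightarrow> h x"
  proof (intro AE_I2 tendsto_eventually)
    fix x :: 'a
    obtain N :: nat where N: "norm x \<le> real N" using real_arch_simple by blast
    show "\<forall>\<^sub>F j in sequentially. indicator (cube (real j + 1)) x * h x = h x"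
      unfolding eventually_sequentially
    proof (intro exI[of _ N] allI impI)
      fix j assume "j \<ge> N"
      then have "\<bar>x \<bullet> k\<bar> \<le> real j + 1" if "k \<in> Basis" for k
        using Basis_le_norm[OF that, of x] N by linarith
      then show "indicator (cube (real j + 1)) x * h x = h x" by (simp add: mem_cube)
    qed
  qed
qed (auto simp: indicator_def)

text \<open>\<open>|f|^a\<close> is replaced by a positive function whose powers inherit the
  smoothness of \<open>f\<close>. Outside the cube the replacement is a positive constant, hence the
  indicator; inside, everything is bounded and the convergence is dominated.\<close>

lemma tendsto_integral_regularised:
  fixes f :: "'a::euclidean_space \<Rightarrow> real"
  assumes f: "continuous_on UNIV f" "\<And>x. x \<notin> cube R \<Longrightarrow> f x = 0" and a: "a > 0"
  shows "integrable lborel (\<lambda>x. \<bar>f x\<bar> powr a)"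
    and "(\<lambda>j. \<integral>x. indicator (cube R) x * ((f x)\<^sup>2 + (1 / (real j + 1))\<^sup>2) powr (a / 2) \<partial>lborel) \<longlonglongrightarrow> (\<integral>x. \<bar>f x\<bar> powr a \<partial>lborel)"
proof -
  have [measurable]: "f \<in> borel_measurable borel" using f by (intro borel_measurable_continuous_onI)
  have "bounded (f ` cube R)"
    by (intro compact_imp_bounded compact_continuous_image continuous_on_subset[OF f(1)]) auto
  then obtain B where B: "B > 0" "\<And>x. x \<in> cube R \<Longrightarrow> \<bar>f x\<bar> \<le> B"
    by (auto simp: bounded_pos)
  define C where "C = (B\<^sup>2 + 1) powr (a / 2)"
  have C: "((f x)\<^sup>2 + \<epsilon>) powr (a / 2) \<le> C" if "x \<in> cube R" "0 \<le> \<epsilon>" "\<epsilon> \<le> 1" for x \<epsilon>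
    unfolding C_def using that B(2)[OF that(1)] B(1) a abs_le_square_iff[of "f x" B]
    by (intro powr_mono2) auto
  have sq: "((f x)\<^sup>2) powr (a / 2) = \<bar>f x\<bar> powr a" for x
  proof -
    have "(f x)\<^sup>2 = \<bar>f x\<bar> powr 2" by simp
    then show ?thesis by (simp only: powr_powr) simp
  qed
  have intC: "integrable lborel (\<lambda>x :: 'a. indicator (cube R) x * C)"
    by (intro integrable_mult_left integrable_real_indicator) (auto simp: emeasure_lborel_cbox_eq)
  show int: "integrable lborel (\<lambda>x. \<bar>f x\<bar> powr a)"
  proof (rule Bochner_Integration.integrable_bound[OF intC])
    show "AE x in lborel. norm (\<bar>f x\<bar> powr a) \<le> norm (indicator (cube R) x * C)"
    proof (intro AE_I2)
      fix x show "norm (\<bar>f x\<bar> powr a) \<le> norm (indicator (cube R) x * C)"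
        using C[of x 0] f(2)[of x] a by (cases "x \<in> cube R") (auto simp: sq)
    qed
  qed measurable
  show "(\<lambda>j. \<integral>x. indicator (cube R) x * ((f x)\<^sup>2 + (1 / (real j + 1))\<^sup>2) powr (a / 2) \<partial>lborel) \<longlonglongrightarrow> (\<integral>x. \<bar>f x\<bar> powr a \<partial>lborel)"
  proof (rule integral_dominated_convergence[OF _ _ intC])
    show "AE x in lborel. (\<lambda>j. indicator (cube R) x * ((f x)\<^sup>2 + (1 / (real j + 1))\<^sup>2) powr (a / 2)) \<longlonglongrightarrow> \<bar>f x\<bar> powr a"
    proof (intro AE_I2)
      fix x
      have "(\<lambda>j. (f x)\<^sup>2 + (1 / (real j + 1))\<^sup>2) \<longlonglongrightarrow> (f x)\<^sup>2" by real_asymp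
      then have "(\<lambda>j. ((f x)\<^sup>2 + (1 / (real j + 1))\<^sup>2) powr (a / 2)) \<longlonglongrightarrow> ((f x)\<^sup>2) powr (a / 2)"
        using a by (intro tendsto_powr2 tendsto_const always_eventually) auto
      from tendsto_mult_left[OF this, of "indicator (cube R) x"]
      show "(\<lambda>j. indicator (cube R) x * ((f x)\<^sup>2 + (1 / (real j + 1))\<^sup>2) powr (a / 2)) \<longlonglongrightarrow> \<bar>f x\<bar> powr a"
        using f(2)[of x] by (cases "x \<in> cube R") (auto simp: sq)
    qed
    show "AE x in lborel. norm (indicator (cube R) x * ((f x)\<^sup>2 + (1 / (real j + 1))\<^sup>2) powr (a / 2)) \<le> indicator (cube R) x * C" for j
      using C[of _ "(1 / (real j + 1))\<^sup>2"] by (intro AE_I2) (auto simp: indicator_def power_le_one)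
  qed measurable
qed

context gn_exponents
begin

lemma euclidean_constants:
  assumes n: "n = DIM('a::euclidean_space)"
  shows "kernel_mass TYPE('a) b s > 0" "kernel_mass TYPE('a) b m > 0"
    "s * kernel_mass TYPE('a) b m = e * kernel_mass TYPE('a) b s"
    "\<And>l. l > 0 \<Longrightarrow> integrable lborel (\<lambda>y :: 'a. kernel b s l (dist 0 y))"
    "\<And>l. l > 0 \<Longrightarrow> integrable lborel (\<lambda>y :: 'a. kernel b m l (dist 0 y))"
    "\<And>l. l > 0 \<Longrightarrow> (\<integral>y. kernel b s l (dist 0 y) \<partial>(lborel :: 'a measure)) = l powr (- e) * kernel_mass TYPE('a) b s"
    "\<And>l. l > 0 \<Longrightarrow> (\<integral>y. kernel b m l (dist 0 y) \<partial>(lborel :: 'a measure)) = l powr (- e - 1) * kernel_mass TYPE('a) b m"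
proof -
  let ?A = "kernel_mass TYPE('a) b s" and ?B = "kernel_mass TYPE('a) b m"
  note Es = euclidean_kernel_integral[where 'a='a, OF b_gt_1 s_pos bs_gt_n[unfolded n]]
  have m0: "m > 0" using m_gt_1 by simp
  note Em = euclidean_kernel_integral[where 'a='a, OF b_gt_1 m0 bm_gt_n[unfolded n]]
  show "?A > 0" "?B > 0" using Es(3)[of 1] Em(3)[of 1] by (auto simp: kernel_mass_def)
  show int: "integrable lborel (\<lambda>y :: 'a. kernel b s l (dist 0 y))" "integrable lborel (\<lambda>y :: 'a. kernel b m l (dist 0 y))" if "l > 0" for l
    using Es(1) Em(1) that by auto
  show A: "(\<integral>y. kernel b s l (dist 0 y) \<partial>(lborel :: 'a measure)) = l powr (- e) * ?A" if "l > 0" for l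
    using Es(2)[OF that] by (simp add: kernel_mass_def e_def flip: n)
  show "(\<integral>y. kernel b m l (dist 0 y) \<partial>(lborel :: 'a measure)) = l powr (- e - 1) * ?B" if "l > 0" for l
    using Em(2)[OF that] by (simp add: kernel_mass_def e_def m_def algebra_simps flip: n)
  \<comment> \<open>The derivative at \<open>l = 1\<close> is computed twice: under the integral
    sign it is \<open>- s\<close> times the mass for \<open>m\<close>, by scaling it is
    \<open>- e\<close> times the mass for \<open>s\<close>.\<close>
  have "((\<lambda>l. \<integral>y. kernel b s l (dist 0 y) \<partial>(lborel :: 'a measure)) has_real_derivative - s * ?B) (at 1)"
    using has_derivative_integral_kernel(2)[OF sets_lborel s_pos _ int(1), of 1] by (simp add: kernel_mass_def m_def)
  then have "((\<lambda>l. l powr (- e) * ?A) has_real_derivative - s * ?B) (at 1)"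
    by (rule has_field_derivative_transform_within_open[of _ _ _ "{0<..}"]) (simp_all only: A greaterThan_iff zero_less_one open_greaterThan)
  moreover have "((\<lambda>l. l powr (- e) * ?A) has_real_derivative - e * ?A) (at 1)"
    by (auto intro!: derivative_eq_intros)
  ultimately show "s * ?B = e * ?A" using DERIV_unique by fastforce
qed

end

section \<open>The sharp inequality for test functions\<close>

lemma upd_vector_derivative: "((\<lambda>t. upd z k t) has_vector_derivative k) (at t)"
  unfolding upd_def by (auto intro!: derivative_eq_intros)

context gn_exponents
begin

text \<open>The transport inequality between \<open>F j\<close> and the kernel \<open>G\<close>, in
  the limit of large \<open>j\<close>. The index drives two limits at once: the regularisation
  \<open>1 / (j + 1)\<close> of \<open>|f|\<close> and the half side \<open>j + 1\<close> of the
  target cube.\<close>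

lemma gn_transport:
  fixes f :: "'a::euclidean_space \<Rightarrow> real" and g :: "'a \<Rightarrow> 'a" and R l \<tau> :: real
  assumes n: "n = DIM('a)"
    and f: "\<And>x. (f has_derivative (\<lambda>h. g x \<bullet> h)) (at x)" and g: "continuous_on UNIV g"
    and R: "R > 0" and supp: "\<And>x k. k \<in> Basis \<Longrightarrow> R \<le> \<bar>x \<bullet> k\<bar> \<Longrightarrow> f x = 0 \<and> g x = 0"
    and l: "l > 0" and \<tau>: "\<tau> > 0"
  defines "A \<equiv> l powr (- e) * kernel_mass TYPE('a) b s" and "B \<equiv> l powr (- e - 1) * kernel_mass TYPE('a) b m"
    and "N \<equiv> \<integral>x. \<bar>f x\<bar> powr r \<partial>lborel"
  shows "m * (N / B) powr (1 - 1 / m) * A \<le> (m - n) * (\<integral>x. \<bar>f x\<bar> powr q \<partial>lborel)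
      + N / B * (q * \<tau> powr (- b) / b * (A - l * B)) + q * \<tau> powr p / p * (\<integral>x. norm (g x) powr p \<partial>lborel)"
proof -
  note Ec = euclidean_constants[OF n]
  have A: "(\<integral>y. kernel b s l (dist 0 y) \<partial>(lborel :: 'a measure)) = A"
    and B: "(\<integral>y. kernel b m l (dist 0 y) \<partial>(lborel :: 'a measure)) = B"
    using Ec(6,7)[OF l] by (auto simp: A_def B_def)
  have Bpos: "B > 0" using Ec(2) l by (simp add: B_def)
  have cf: "continuous_on UNIV f"
    using f has_derivative_continuous continuous_at_imp_continuous_on by blast
  have [measurable]: "f \<in> borel_measurable borel" "g \<in> borel_measurable borel"
    using cf g by (auto intro: borel_measurable_continuous_onI)
  have outside: "f x = 0 \<and> g x = 0" if x: "x \<notin> cube R" for x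
  proof -
    obtain k where "k \<in> Basis" "\<bar>x \<bullet> k\<bar> > R" using x by (auto simp: mem_cube not_le)
    then show ?thesis using supp[of k x] by auto
  qed
  define G where "G y = kernel b m l (norm y)" for y :: 'a
  define \<psi> where "\<psi> y = q * \<tau> powr (- b) / b * norm y powr b" for y :: 'a
  define \<phi> where "\<phi> x = q * \<tau> powr p / p * norm (g x) powr p" for x
  define F where "F j x = ((f x)\<^sup>2 + (1 / (real j + 1))\<^sup>2) powr (r / 2)" for j x
  define D where "D j k x = q * ((f x)\<^sup>2 + (1 / (real j + 1))\<^sup>2) powr (q / 2 - 1) * f x * (g x \<bullet> k)" for j k x
  \<comment> \<open>The ratio that gives \<open>F j\<close> and \<open>c j * G\<close> equal mass on
    their cubes.\<close>
  define c where "c j = (\<integral>x. indicator (cube R) x * F j x \<partial>lborel) / (\<integral>y. indicator (cube (real j + 1)) y * G y \<partial>lborel)" for j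
  have \<gamma>: "r / 2 * (1 - 1 / m) = q / 2" using r_q by (metis mult.commute times_divide_eq_left)
  have wpos: "(f x)\<^sup>2 + (1 / (real j + 1))\<^sup>2 > 0" for x j
    by (intro add_nonneg_pos) auto
  have F\<gamma>: "F j x powr (1 - 1 / m) = ((f x)\<^sup>2 + (1 / (real j + 1))\<^sup>2) powr (q / 2)" for j x
    unfolding F_def powr_powr \<gamma> ..
  have Gpos: "G y > 0" for y unfolding G_def by (rule kernel_pos[OF l])
  have Fpos: "F j x > 0" for j x unfolding F_def using wpos[of x j] by simp
  have G\<gamma>: "G y powr (1 - 1 / m) = kernel b s l (norm y)" for y
  proof -
    have "- m * (1 - 1 / m) = - s" using m_gt_1 by (simp add: m_def field_simps)
    then show ?thesis unfolding G_def kernel_def powr_powr by simp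
  qed
  have powb: "continuous_on S (\<lambda>y :: 'a. norm y powr b)" for S
    using b_gt_1 by (intro continuous_on_powr' continuous_intros) auto
  have cG: "continuous_on UNIV G"
    unfolding G_def kernel_def using l
    by (intro continuous_on_powr powb continuous_intros) (metis add_pos_nonneg less_irrefl powr_ge_zero)
  have c\<psi>: "continuous_on UNIV \<psi>" unfolding \<psi>_def by (intro continuous_intros powb)
  have c\<phi>: "continuous_on UNIV \<phi>"
    unfolding \<phi>_def using p by (intro continuous_on_powr' continuous_intros g) auto
  have wne: "(f x)\<^sup>2 + (1 / (real j + 1))\<^sup>2 \<noteq> 0" for x j using wpos[of x j] by linarith
  have cF: "continuous_on UNIV (F j)" for j
    unfolding F_def using wne by (intro continuous_on_powr continuous_intros cf) auto
  have cD: "continuous_on UNIV (D j k)" for j k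
    unfolding D_def using wne by (intro continuous_on_powr continuous_intros cf g) auto
  have [measurable]: "G \<in> borel_measurable borel" "\<psi> \<in> borel_measurable borel"
    using cG c\<psi> by (auto intro: borel_measurable_continuous_onI)
  obtain bs :: "'a list" where bs: "set bs = Basis" "distinct bs"
    using finite_distinct_list[OF finite_Basis] by blast
  have cubepos: "(\<integral>x. indicator (cube L) x * h x \<partial>lborel) > 0"
    if "L > 0" "continuous_on UNIV h" "\<And>x. h x > 0" for h :: "'a \<Rightarrow> real" and L
    using has_bochner_integral_integral_eq[OF cube_integral_iterint[OF that(2) less_imp_le[OF that(3)] bs, of L 0]]
      iterint_pos[OF that, of bs 0] by simp
  have cpos: "c j > 0" for j
    unfolding c_def by (intro divide_pos_pos cubepos R cF Fpos cG Gpos) auto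
  have main: "m * c j powr (1 - 1 / m) * (\<integral>y. indicator (cube (real j + 1)) y * G y powr (1 - 1 / m) \<partial>lborel)
    \<le> (m - DIM('a)) * (\<integral>x. indicator (cube R) x * F j x powr (1 - 1 / m) \<partial>lborel)
      + c j * (\<integral>y. indicator (cube (real j + 1)) y * (G y * \<psi> y) \<partial>lborel) + (\<integral>x. indicator (cube R) x * \<phi> x \<partial>lborel)
      + DIM('a) * (2 * (real j + 1) * (1 / (real j + 1)) powr q * (2 * R) ^ (DIM('a) - 1))" for j
  proof (rule euclidean_transport_inequality[where D = "D j" and F = "F j"])
    show "(\<integral>x. indicator (cube R) x * F j x \<partial>lborel) = c j * (\<integral>y. indicator (cube (real j + 1)) y * G y \<partial>lborel)"
      using cubepos[OF _ cG Gpos, of "real j + 1"] by (simp add: c_def)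
    show "((\<lambda>t. F j (upd z k t) powr (1 - 1 / m)) has_real_derivative D j k (upd z k t)) (at t)" for z k t
    proof -
      have "((\<lambda>t. f (upd z k t)) has_derivative (\<lambda>h. g (upd z k t) \<bullet> (h *\<^sub>R k))) (at t)"
        by (rule has_derivative_compose[OF upd_vector_derivative[unfolded has_vector_derivative_def] f])
      then have df: "((\<lambda>t. f (upd z k t)) has_real_derivative g (upd z k t) \<bullet> k) (at t)"
        unfolding has_field_derivative_def by (rule has_derivative_eq_rhs) (auto simp: mult.commute)
      have "((\<lambda>t. (f (upd z k t))\<^sup>2 + (1 / (real j + 1))\<^sup>2) has_real_derivative 2 * f (upd z k t) * (g (upd z k t) \<bullet> k)) (at t)"
        by (auto intro!: derivative_eq_intros df)
      from DERIV_chain2[OF has_real_derivative_powr[OF wpos, of "q / 2"] this]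
      show ?thesis unfolding F\<gamma> D_def by (simp add: mult_ac)
    qed
    show "F j x powr (1 - 1 / m) \<le> (1 / (real j + 1)) powr q" if "k \<in> Basis" "\<bar>x \<bullet> k\<bar> = R" for x k
    proof -
      have "f x = 0" using supp[of k x] that by simp
      moreover have "((1 / (real j + 1))\<^sup>2) powr (q / 2) = (1 / (real j + 1)) powr q"
      proof -
        have "(1 / (real j + 1))\<^sup>2 = (1 / (real j + 1)) powr 2" by simp
        then show ?thesis by (simp only: powr_powr) simp
      qed
      ultimately show ?thesis unfolding F\<gamma> by simp
    qed
    \<comment> \<open>\<open>D j k\<close> is the partial derivative of
      \<open>w powr (q / 2)\<close>. Cauchy-Schwarz and \<open>|f| \<le> sqrt w\<close> leave
      \<open>q |g| w^((q-1)/2) |y|\<close>, which Young's inequality splits into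
      \<open>\<phi>\<close> and \<open>F j\<close> times \<open>\<psi>\<close>.\<close>
    show "- (\<Sum>k\<in>Basis. D j k x * (y \<bullet> k)) \<le> F j x * \<psi> y + \<phi> x" for x y
    proof -
      define w where "w = (f x)\<^sup>2 + (1 / (real j + 1))\<^sup>2"
      have w: "w > 0" using wpos by (simp add: w_def)
      have "(\<Sum>k\<in>Basis. D j k x * (y \<bullet> k)) = q * w powr (q / 2 - 1) * f x * (g x \<bullet> y)"
        unfolding D_def w_def[symmetric]
        by (subst euclidean_inner[of "g x" y]) (simp add: sum_distrib_left mult_ac)
      then have "- (\<Sum>k\<in>Basis. D j k x * (y \<bullet> k)) \<le> q * w powr (q / 2 - 1) * \<bar>f x\<bar> * \<bar>g x \<bullet> y\<bar>"
        using p q by (auto simp: abs_mult intro: order_trans[OF abs_ge_minus_self])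
      also have "\<dots> \<le> q * w powr (q / 2 - 1) * w powr (1 / 2) * (norm (g x) * norm y)"
      proof (intro mult_mono Cauchy_Schwarz_ineq2)
        have "\<bar>f x\<bar> = sqrt ((f x)\<^sup>2)" by simp
        also have "\<dots> \<le> sqrt w" by (intro real_sqrt_le_mono) (simp add: w_def)
        finally show "\<bar>f x\<bar> \<le> w powr (1 / 2)" using w by (simp add: powr_half_sqrt)
      qed (use p q in auto)
      also have "\<dots> = q * (norm (g x) * (w powr ((q - 1) / 2) * norm y))"
      proof -
        have "w powr (q / 2 - 1) * w powr (1 / 2) = w powr ((q - 1) / 2)"
          by (simp add: powr_add[symmetric] field_simps)
        then show ?thesis by (simp add: mult_ac)
      qed
      also have "\<dots> \<le> q * (\<tau> powr p / p * norm (g x) powr p + \<tau> powr (- b) / b * (w powr ((q - 1) / 2) * norm y) powr b)"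
        using p q b_gt_1 b_conj \<tau> by (intro mult_left_mono young_weighted) auto
      also have "(w powr ((q - 1) / 2) * norm y) powr b = F j x * norm y powr b"
      proof -
        have "(q - 1) / 2 * b = r / 2" using qb by simp
        then show ?thesis unfolding F_def w_def[symmetric] powr_mult powr_powr by simp
      qed
      finally show ?thesis by (simp add: \<phi>_def \<psi>_def algebra_simps)
    qed
  qed (use R m_ge_n n cF cG c\<phi> c\<psi> cD Fpos Gpos cpos p q b_gt_1 in \<open>auto simp: \<phi>_def \<psi>_def\<close>)
  have limN: "(\<lambda>j. \<integral>x. indicator (cube R) x * F j x \<partial>lborel) \<longlonglongrightarrow> N"
    unfolding F_def N_def using tendsto_integral_regularised(2)[OF cf _ r_pos, of R] outside by auto
  have limQ: "(\<lambda>j. \<integral>x. indicator (cube R) x * F j x powr (1 - 1 / m) \<partial>lborel) \<longlonglongrightarrow> (\<integral>x. \<bar>f x\<bar> powr q \<partial>lborel)"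
    unfolding F\<gamma> using tendsto_integral_regularised(2)[OF cf, of R q] outside p q by auto
  have limB: "(\<lambda>j. \<integral>y. indicator (cube (real j + 1)) y * G y \<partial>lborel) \<longlonglongrightarrow> B"
    using tendsto_integral_cube[OF Ec(5)[OF l]] B by (simp add: G_def)
  have limA: "(\<lambda>j. \<integral>y. indicator (cube (real j + 1)) y * G y powr (1 - 1 / m) \<partial>lborel) \<longlonglongrightarrow> A"
    unfolding G\<gamma> using tendsto_integral_cube[OF Ec(4)[OF l]] A by simp
  \<comment> \<open>Write \<open>|y|^b\<close> as \<open>(l + |y|^b) - l\<close>; the bracket lowers
    the exponent of the kernel from \<open>m\<close> to \<open>s = m - 1\<close>.\<close>
  have G\<psi>: "G y * \<psi> y = q * \<tau> powr (- b) / b * (kernel b s l (dist 0 y) - l * kernel b m l (dist 0 y))" for y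
  proof -
    have pos: "l + norm y powr b > 0" using l by (simp add: add_pos_nonneg)
    have "kernel b s l (norm y) = (l + norm y powr b) * kernel b m l (norm y)"
      using pos by (simp add: kernel_def m_def powr_mult_base)
    then have "kernel b s l (norm y) - l * kernel b m l (norm y) = norm y powr b * kernel b m l (norm y)"
      by (simp add: algebra_simps)
    then show ?thesis by (simp add: G_def \<psi>_def)
  qed
  have int\<psi>: "integrable lborel (\<lambda>y. G y * \<psi> y)"
    unfolding G\<psi> by (intro Bochner_Integration.integrable_diff integrable_mult_right Ec l)
  have "(\<integral>y. G y * \<psi> y \<partial>lborel) = q * \<tau> powr (- b) / b * (A - l * B)"
    unfolding G\<psi> using Ec(4,5)[OF l] A B by (simp add: Bochner_Integration.integral_diff)
  then have lim\<psi>: "(\<lambda>j. \<integral>y. indicator (cube (real j + 1)) y * (G y * \<psi> y) \<partial>lborel) \<longlonglongrightarrow> q * \<tau> powr (- b) / b * (A - l * B)"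
    using tendsto_integral_cube[OF int\<psi>] by simp
  have limc: "c \<longlonglongrightarrow> N / B"
    unfolding c_def using Bpos by (intro tendsto_divide limN limB) auto
  \<comment> \<open>The target cube grows like \<open>j\<close>, while
    \<open>F j powr (1 - 1 / m)\<close> equals \<open>(j + 1) powr (- q)\<close> on the faces of the
    source cube; the product tends to 0 because \<open>q > 1\<close>.\<close>
  have limbd: "(\<lambda>j. DIM('a) * (2 * (real j + 1) * (1 / (real j + 1)) powr q * (2 * R) ^ (DIM('a) - 1))) \<longlonglongrightarrow> 0"
  proof -
    have "(\<lambda>j. (real j + 1) * (1 / (real j + 1)) powr q) \<longlonglongrightarrow> 0"
    proof -
      have "(\<lambda>j. (real j + 1) powr (1 - q)) \<longlonglongrightarrow> 0"
        using p q by real_asymp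
      moreover have "(real j + 1) * (1 / (real j + 1)) powr q = (real j + 1) powr (1 - q)" for j
        by (simp add: powr_diff powr_divide)
      ultimately show ?thesis by simp
    qed
    from tendsto_mult_left[OF this, of "real DIM('a) * 2 * (2 * R) ^ (DIM('a) - 1)"]
    show ?thesis by (simp only: mult_ac mult_zero_left)
  qed
  have int\<phi>: "(\<integral>x. indicator (cube R) x * \<phi> x \<partial>lborel) = q * \<tau> powr p / p * (\<integral>x. norm (g x) powr p \<partial>lborel)"
  proof -
    have "(\<lambda>x. indicator (cube R) x * \<phi> x) = (\<lambda>x. q * \<tau> powr p / p * norm (g x) powr p)"
    proof
      fix x show "indicator (cube R) x * \<phi> x = q * \<tau> powr p / p * norm (g x) powr p"
        using outside[of x] by (cases "x \<in> cube R") (auto simp: \<phi>_def)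
    qed
    then show ?thesis by simp
  qed
  have "m * (N / B) powr (1 - 1 / m) * A \<le> (m - DIM('a)) * (\<integral>x. \<bar>f x\<bar> powr q \<partial>lborel)
      + N / B * (q * \<tau> powr (- b) / b * (A - l * B)) + q * \<tau> powr p / p * (\<integral>x. norm (g x) powr p \<partial>lborel) + 0"
  proof (rule LIMSEQ_le)
    show "(\<lambda>j. m * c j powr (1 - 1 / m) * (\<integral>y. indicator (cube (real j + 1)) y * G y powr (1 - 1 / m) \<partial>lborel))
       \<longlonglongrightarrow> m * (N / B) powr (1 - 1 / m) * A"
      using m_gt_1 cpos by (intro tendsto_mult tendsto_const limA tendsto_powr2 limc always_eventually) (auto simp: less_imp_le)
    show "(\<lambda>j. (m - DIM('a)) * (\<integral>x. indicator (cube R) x * F j x powr (1 - 1 / m) \<partial>lborel)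
      + c j * (\<integral>y. indicator (cube (real j + 1)) y * (G y * \<psi> y) \<partial>lborel) + (\<integral>x. indicator (cube R) x * \<phi> x \<partial>lborel)
      + DIM('a) * (2 * (real j + 1) * (1 / (real j + 1)) powr q * (2 * R) ^ (DIM('a) - 1)))
      \<longlonglongrightarrow> (m - DIM('a)) * (\<integral>x. \<bar>f x\<bar> powr q \<partial>lborel)
      + N / B * (q * \<tau> powr (- b) / b * (A - l * B)) + q * \<tau> powr p / p * (\<integral>x. norm (g x) powr p \<partial>lborel) + 0"
      unfolding int\<phi> by (intro tendsto_add tendsto_mult[OF tendsto_const limQ] tendsto_mult[OF limc lim\<psi>] tendsto_const limbd)
  qed (use main in auto)
  then show ?thesis by (simp add: n)
qed

end

section \<open>Optimisation over the two free parameters\<close>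

lemma optimise_young:
  fixes \<alpha> \<beta> p b X Z :: real
  assumes "p > 1" "b > 1" "1 / p + 1 / b = 1" "\<alpha> > 0" "\<beta> > 0"
    and le: "\<And>\<tau>. \<tau> > 0 \<Longrightarrow> X \<le> Z + \<alpha> * (\<tau> powr (- b) / b) + \<beta> * (\<tau> powr p / p)"
  shows "X \<le> Z + \<alpha> powr (1 / b) * \<beta> powr (1 / p)"
proof -
  \<comment> \<open>The minimiser: the derivative in \<open>\<tau>\<close> vanishes for
    \<open>\<tau>^(p + b) = \<alpha> / \<beta>\<close>, and \<open>p + b = p * b\<close> for
    conjugate exponents.\<close>
  define \<tau> where "\<tau> = (\<alpha> / \<beta>) powr (1 / (p * b))"
  have "1 / (p * b) * p = 1 / b" "1 / (p * b) * (- b) = - (1 / p)" using assms by auto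
  then have "\<tau> powr p = (\<alpha> / \<beta>) powr (1 / b)" "\<tau> powr (- b) = (\<alpha> / \<beta>) powr (- (1 / p))"
    unfolding \<tau>_def powr_powr by simp_all
  then have t: "\<tau> powr p = \<alpha> powr (1 / b) / \<beta> powr (1 / b)" "\<tau> powr (- b) = \<beta> powr (1 / p) / \<alpha> powr (1 / p)"
    by (simp_all add: powr_divide powr_minus_divide)
  have ab: "\<alpha> = \<alpha> powr (1 / b) * \<alpha> powr (1 / p)" "\<beta> = \<beta> powr (1 / b) * \<beta> powr (1 / p)"
    using assms by (simp_all add: powr_add[symmetric] add.commute)
  have "\<alpha> * (\<tau> powr (- b) / b) = \<alpha> powr (1 / b) * \<beta> powr (1 / p) * (1 / b)"
    unfolding t using assms ab(1) by (simp add: field_simps)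
  moreover have "\<beta> * (\<tau> powr p / p) = \<alpha> powr (1 / b) * \<beta> powr (1 / p) * (1 / p)"
    unfolding t using assms ab(2) by (simp add: field_simps)
  moreover have "\<alpha> powr (1 / b) * \<beta> powr (1 / p) * (1 / b) + \<alpha> powr (1 / b) * \<beta> powr (1 / p) * (1 / p)
     = \<alpha> powr (1 / b) * \<beta> powr (1 / p)"
    using assms(3) by (simp only: distrib_left[symmetric] add.commute mult_1_right)
  moreover have "\<tau> > 0" using assms by (simp add: \<tau>_def)
  ultimately show ?thesis using le[of \<tau>] by linarith
qed

lemma optimise_scale:
  fixes X Y Q m n :: real
  assumes "n > 0" "m \<ge> n" "X > 0" "Y > 0" "Q > 0"
    and le: "\<And>l. l > 0 \<Longrightarrow> m * (X * l powr (n / m)) \<le> (m - n) * Q + l * Y"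
  shows "X powr m * n powr n \<le> Q powr (m - n) * Y powr n"
proof (cases "m = n")
  case True
  \<comment> \<open>For \<open>m = n\<close> both sides are linear in \<open>l\<close>, so one value
    of \<open>l\<close> carries all the information.\<close>
  then have "n * X \<le> Y" using le[of 1] by simp
  then have "(n * X) powr n \<le> Y powr n" using assms by (intro powr_mono2) auto
  then show ?thesis using True assms by (simp add: powr_mult mult.commute)
next
  case False
  then have mn: "m > n" using assms by simp
  \<comment> \<open>The critical point of \<open>(m - n) Q + l Y - m X l^(n/m)\<close>. There
    \<open>l Y = n X l^(n/m)\<close>, and the hypothesis collapses to
    \<open>X l^(n/m) \<le> Q\<close>.\<close>
  define l where "l = (n * X / Y) powr (m / (m - n))"
  have z: "n * X / Y > 0" "n \<noteq> 0" "X \<noteq> 0" "Y \<noteq> 0" using assms by auto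
  have l: "l > 0" using z by (simp add: l_def)
  have e1: "l powr (n / m) = (n * X / Y) powr (n / (m - n))"
    using assms mn by (simp add: l_def powr_powr)
  have "m / (m - n) = 1 + n / (m - n)" using mn by (simp add: field_simps)
  then have "l = (n * X / Y) * (n * X / Y) powr (n / (m - n))"
    unfolding l_def using assms z by (simp add: powr_add)
  then have "l = n * X / Y * l powr (n / m)" unfolding e1 .
  then have "l * Y = n * X / Y * l powr (n / m) * Y" by (rule arg_cong)
  then have "l * Y = n * (X * l powr (n / m))" using assms by simp
  then have "(m - n) * (X * l powr (n / m)) \<le> (m - n) * Q"
    using le[OF l] by (simp add: algebra_simps)
  then have "X * (n * X / Y) powr (n / (m - n)) \<le> Q" using mn e1 by simp
  then have "(X * (n * X / Y) powr (n / (m - n))) powr (m - n) \<le> Q powr (m - n)"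
    using mn assms by (intro powr_mono2) auto
  also have "(X * (n * X / Y) powr (n / (m - n))) powr (m - n) = X powr (m - n) * (n * X / Y) powr n"
    using mn by (simp add: powr_mult powr_powr)
  also have "\<dots> = X powr m * n powr n / Y powr n"
    using assms by (simp add: powr_mult powr_divide powr_diff)
  finally show ?thesis using assms by (simp add: field_simps)
qed

text \<open>
  Written for \<open>\<integral> |u|\<^sup>r\<close>, \<open>\<integral> |\<nabla>u|\<^sup>p\<close> and \<open>\<integral> |u|\<^sup>q\<close> without the outer roots, the inequality has the
  exponents \<open>e\<close>, \<open>n/p\<close> and \<open>m - n\<close>; in this form no case distinction for \<open>\<theta> = 1\<close> arises, since
  then \<open>m = n\<close>. The constant below is the one for which the extremal profile attains equality.
\<close>

definition gn_power_const :: "'a::euclidean_space itself \<Rightarrow> real \<Rightarrow> real \<Rightarrow> real" where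
  "gn_power_const T p q = (let n = real DIM('a); b = gn_exponents.b p; s = gn_exponents.s p q;
     m = gn_exponents.m p q; e = gn_exponents.e DIM('a) p q; A = kernel_mass T b s; B = kernel_mass T b m in
     B powr e * q powr n * (A - B) powr (n / b) / (A powr m * n powr n))"

text \<open>\<open>gradient\<close> is a definite description, so it has to be identified with the
  vector representing the Frechet derivative, whose components are the values on the
  \<open>axis\<close> vectors. The support is described by coordinates to fit cubes.\<close>

lemma test_function_gradient:
  fixes f :: "real ^ 'n::finite \<Rightarrow> real"
  assumes "test_function f"
  shows "(f has_derivative (\<lambda>h. gradient f x \<bullet> h)) (at x)" "continuous_on UNIV (gradient f)"
    "\<exists>R>0. \<forall>x. \<forall>k\<in>Basis. R \<le> \<bar>x \<bullet> k\<bar> \<longrightarrow> f x = 0 \<and> gradient f x = 0"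
proof -
  have C1: "Ck (Suc 0) f" and supp: "compact (closure {x. f x \<noteq> 0})"
    using assms by (auto simp: test_function_def)
  then have diff: "f differentiable (at x)" and cont: "continuous_on UNIV (\<lambda>x. frechet_derivative f (at x) v)" for x v
    by auto
  have frechet: "(f has_derivative frechet_derivative f (at x)) (at x)" for x
    using diff frechet_derivative_works by blast
  define G where "G x = (\<chi> k. frechet_derivative f (at x) (axis k 1))" for x
  have inner: "G x \<bullet> h = frechet_derivative f (at x) h" for x h
  proof -
    have lin: "linear (frechet_derivative f (at x))" using frechet has_derivative_linear by blast
    have "frechet_derivative f (at x) h = frechet_derivative f (at x) (\<Sum>k\<in>UNIV. (h $ k) *\<^sub>R axis k 1)"
      using basis_expansion[of h] by (simp add: scalar_mult_eq_scaleR)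
    also have "\<dots> = (\<Sum>k\<in>UNIV. (h $ k) * frechet_derivative f (at x) (axis k 1))"
      by (simp add: linear_sum[OF lin] linear_cmul[OF lin])
    finally show ?thesis by (simp add: inner_vec_def G_def mult.commute)
  qed
  have D: "(f has_derivative (\<lambda>h. G x \<bullet> h)) (at x)" for x
    using frechet[of x] by (simp add: inner)
  have grad: "gradient f x = D" if "(f has_derivative (\<lambda>h. D \<bullet> h)) (at x)" for x D
    unfolding gradient_def
  proof (rule the_equality)
    show "GDERIV f x :> D" using that by (simp add: gderiv_def inner_commute)
    fix D' assume "GDERIV f x :> D'"
    then have "(f has_derivative (\<lambda>h. D' \<bullet> h)) (at x)" by (simp add: gderiv_def inner_commute)
    from has_derivative_unique[OF this that] have "\<forall>h. D' \<bullet> h = D \<bullet> h" by (metis)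
    then show "D' = D" by (simp only: vector_eq_rdot)
  qed
  have GG: "gradient f = G" using grad[OF D] by auto
  show "(f has_derivative (\<lambda>h. gradient f x \<bullet> h)) (at x)" using D GG by simp
  show "continuous_on UNIV (gradient f)"
    unfolding GG G_def by (intro continuous_on_vec_lambda cont)
  obtain R where R: "R > 0" "\<And>x. x \<in> closure {x. f x \<noteq> 0} \<Longrightarrow> norm x \<le> R"
    using compact_imp_bounded[OF supp] by (auto simp: bounded_pos)
  show "\<exists>R>0. \<forall>x. \<forall>k\<in>Basis. R \<le> \<bar>x \<bullet> k\<bar> \<longrightarrow> f x = 0 \<and> gradient f x = 0"
  proof (intro exI[of _ "R + 1"] conjI allI ballI impI)
    fix x k :: "real ^ 'n" assume "k \<in> Basis" "R + 1 \<le> \<bar>x \<bullet> k\<bar>"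
    then have "norm x > R" using Basis_le_norm[of k x] by linarith
    then have x: "x \<in> - closure {x. f x \<noteq> 0}" using R(2)[of x] by auto
    show "f x = 0" using x closure_subset[of "{x. f x \<noteq> 0}"] by auto
    have "((\<lambda>_. 0) has_derivative (\<lambda>h. (0 :: real ^ 'n) \<bullet> h)) (at x)" by simp
    then have "(f has_derivative (\<lambda>h. 0 \<bullet> h)) (at x)"
      by (rule has_derivative_transform_within_open[of _ _ _ _ "- closure {x. f x \<noteq> 0}"])
        (use x closure_subset[of "{x. f x \<noteq> 0}"] in auto)
    then show "gradient f x = 0" by (rule grad)
  qed (use R in auto)
qed

section \<open>From transport to the power form of the sharp inequality\<close>

context gn_exponents
begin

text \<open>The difference is the integral of \<open>|y|^b\<close> against the kernel with exponent
  \<open>m\<close>. Its value follows from the relation between the two masses and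
  \<open>b * (s - e) = n\<close>.\<close>

lemma kernel_mass_diff:
  assumes n: "n = DIM('a::euclidean_space)"
  shows "s * b * (kernel_mass TYPE('a) b s - kernel_mass TYPE('a) b m) = real n * kernel_mass TYPE('a) b s"
    and "kernel_mass TYPE('a) b s - kernel_mass TYPE('a) b m > 0"
proof -
  note Ec = euclidean_constants[OF n]
  have "s * b * (kernel_mass TYPE('a) b s - kernel_mass TYPE('a) b m) = b * (s * kernel_mass TYPE('a) b s - s * kernel_mass TYPE('a) b m)"
    by (simp add: algebra_simps)
  also have "\<dots> = b * (s - e) * kernel_mass TYPE('a) b s" unfolding Ec(3) by (simp add: algebra_simps)
  also have "b * (s - e) = real n" using b_gt_1 by (simp add: e_def)
  finally show eq: "s * b * (kernel_mass TYPE('a) b s - kernel_mass TYPE('a) b m) = real n * kernel_mass TYPE('a) b s" .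
  have "s * b * (kernel_mass TYPE('a) b s - kernel_mass TYPE('a) b m) > 0"
    unfolding eq using Ec(1) p by simp
  then show "kernel_mass TYPE('a) b s - kernel_mass TYPE('a) b m > 0"
    by (rule zero_less_mult_pos) (use s_pos b_gt_1 in simp)
qed

text \<open>\<open>P\<close> and \<open>Q\<close> are positive upper bounds in place of the
  integrals: the optimisations work with positive quantities, and the same \<open>P\<close> and
  \<open>Q\<close> will serve all late members of an approximating sequence.\<close>

lemma gn_smooth:
  fixes f :: "'a::euclidean_space \<Rightarrow> real" and g :: "'a \<Rightarrow> 'a" and R P Q :: real
  assumes n: "n = DIM('a)"
    and f: "\<And>x. (f has_derivative (\<lambda>h. g x \<bullet> h)) (at x)" and g: "continuous_on UNIV g"
    and R: "R > 0" and supp: "\<And>x k. k \<in> Basis \<Longrightarrow> R \<le> \<bar>x \<bullet> k\<bar> \<Longrightarrow> f x = 0 \<and> g x = 0"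
    and P: "(\<integral>x. norm (g x) powr p \<partial>lborel) \<le> P" "P > 0"
    and Q: "(\<integral>x. \<bar>f x\<bar> powr q \<partial>lborel) \<le> Q" "Q > 0"
  shows "(\<integral>x. \<bar>f x\<bar> powr r \<partial>lborel) powr e \<le> gn_power_const TYPE('a) p q * Q powr (m - n) * P powr (n / p)"
proof -
  note Ec = euclidean_constants[OF n]
  define A where "A = kernel_mass TYPE('a) b s"
  define B where "B = kernel_mass TYPE('a) b m"
  define N where "N = (\<integral>x. \<bar>f x\<bar> powr r \<partial>lborel)"
  have AB: "A > 0" "B > 0" "A - B > 0" using Ec(1,2) kernel_mass_diff(2)[OF n] by (auto simp: A_def B_def)
  have K: "gn_power_const TYPE('a) p q = B powr e * q powr n * (A - B) powr (n / b) / (A powr m * n powr n)"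
    by (simp add: gn_power_const_def Let_def A_def B_def n)
  have N0: "N \<ge> 0" by (simp add: N_def)
  show ?thesis
  proof (cases "N = 0")
    case True
    then show ?thesis using AB by (simp add: N_def[symmetric] K)
  next
    case False
    then have N: "N > 0" using N0 by simp
    define X where "X = (N / B) powr (1 - 1 / m) * A"
    define Y where "Y = q * ((N * (A - B) / B) powr (1 / b) * P powr (1 / p))"
    have q0: "q > 0" using p q by simp
    have m0: "m > 0" using m_gt_1 by simp
    have pre: "m * (X * l powr (n / m)) \<le> (m - n) * Q + l * Y" if l: "l > 0" for l
    proof -
      \<comment> \<open>The kernel parameter is \<open>l powr b\<close>, so that
        \<open>L powr (1 / b)\<close> is linear in \<open>l\<close>, as
        \<open>optimise_scale\<close> expects.\<close>
      define L where "L = l powr b"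
      have L: "L > 0" using l by (simp add: L_def)
      have Ll: "L powr (1 / b) = l" using l b_gt_1 by (simp add: L_def powr_powr)
      have L1: "L powr (- e) = L powr (- e - 1) * L"
        using L by (simp add: powr_diff)
      have XL: "m * (N / (L powr (- e - 1) * B)) powr (1 - 1 / m) * (L powr (- e) * A) = m * (X * l powr (n / m))"
      proof -
        have "(N / (L powr (- e - 1) * B)) powr (1 - 1 / m) = (N / B * L powr (e + 1)) powr (1 - 1 / m)"
        proof -
          have "- e - 1 = - (e + 1)" by simp
          then have "N / (L powr (- e - 1) * B) = N / B * L powr (e + 1)"
            by (simp only: powr_minus_divide) simp
          then show ?thesis by simp
        qed
        also have "\<dots> = (N / B) powr (1 - 1 / m) * L powr ((e + 1) * (1 - 1 / m))"
          by (simp only: powr_mult powr_powr)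
        finally have "m * (N / (L powr (- e - 1) * B)) powr (1 - 1 / m) * (L powr (- e) * A)
           = m * X * (L powr ((e + 1) * (1 - 1 / m)) * L powr (- e))" by (simp add: X_def)
        also have "L powr ((e + 1) * (1 - 1 / m)) * L powr (- e) = l powr (b * ((e + 1) * (1 - 1 / m) - e))"
          by (simp add: L_def powr_powr powr_add[symmetric] algebra_simps)
        also have "b * ((e + 1) * (1 - 1 / m) - e) = n / m"
        proof -
          have "(e + 1) * (1 - 1 / m) - e = (m - 1 - e) / m" using m0 by (simp add: field_simps)
          moreover have "b * (m - 1 - e) = n" using b_gt_1 by (simp add: m_def e_def)
          ultimately show ?thesis by simp
        qed
        finally show ?thesis by simp
      qed
      have ND: "N / (L powr (- e - 1) * B) * (L powr (- e) * A - L * (L powr (- e - 1) * B)) = L * (N * (A - B) / B)"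
        unfolding L1 using L AB by (simp add: field_simps)
      have "m * (X * l powr (n / m)) \<le> (m - n) * Q + (q * (L * (N * (A - B) / B))) powr (1 / b) * (q * P) powr (1 / p)"
      proof (rule optimise_young[OF p(1) b_gt_1 b_conj])
        fix \<tau> :: real assume \<tau>: "\<tau> > 0"
        have "m * (X * l powr (n / m)) \<le> (m - n) * (\<integral>x. \<bar>f x\<bar> powr q \<partial>lborel)
          + N / (L powr (- e - 1) * B) * (q * \<tau> powr (- b) / b * (L powr (- e) * A - L * (L powr (- e - 1) * B)))
          + q * \<tau> powr p / p * (\<integral>x. norm (g x) powr p \<partial>lborel)"
          using gn_transport[OF n f g R supp L \<tau>] unfolding XL[symmetric] A_def B_def N_def by simp
        also have "N / (L powr (- e - 1) * B) * (q * \<tau> powr (- b) / b * (L powr (- e) * A - L * (L powr (- e - 1) * B)))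
          = q * (N / (L powr (- e - 1) * B) * (L powr (- e) * A - L * (L powr (- e - 1) * B))) * (\<tau> powr (- b) / b)"
          by simp
        also have "\<dots> = q * (L * (N * (A - B) / B)) * (\<tau> powr (- b) / b)" unfolding ND ..
        also have "(m - n) * (\<integral>x. \<bar>f x\<bar> powr q \<partial>lborel) \<le> (m - n) * Q"
          using m_ge_n Q by (intro mult_left_mono) auto
        also have "q * \<tau> powr p / p * (\<integral>x. norm (g x) powr p \<partial>lborel) \<le> q * \<tau> powr p / p * P"
          using P p q0 by (intro mult_left_mono) auto
        finally show "m * (X * l powr (n / m)) \<le> (m - n) * Q + q * (L * (N * (A - B) / B)) * (\<tau> powr (- b) / b) + q * P * (\<tau> powr p / p)"
          by (simp add: mult_ac)
      qed (use L N AB P q0 in auto)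
      also have "(q * (L * (N * (A - B) / B))) powr (1 / b) * (q * P) powr (1 / p) = l * Y"
      proof -
        have "q powr (1 / b) * q powr (1 / p) = q"
          using b_conj q0 by (simp add: powr_add[symmetric] add.commute)
        moreover have "(q * (L * (N * (A - B) / B))) powr (1 / b) * (q * P) powr (1 / p)
            = (q powr (1 / b) * q powr (1 / p)) * (l * ((N * (A - B) / B) powr (1 / b) * P powr (1 / p)))"
          unfolding powr_mult[of q] powr_mult[of L] Ll by (simp only: mult_ac)
        ultimately show ?thesis by (simp add: Y_def)
      qed
      finally show ?thesis .
    qed
    have "X powr m * n powr n \<le> Q powr (m - n) * Y powr n"
      by (rule optimise_scale[OF _ m_ge_n _ _ _ pre]) (use p N AB P Q q0 in \<open>auto simp: X_def Y_def\<close>)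
    moreover have "X powr m = (N / B) powr e * (N / B) powr (n / b) * A powr m"
    proof -
      have "(1 - 1 / m) * m = e + n / b" using m0 by (simp add: m_def e_def field_simps)
      then show ?thesis by (simp add: X_def powr_mult powr_powr powr_add)
    qed
    moreover have "Y powr n = q powr n * ((N / B) powr (n / b) * (A - B) powr (n / b) * P powr (n / p))"
    proof -
      have "N * (A - B) / B = N / B * (A - B)" by simp
      then have "(N * (A - B) / B) powr (n / b) = (N / B) powr (n / b) * (A - B) powr (n / b)"
        by (simp only: powr_mult)
      then show ?thesis by (simp add: Y_def powr_mult powr_powr)
    qed
    \<comment> \<open>Because \<open>(1 - 1 / m) * m = e + n / b\<close>, both sides carry the
      factor \<open>(N / B) powr (n / b)\<close>. Cancelling it leaves the power \<open>e\<close> of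
      \<open>N\<close>.\<close>
    ultimately have "(N / B) powr (n / b) * ((N / B) powr e * (A powr m * n powr n))
      \<le> (N / B) powr (n / b) * (Q powr (m - n) * (q powr n * ((A - B) powr (n / b) * P powr (n / p))))"
      by (simp only: mult_ac)
    then have "(N / B) powr e * (A powr m * n powr n) \<le> Q powr (m - n) * (q powr n * ((A - B) powr (n / b) * P powr (n / p)))"
      using N AB by simp
    then have "N powr e * (A powr m * n powr n) \<le> B powr e * (Q powr (m - n) * (q powr n * ((A - B) powr (n / b) * P powr (n / p))))"
      using AB by (simp add: powr_divide field_simps)
    then show ?thesis
      using AB p unfolding N_def[symmetric] K by (simp add: field_simps)
  qed
qed

end

section \<open>Passage to the completion\<close>

text \<open>Convexity of the power at \<open>(1 - t) (x / (1 - t)) + t (y / t)\<close>. For small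
  \<open>t\<close> the coefficient of \<open>x powr a\<close> is close to 1, at the price of a large
  one for \<open>y powr a\<close>.\<close>

lemma powr_add_le:
  fixes x y a t :: real
  assumes "x \<ge> 0" "y \<ge> 0" "a \<ge> 1" "0 < t" "t < 1"
  shows "(x + y) powr a \<le> (1 - t) powr (1 - a) * x powr a + t powr (1 - a) * y powr a"
proof -
  have ge1: "c powr (1 - a) \<ge> 1" if "0 < c" "c < 1" for c :: real
    using powr_mono'[of "1 - a" 0 c] that assms by simp
  consider "x = 0" | "y = 0" | "x > 0" "y > 0" using assms by linarith
  then show ?thesis
  proof cases
    case 1
    then show ?thesis using ge1[of t] assms by (simp add: mult_le_cancel_right1)
  next
    case 2
    then show ?thesis using ge1[of "1 - t"] assms by (simp add: mult_le_cancel_right1)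
  next
    case 3
    have "((1 - t) *\<^sub>R (x / (1 - t)) + t *\<^sub>R (y / t)) powr a \<le> (1 - t) * (x / (1 - t)) powr a + t * (y / t) powr a"
      using 3 assms by (intro convex_onD[OF powr_convex[OF assms(3)]]) auto
    also have "(1 - t) * (x / (1 - t)) powr a = (1 - t) powr (1 - a) * x powr a"
      using assms by (simp add: powr_divide powr_diff)
    also have "t * (y / t) powr a = t powr (1 - a) * y powr a"
      using assms by (simp add: powr_divide powr_diff)
    finally show ?thesis using assms by simp
  qed
qed

text \<open>Convergence of the norms is stated as an eventual bound by every \<open>V\<close> above
  the integral of the limit; \<open>powr_add_le\<close> yields this directly for \<open>a\<close>-th
  powers, and it is the direction in which \<open>P\<close> and \<open>Q\<close> of
  \<open>gn_smooth\<close> are used.\<close>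

lemma Lp_limit:
  fixes v :: "nat \<Rightarrow> 'a \<Rightarrow> 'b::{real_normed_vector, second_countable_topology}"
  assumes a: "a \<ge> 1" and [measurable]: "\<And>k. v k \<in> borel_measurable M" "w \<in> borel_measurable M"
    and int: "\<And>k. integrable M (\<lambda>x. norm (v k x) powr a)"
    and lim: "(\<lambda>k. \<integral>\<^sup>+x. ennreal (norm (v k x - w x) powr a) \<partial>M) \<longlonglongrightarrow> 0"
  shows "integrable M (\<lambda>x. norm (w x) powr a)"
    and "\<And>V. V > (\<integral>x. norm (w x) powr a \<partial>M) \<Longrightarrow> \<forall>\<^sub>F k in sequentially. (\<integral>x. norm (v k x) powr a \<partial>M) \<le> V"
    and "\<exists>\<rho>. strict_mono \<rho> \<and> (AE x in M. (\<lambda>k. v (\<rho> k) x) \<longlonglongrightarrow> w x)"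
proof -
  define d where "d k = (\<integral>\<^sup>+x. ennreal (norm (v k x - w x) powr a) \<partial>M)" for k
  have "\<forall>\<^sub>F k in sequentially. d k < 1"
    using lim by (auto simp: d_def[symmetric] intro: order_tendstoD)
  then obtain K where K: "\<And>k. k \<ge> K \<Longrightarrow> d k < 1" by (auto simp: eventually_sequentially)
  have intd: "integrable M (\<lambda>x. norm (v k x - w x) powr a)" if "k \<ge> K" for k
  proof (rule integrableI_nonneg)
    show "(\<integral>\<^sup>+x. ennreal (norm (v k x - w x) powr a) \<partial>M) < \<infinity>"
      using K[OF that] unfolding d_def by (rule order_less_trans) simp
  qed auto
  define D where "D k = (\<integral>x. norm (v k x - w x) powr a \<partial>M)" for k
  have dD: "d k = ennreal (D k)" if "k \<ge> K" for k
    unfolding d_def D_def by (rule nn_integral_eq_integral[OF intd[OF that]]) simp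
  have limD: "D \<longlonglongrightarrow> 0"
  proof -
    have "(\<lambda>k. enn2real (d k)) \<longlonglongrightarrow> enn2real 0"
      using lim unfolding d_def[symmetric] by (intro tendsto_enn2real) auto
    moreover have "\<forall>\<^sub>F k in sequentially. enn2real (d k) = D k"
      using eventually_ge_at_top[of K] by eventually_elim (simp add: dD D_def)
    ultimately show ?thesis by (simp add: Lim_transform_eventually)
  qed
  have pert: "norm y powr a \<le> (1 - t) powr (1 - a) * norm z powr a + t powr (1 - a) * norm (y - z) powr a"
    if "0 < t" "t < 1" for t and y z :: 'b
  proof -
    have "norm y \<le> norm z + norm (y - z)" using norm_triangle_ineq[of z "y - z"] by simp
    then have "norm y powr a \<le> (norm z + norm (y - z)) powr a" using a by (intro powr_mono2) auto
    also have "\<dots> \<le> (1 - t) powr (1 - a) * norm z powr a + t powr (1 - a) * norm (y - z) powr a"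
      using a that by (intro powr_add_le) auto
    finally show ?thesis .
  qed
  show intw: "integrable M (\<lambda>x. norm (w x) powr a)"
  proof (rule Bochner_Integration.integrable_bound)
    show "integrable M (\<lambda>x. (1 - 1/2) powr (1 - a) * norm (v K x) powr a + (1/2) powr (1 - a) * norm (v K x - w x) powr a)"
      by (intro Bochner_Integration.integrable_add integrable_mult_right int intd) simp
    show "AE x in M. norm (norm (w x) powr a) \<le> norm ((1 - 1/2) powr (1 - a) * norm (v K x) powr a + (1/2) powr (1 - a) * norm (v K x - w x) powr a)"
      using pert[of "1/2" "w _" "v K _"] by (intro AE_I2) (simp add: norm_minus_commute)
  qed measurable
  show "\<exists>\<rho>. strict_mono \<rho> \<and> (AE x in M. (\<lambda>k. v (\<rho> k) x) \<longlonglongrightarrow> w x)"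
  proof -
    have "(\<lambda>k. D (k + K)) \<longlonglongrightarrow> 0" by (rule LIMSEQ_ignore_initial_segment[OF limD])
    then have "\<exists>\<rho>::nat \<Rightarrow> nat. strict_mono \<rho> \<and> (AE x in M. (\<lambda>k. norm (v (\<rho> k + K) x - w x) powr a) \<longlonglongrightarrow> 0)"
      using tendsto_L1_AE_subseq[of M "\<lambda>k x. norm (v (k + K) x - w x) powr a"] intd by (simp add: D_def)
    then obtain \<rho> :: "nat \<Rightarrow> nat" where \<rho>: "strict_mono \<rho>" "AE x in M. (\<lambda>k. norm (v (\<rho> k + K) x - w x) powr a) \<longlonglongrightarrow> 0"
      by blast
    have "AE x in M. (\<lambda>k. v (\<rho> k + K) x) \<longlonglongrightarrow> w x"
      using \<rho>(2)
    proof eventually_elim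
      fix x assume "(\<lambda>k. norm (v (\<rho> k + K) x - w x) powr a) \<longlonglongrightarrow> 0"
      then have "(\<lambda>k. (norm (v (\<rho> k + K) x - w x) powr a) powr (1 / a)) \<longlonglongrightarrow> 0"
        by (rule tendsto_zero_powrI[OF _ tendsto_const]) (use a in auto)
      then have "(\<lambda>k. norm (v (\<rho> k + K) x - w x)) \<longlonglongrightarrow> 0" using a by (simp add: powr_powr)
      then show "(\<lambda>k. v (\<rho> k + K) x) \<longlonglongrightarrow> w x" by (rule LIM_zero_cancel[OF tendsto_norm_zero_cancel])
    qed
    then show ?thesis using \<rho>(1) by (intro exI[of _ "\<lambda>k. \<rho> k + K"]) (simp add: strict_mono_def)
  qed
  fix V assume V: "V > (\<integral>x. norm (w x) powr a \<partial>M)"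
  define W where "W = (\<integral>x. norm (w x) powr a \<partial>M)"
  \<comment> \<open>First \<open>t\<close> is fixed so small that the main term stays below
    \<open>V\<close>; then \<open>k\<close> is taken so large that the error term fits into the
    gap.\<close>
  have "((\<lambda>t. (1 - t) powr (1 - a) * W) \<longlongrightarrow> (1 - 0) powr (1 - a) * W) (at_right 0)"
    by (intro tendsto_intros) auto
  then have "\<forall>\<^sub>F t in at_right (0::real). (1 - t) powr (1 - a) * W < V"
    using V by (intro order_tendstoD(2)) (auto simp: W_def)
  moreover have "\<forall>\<^sub>F t in at_right (0::real). t < 1 \<and> 0 < t"
    by (auto simp: eventually_at_right_field intro!: exI[of _ 1])
  ultimately have "\<forall>\<^sub>F t in at_right (0::real). (1 - t) powr (1 - a) * W < V \<and> 0 < t \<and> t < 1"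
    by eventually_elim auto
  then obtain t where t: "(1 - t) powr (1 - a) * W < V" "0 < t" "t < 1"
    using eventually_happens[of _ "at_right (0::real)"] by auto
  have "(\<lambda>k. (1 - t) powr (1 - a) * W + t powr (1 - a) * D k) \<longlonglongrightarrow> (1 - t) powr (1 - a) * W + t powr (1 - a) * 0"
    by (intro tendsto_intros limD)
  then have "\<forall>\<^sub>F k in sequentially. (1 - t) powr (1 - a) * W + t powr (1 - a) * D k < V"
    using t by (intro order_tendstoD(2)) auto
  then show "\<forall>\<^sub>F k in sequentially. (\<integral>x. norm (v k x) powr a \<partial>M) \<le> V"
    using eventually_ge_at_top[of K]
  proof eventually_elim
    fix k assume k: "(1 - t) powr (1 - a) * W + t powr (1 - a) * D k < V" "K \<le> k"
    have "(\<integral>x. norm (v k x) powr a \<partial>M) \<le> (\<integral>x. (1 - t) powr (1 - a) * norm (w x) powr a + t powr (1 - a) * norm (v k x - w x) powr a \<partial>M)"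
      using intw intd[OF k(2)] int t by (intro integral_mono pert) auto
    also have "\<dots> = (1 - t) powr (1 - a) * W + t powr (1 - a) * D k"
      using intw intd[OF k(2)] by (simp add: W_def D_def)
    finally show "(\<integral>x. norm (v k x) powr a \<partial>M) \<le> V" using k by simp
  qed
qed

context gn_exponents
begin

lemma gn_power_const_pos:
  assumes n: "n = DIM('a::euclidean_space)"
  shows "gn_power_const TYPE('a) p q > 0"
  using euclidean_constants(1,2)[OF n] kernel_mass_diff(2)[OF n] p q
  by (simp add: gn_power_const_def Let_def n)

text \<open>Strict bounds for the limit bound the approximating test functions eventually, so
  \<open>gn_smooth\<close> applies to them with a fixed right-hand side. Fatou's lemma along an
  almost everywhere convergent subsequence carries the bound to \<open>u\<close> and gives the
  integrability of \<open>|u|^r\<close>.\<close>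

lemma gn_Dpq_power:
  fixes u :: "real ^ 'n::finite \<Rightarrow> real" and g :: "real ^ 'n \<Rightarrow> real ^ 'n"
  assumes n: "n = CARD('n)" and ug: "(u, g) \<in> Dpq p q"
    and P: "P > (\<integral>x. norm (g x) powr p \<partial>lborel)" and Q: "Q > (\<integral>x. \<bar>u x\<bar> powr q \<partial>lborel)"
  shows "integrable lborel (\<lambda>x. \<bar>u x\<bar> powr r)"
    "(\<integral>x. \<bar>u x\<bar> powr r \<partial>lborel) powr e \<le> gn_power_const TYPE(real ^ 'n) p q * Q powr (m - n) * P powr (n / p)"
proof -
  have n': "n = DIM(real ^ 'n)" using n by simp
  from ug obtain f :: "nat \<Rightarrow> real ^ 'n \<Rightarrow> real" where
    f: "\<And>k. test_function (f k)"
    and limg: "(\<lambda>k. \<integral>\<^sup>+x. ennreal (norm (gradient (f k) x - g x) powr p) \<partial>lborel) \<longlonglongrightarrow> 0"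
    and limf: "(\<lambda>k. \<integral>\<^sup>+x. ennreal (\<bar>f k x - u x\<bar> powr q) \<partial>lborel) \<longlonglongrightarrow> 0"
    and meas: "u \<in> borel_measurable lborel" "g \<in> borel_measurable lborel"
    by (auto simp: Dpq_def)
  have [measurable]: "u \<in> borel_measurable borel" "g \<in> borel_measurable borel" using meas by auto
  note tf = test_function_gradient[OF f]
  have cf: "continuous_on UNIV (f k)" for k
    by (rule continuous_at_imp_continuous_on) (simp add: has_derivative_continuous[OF tf(1)])
  have mf [measurable]: "f k \<in> borel_measurable borel" "gradient (f k) \<in> borel_measurable borel" for k
    using cf tf(2) by (auto intro: borel_measurable_continuous_onI)
  have "\<forall>k. \<exists>R. R > 0 \<and> (\<forall>x. \<forall>i\<in>Basis. R \<le> \<bar>x \<bullet> i\<bar> \<longrightarrow> f k x = 0 \<and> gradient (f k) x = 0)"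
    using test_function_gradient(3)[OF f] by simp
  from choice[OF this] obtain R where "\<forall>k. R k > 0 \<and> (\<forall>x. \<forall>i\<in>Basis. R k \<le> \<bar>x \<bullet> i\<bar> \<longrightarrow> f k x = 0 \<and> gradient (f k) x = 0)" ..
  then have R: "\<And>k. R k > 0" "\<And>k x i. i \<in> Basis \<Longrightarrow> R k \<le> \<bar>x \<bullet> i\<bar> \<Longrightarrow> f k x = 0 \<and> gradient (f k) x = 0"
    by auto
  have out: "f k x = 0 \<and> gradient (f k) x = 0" if x: "x \<notin> cube (R k)" for k x
  proof -
    obtain i where "i \<in> Basis" "R k < \<bar>x \<bullet> i\<bar>" using x by (auto simp: mem_cube not_le)
    then show ?thesis using R(2)[of i k x] by simp
  qed
  have intf: "integrable lborel (\<lambda>x. \<bar>f k x\<bar> powr a)" if "a > 0" for k a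
    by (rule tendsto_integral_regularised(1)[OF cf _ that, of "R k"]) (simp add: out)
  have intg: "integrable lborel (\<lambda>x. norm (gradient (f k) x) powr p)" for k
  proof -
    have "continuous_on UNIV (\<lambda>x. norm (gradient (f k) x))" by (intro continuous_intros tf(2))
    then have "integrable lborel (\<lambda>x. \<bar>norm (gradient (f k) x)\<bar> powr p)"
      by (rule tendsto_integral_regularised(1)[where R = "R k"]) (use p out in auto)
    then show ?thesis by simp
  qed
  have P0: "P > 0" using P by (rule order_le_less_trans[rotated]) simp
  have Q0: "Q > 0" using Q by (rule order_le_less_trans[rotated]) simp
  have "\<forall>\<^sub>F k in sequentially. (\<integral>x. norm (gradient (f k) x) powr p \<partial>lborel) \<le> P"
    by (rule Lp_limit(2)[OF _ _ _ intg limg P]) (use p in auto)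
  moreover have "\<forall>\<^sub>F k in sequentially. (\<integral>x. norm (f k x) powr q \<partial>lborel) \<le> Q"
    by (rule Lp_limit(2)[where w = u]) (use p q Q limf intf in auto)
  ultimately have ev: "\<forall>\<^sub>F k in sequentially. (\<integral>x. \<bar>f k x\<bar> powr r \<partial>lborel) powr e
    \<le> gn_power_const TYPE(real ^ 'n) p q * Q powr (m - n) * P powr (n / p)"
  proof eventually_elim
    fix k assume k: "(\<integral>x. norm (gradient (f k) x) powr p \<partial>lborel) \<le> P" "(\<integral>x. norm (f k x) powr q \<partial>lborel) \<le> Q"
    show "(\<integral>x. \<bar>f k x\<bar> powr r \<partial>lborel) powr e \<le> gn_power_const TYPE(real ^ 'n) p q * Q powr (m - n) * P powr (n / p)"
      by (rule gn_smooth[OF n' tf(1,2) R(1)[of k] R(2) k(1) P0 _ Q0]) (use k in auto)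
  qed
  define C where "C = gn_power_const TYPE(real ^ 'n) p q * Q powr (m - n) * P powr (n / p)"
  have C: "C \<ge> 0" using gn_power_const_pos[OF n'] by (simp add: C_def)
  have ev': "\<forall>\<^sub>F k in sequentially. (\<integral>\<^sup>+x. ennreal (\<bar>f k x\<bar> powr r) \<partial>lborel) \<le> ennreal (C powr (1 / e))"
    using ev
  proof eventually_elim
    fix k assume "(\<integral>x. \<bar>f k x\<bar> powr r \<partial>lborel) powr e \<le> gn_power_const TYPE(real ^ 'n) p q * Q powr (m - n) * P powr (n / p)"
    then have "((\<integral>x. \<bar>f k x\<bar> powr r \<partial>lborel) powr e) powr (1 / e) \<le> C powr (1 / e)"
      unfolding C_def[symmetric] using e_pos by (intro powr_mono2) auto
    then have "(\<integral>x. \<bar>f k x\<bar> powr r \<partial>lborel) \<le> C powr (1 / e)" using e_pos by (simp add: powr_powr)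
    then show "(\<integral>\<^sup>+x. ennreal (\<bar>f k x\<bar> powr r) \<partial>lborel) \<le> ennreal (C powr (1 / e))"
      using nn_integral_eq_integral[OF intf[OF r_pos]] by (simp add: ennreal_leI)
  qed
  obtain \<rho> where \<rho>: "strict_mono \<rho>" "AE x in lborel. (\<lambda>k. f (\<rho> k) x) \<longlonglongrightarrow> u x"
    using Lp_limit(3)[of q f lborel u] p q limf intf by auto
  have "(\<integral>\<^sup>+x. ennreal (\<bar>u x\<bar> powr r) \<partial>lborel) = (\<integral>\<^sup>+x. liminf (\<lambda>k. ennreal (\<bar>f (\<rho> k) x\<bar> powr r)) \<partial>lborel)"
  proof (rule nn_integral_cong_AE)
    show "AE x in lborel. ennreal (\<bar>u x\<bar> powr r) = liminf (\<lambda>k. ennreal (\<bar>f (\<rho> k) x\<bar> powr r))"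
      using \<rho>(2)
    proof eventually_elim
      fix x assume "(\<lambda>k. f (\<rho> k) x) \<longlonglongrightarrow> u x"
      then have "(\<lambda>k. \<bar>f (\<rho> k) x\<bar>) \<longlonglongrightarrow> \<bar>u x\<bar>" by (rule tendsto_rabs)
      then have "(\<lambda>k. ennreal (\<bar>f (\<rho> k) x\<bar> powr r)) \<longlonglongrightarrow> ennreal (\<bar>u x\<bar> powr r)"
        using r_pos by (intro tendsto_ennrealI tendsto_powr2 tendsto_const) auto
      then show "ennreal (\<bar>u x\<bar> powr r) = liminf (\<lambda>k. ennreal (\<bar>f (\<rho> k) x\<bar> powr r))"
        by (rule lim_imp_Liminf[OF sequentially_bot, symmetric])
    qed
  qed
  also have "\<dots> \<le> liminf (\<lambda>k. \<integral>\<^sup>+x. ennreal (\<bar>f (\<rho> k) x\<bar> powr r) \<partial>lborel)"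
    by (rule nn_integral_liminf) measurable
  also have "\<dots> \<le> ennreal (C powr (1 / e))"
  proof (rule Liminf_le)
    show "\<forall>\<^sub>F k in sequentially. (\<integral>\<^sup>+x. ennreal (\<bar>f (\<rho> k) x\<bar> powr r) \<partial>lborel) \<le> ennreal (C powr (1 / e))"
      using eventually_subseq[OF \<rho>(1) ev'] .
  qed simp
  finally have le: "(\<integral>\<^sup>+x. ennreal (\<bar>u x\<bar> powr r) \<partial>lborel) \<le> ennreal (C powr (1 / e))" .
  show int: "integrable lborel (\<lambda>x. \<bar>u x\<bar> powr r)"
    by (rule integrableI_nonneg) (use le in \<open>auto intro: order_le_less_trans\<close>)
  have "(\<integral>x. \<bar>u x\<bar> powr r \<partial>lborel) \<le> C powr (1 / e)"
    using le nn_integral_eq_integral[OF int] by simp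
  then have "(\<integral>x. \<bar>u x\<bar> powr r \<partial>lborel) powr e \<le> (C powr (1 / e)) powr e"
    using e_pos by (intro powr_mono2) auto
  then show "(\<integral>x. \<bar>u x\<bar> powr r \<partial>lborel) powr e \<le> gn_power_const TYPE(real ^ 'n) p q * Q powr (m - n) * P powr (n / p)"
    using e_pos C by (simp add: powr_powr C_def[symmetric])
qed

lemma theta_1_iff: "\<theta> = 1 \<longleftrightarrow> m = real n"
proof -
  have "1 - \<theta> = q * ((m - n) / (r * e))" using one_minus_theta p q by (simp add: field_simps)
  then have "1 - \<theta> = 0 \<longleftrightarrow> m - n = 0" using p q r_pos e_pos by simp
  then show ?thesis by auto
qed

lemma gn_inequality_of_power:
  fixes N P Q K :: real
  assumes "N \<ge> 0" "P \<ge> 0" "Q \<ge> 0" "K \<ge> 0"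
    and le: "\<And>P' Q'. P' > P \<Longrightarrow> Q' > Q \<Longrightarrow> N powr e \<le> K * Q' powr (m - n) * P' powr (n / p)"
  shows "N powr (1 / r) \<le> K powr (1 / (r * e)) * P powr (\<theta> / p) * (if \<theta> = 1 then 1 else Q powr ((1 - \<theta>) / q))"
proof -
  have re: "1 / (r * e) > 0" using r_pos e_pos by simp
  \<comment> \<open>For \<open>\<theta> = 1\<close> the exponent \<open>m - n\<close> is 0, and
    \<open>Q powr 0\<close> would be 0 at \<open>Q = 0\<close>. The conventional factor 1 is the
    limit of \<open>Q' powr 0\<close> over \<open>Q' > 0\<close>.\<close>
  define Z where "Z = (if \<theta> = 1 then 1 else Q powr (m - n))"
  have "N powr e \<le> K * Z * P powr (n / p)"
  proof (rule tendsto_lowerbound)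
    show "((\<lambda>\<delta>. K * (if \<theta> = 1 then 1 else (Q + \<delta>) powr (m - n)) * (P + \<delta>) powr (n / p)) \<longlongrightarrow> K * Z * P powr (n / p)) (at_right 0)"
    proof (intro tendsto_mult tendsto_const)
      have *: "((\<lambda>\<delta>. (c + \<delta>) powr a) \<longlongrightarrow> c powr a) (at_right (0::real))" if "c \<ge> 0" "a > 0" for c a :: real
      proof (rule tendsto_powr2)
        show "((\<lambda>\<delta>. c + \<delta>) \<longlongrightarrow> c) (at_right 0)" by (auto intro!: tendsto_eq_intros)
        show "\<forall>\<^sub>F \<delta> in at_right 0. 0 \<le> c + \<delta>"
          using that by (auto simp: eventually_at_right_field intro!: exI[of _ 1])
      qed (use that in auto)
      show "((\<lambda>\<delta>. (P + \<delta>) powr (n / p)) \<longlongrightarrow> P powr (n / p)) (at_right 0)"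
        using assms p by (intro *) auto
      show "((\<lambda>\<delta>. if \<theta> = 1 then 1 else (Q + \<delta>) powr (m - n)) \<longlongrightarrow> Z) (at_right 0)"
        using assms m_ge_n theta_1_iff by (auto simp: Z_def intro!: *)
    qed
    show "\<forall>\<^sub>F \<delta> in at_right 0. N powr e \<le> K * (if \<theta> = 1 then 1 else (Q + \<delta>) powr (m - n)) * (P + \<delta>) powr (n / p)"
      unfolding eventually_at_right_field
    proof (intro exI[of _ 1] conjI allI impI)
      fix \<delta> :: real assume \<delta>: "0 < \<delta>" "\<delta> < 1"
      have "N powr e \<le> K * (Q + \<delta>) powr (m - n) * (P + \<delta>) powr (n / p)"
        by (rule le) (use \<delta> in auto)
      moreover have "(Q + \<delta>) powr (m - n) = 1" if "\<theta> = 1"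
        using that theta_1_iff assms(3) \<delta> by simp
      ultimately show "N powr e \<le> K * (if \<theta> = 1 then 1 else (Q + \<delta>) powr (m - n)) * (P + \<delta>) powr (n / p)"
        by (cases "\<theta> = 1") simp_all
    qed simp
  qed simp
  then have "(N powr e) powr (1 / (r * e)) \<le> (K * Z * P powr (n / p)) powr (1 / (r * e))"
    using re by (intro powr_mono2) auto
  also have "(N powr e) powr (1 / (r * e)) = N powr (1 / r)"
    using e_pos by (simp add: powr_powr)
  also have "(K * Z * P powr (n / p)) powr (1 / (r * e)) = K powr (1 / (r * e)) * P powr (\<theta> / p) * Z powr (1 / (r * e))"
  proof -
    have "n / p * (1 / (r * e)) = \<theta> / p" by (simp add: theta_eq)
    then show ?thesis by (simp only: powr_mult powr_powr mult_ac)
  qed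
  also have "Z powr (1 / (r * e)) = (if \<theta> = 1 then 1 else Q powr ((1 - \<theta>) / q))"
    unfolding one_minus_theta by (simp add: Z_def powr_powr)
  finally show ?thesis .
qed

text \<open>The power constant, with the root taken, belongs to the set of admissible constants. So
  the infimum is over a nonempty set bounded below and not a default value.\<close>

lemma gn_best_const_le:
  assumes n: "n = CARD('n::finite)"
  shows "gn_best_const TYPE('n) p q r \<theta> \<le> gn_power_const TYPE(real ^ 'n) p q powr (1 / (r * e))"
    and "gn_best_const TYPE('n) p q r \<theta> \<ge> 0"
proof -
  let ?K = "gn_power_const TYPE(real ^ 'n) p q"
  let ?S = "{C. 0 \<le> C \<and>
     (\<forall>(u, g) \<in> (Dpq p q :: ((real ^ 'n \<Rightarrow> real) \<times> (real ^ 'n \<Rightarrow> real ^ 'n)) set).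
        integrable lborel (\<lambda>x. \<bar>u x\<bar> powr r) \<and>
        gn_inequality lborel p q r \<theta> C u (\<lambda>x. norm (g x)))}"
  have n': "n = DIM(real ^ 'n)" using n by simp
  have mem: "?K powr (1 / (r * e)) \<in> ?S"
  proof (intro CollectI conjI ballI, simp, clarify)
    fix u :: "real ^ 'n \<Rightarrow> real" and g :: "real ^ 'n \<Rightarrow> real ^ 'n" assume ug: "(u, g) \<in> Dpq p q"
    show "integrable lborel (\<lambda>x. \<bar>u x\<bar> powr r) \<and> gn_inequality lborel p q r \<theta> (?K powr (1 / (r * e))) u (\<lambda>x. norm (g x))"
      unfolding gn_inequality_def
    proof
      show "integrable lborel (\<lambda>x. \<bar>u x\<bar> powr r)"
        by (rule gn_Dpq_power(1)[OF n ug less_add_one less_add_one])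
      show "(\<integral>x. \<bar>u x\<bar> powr r \<partial>lborel) powr (1 / r) \<le> ?K powr (1 / (r * e)) *
         (\<integral>x. norm (g x) powr p \<partial>lborel) powr (\<theta> / p) *
         (if \<theta> = 1 then 1 else (\<integral>x. \<bar>u x\<bar> powr q \<partial>lborel) powr ((1 - \<theta>) / q))"
        by (rule gn_inequality_of_power[OF _ _ _ _ gn_Dpq_power(2)[OF n ug]])
          (use gn_power_const_pos[OF n'] in auto)
    qed
  qed
  show "gn_best_const TYPE('n) p q r \<theta> \<le> ?K powr (1 / (r * e))"
    unfolding gn_best_const_def by (rule cInf_lower[OF mem]) (auto simp: bdd_below_def)
  show "gn_best_const TYPE('n) p q r \<theta> \<ge> 0"
    unfolding gn_best_const_def by (rule cInf_greatest) (use mem in blast, simp)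
qed

end

section \<open>Truncated kernels as test functions\<close>

lemma kernel_powr: "kernel b a l t powr c = kernel b (a * c) l t"
  by (simp add: kernel_def powr_powr)

lemma kernel_antimono:
  assumes "l > 0" "a \<ge> 0" "b > 0" "0 \<le> t" "t \<le> t'"
  shows "kernel b a l t' \<le> kernel b a l t"
  unfolding kernel_def using assms by (intro powr_mono2' add_left_mono powr_mono2 add_pos_nonneg) auto

text \<open>Bounding \<open>t powr (b - 1)\<close> by
  \<open>(l + t powr b) powr ((b - 1) / b)\<close> leaves a negative power of
  \<open>l + t powr b\<close>, hence of \<open>l\<close>. The bound serves as Lipschitz constant of
  the kernel.\<close>

lemma kernel_density_bound:
  assumes "b > 1" "l > 0" "a > 0" "t \<ge> 0"
  shows "kernel_density b a l t \<le> a * b * l powr (- (1 / b) - a)"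
proof -
  have pos: "l + t powr b > 0" using assms by (simp add: add_pos_nonneg)
  have "t powr (b - 1) = (t powr b) powr ((b - 1) / b)" using assms by (simp add: powr_powr)
  also have "\<dots> \<le> (l + t powr b) powr ((b - 1) / b)" using assms by (intro powr_mono2) auto
  finally have "kernel_density b a l t \<le> a * b * ((l + t powr b) powr ((b - 1) / b) * (l + t powr b) powr (- a - 1))"
    unfolding kernel_density_def using assms by (simp add: mult_left_mono mult_right_mono mult.assoc)
  also have "(l + t powr b) powr ((b - 1) / b) * (l + t powr b) powr (- a - 1) = (l + t powr b) powr (- (1 / b) - a)"
    using assms by (simp add: powr_add[symmetric] field_simps)
  also have "\<dots> \<le> l powr (- (1 / b) - a)"
  proof (rule powr_mono2')
    have "1 / b \<ge> 0" using assms by simp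
    then show "- (1 / b) - a \<le> 0" using assms by linarith
  qed (use assms in auto)
  finally show ?thesis using assms by simp
qed

lemma kernel_lipschitz:
  assumes "b > 1" "l > 0" "a > 0" "t \<ge> 0" "t' \<ge> 0"
  shows "\<bar>kernel b a l t - kernel b a l t'\<bar> \<le> a * b * l powr (- (1 / b) - a) * \<bar>t - t'\<bar>"
proof -
  have "norm (kernel b a l \<bar>t\<bar> - kernel b a l \<bar>t'\<bar>) \<le> a * b * l powr (- (1 / b) - a) * norm (t - t')"
  proof (rule field_differentiable_bound[of "{0..}"])
    fix y :: real assume y: "y \<in> {0..}"
    show "((\<lambda>t. kernel b a l \<bar>t\<bar>) has_field_derivative - kernel_density b a l y) (at y within {0..})"
      using y assms by (intro has_field_derivative_at_within[OF has_derivative_kernel_abs]) auto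
    show "norm (- kernel_density b a l y) \<le> a * b * l powr (- (1 / b) - a)"
      using kernel_density_bound[of b l a y] kernel_density_nonneg[of a b l y] y assms by auto
  qed (use assms in auto)
  then show ?thesis using assms by simp
qed

lemma kernel_tendsto_0:
  assumes "b > 0" "a > 0"
  shows "((\<lambda>t. kernel b a l t) \<longlongrightarrow> 0) at_top"
  unfolding kernel_def
proof (rule tendsto_neg_powr)
  show "filterlim (\<lambda>t :: real. l + t powr b) at_top at_top"
    using assms by (intro filterlim_tendsto_add_at_top[OF tendsto_const]) real_asymp
qed (use assms in auto)

text \<open>Subtracting the value at \<open>R\<close> before cutting at 0 gives bounded support
  without a cut-off factor, so the slope never exceeds that of the kernel.\<close>

definition trunc_kernel :: "real \<Rightarrow> real \<Rightarrow> real \<Rightarrow> 'a::metric_space \<Rightarrow> real \<Rightarrow> 'a \<Rightarrow> real" where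
  "trunc_kernel b a l x0 R x = max 0 (kernel b a l (dist x0 x) - kernel b a l R)"

lemma trunc_kernel_Lip0:
  fixes x0 :: "'a::metric_space"
  assumes proper: "\<And>S :: 'a set. closed S \<Longrightarrow> bounded S \<Longrightarrow> compact S"
    and b: "b > 1" "l > 0" "a > 0" "R \<ge> 0"
  shows "trunc_kernel b a l x0 R \<in> Lip0"
proof -
  have "{x. trunc_kernel b a l x0 R x \<noteq> 0} \<subseteq> cball x0 R"
  proof
    fix x assume "x \<in> {x. trunc_kernel b a l x0 R x \<noteq> 0}"
    then have "\<not> kernel b a l (dist x0 x) \<le> kernel b a l R" by (auto simp: trunc_kernel_def)
    then have "\<not> R \<le> dist x0 x" using kernel_antimono[of l a b R "dist x0 x"] b by auto
    then show "x \<in> cball x0 R" by simp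
  qed
  then have "bounded (closure {x. trunc_kernel b a l x0 R x \<noteq> 0})"
    by (intro bounded_closure) (rule bounded_subset[OF bounded_cball])
  then have "compact (closure {x. trunc_kernel b a l x0 R x \<noteq> 0})"
    by (intro proper) auto
  moreover have "(a * b * l powr (- (1 / b) - a))-lipschitz_on UNIV (trunc_kernel b a l x0 R)"
  proof (rule lipschitz_onI)
    fix x y
    have "dist (trunc_kernel b a l x0 R x) (trunc_kernel b a l x0 R y) \<le> \<bar>kernel b a l (dist x0 x) - kernel b a l (dist x0 y)\<bar>"
      by (auto simp: trunc_kernel_def dist_real_def max_def)
    also have "\<dots> \<le> a * b * l powr (- (1 / b) - a) * \<bar>dist x0 x - dist x0 y\<bar>"
      using b by (intro kernel_lipschitz) auto
    also have "\<dots> \<le> a * b * l powr (- (1 / b) - a) * dist x y"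
      using b abs_dist_diff_le[of x x0 y] by (intro mult_left_mono) (auto simp: dist_commute)
    finally show "dist (trunc_kernel b a l x0 R x) (trunc_kernel b a l x0 R y) \<le> a * b * l powr (- (1 / b) - a) * dist x y" .
  qed (use b in auto)
  ultimately show ?thesis by (auto simp: Lip0_def)
qed

text \<open>Neither the truncation nor the distance function increases differences, so
  differentiability of the kernel in the radius bounds the difference quotients near
  \<open>x\<close> by the density plus \<open>\<epsilon>\<close>.\<close>

lemma local_lip_trunc_kernel:
  fixes x0 :: "'a::metric_space"
  assumes b: "b > 1" "l > 0" "a > 0"
  shows "0 \<le> local_lip (trunc_kernel b a l x0 R) x"
    and "local_lip (trunc_kernel b a l x0 R) x \<le> kernel_density b a l (dist x0 x)"
proof -
  let ?u = "trunc_kernel b a l x0 R" and ?k = "kernel_density b a l (dist x0 x)"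
  define \<Lambda> where "\<Lambda> = Limsup (at x) (\<lambda>y. ereal (\<bar>?u y - ?u x\<bar> / dist x y))"
  have k0: "?k \<ge> 0" using b by (intro kernel_density_nonneg) auto
  have le: "\<Lambda> \<le> ereal ?k"
  proof (rule ereal_le_epsilon2)
    fix \<epsilon> :: real assume \<epsilon>: "0 < \<epsilon>"
    have "((\<lambda>t. kernel b a l \<bar>t\<bar>) has_derivative (*) (- ?k)) (at (dist x0 x))"
      using has_derivative_kernel_abs[of b l "dist x0 x" a] b by (simp add: has_field_derivative_def)
    then obtain d where d: "d > 0" "\<And>t. norm (t - dist x0 x) < d \<Longrightarrow>
        norm (kernel b a l \<bar>t\<bar> - kernel b a l \<bar>dist x0 x\<bar> - (- ?k) * (t - dist x0 x)) \<le> \<epsilon> * norm (t - dist x0 x)"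
      using \<epsilon> unfolding has_derivative_at_alt by blast
    have "\<bar>?u y - ?u x\<bar> / dist x y \<le> ?k + \<epsilon>" if y: "dist y x < d" "y \<noteq> x" for y
    proof -
      define h where "h = dist x0 y - dist x0 x"
      have hd: "\<bar>h\<bar> \<le> dist x y" unfolding h_def using abs_dist_diff_le[of y x0 x] by (simp add: dist_commute)
      have "\<bar>?u y - ?u x\<bar> \<le> \<bar>kernel b a l (dist x0 y) - kernel b a l (dist x0 x)\<bar>"
        by (auto simp: trunc_kernel_def max_def)
      also have "\<dots> \<le> ?k * \<bar>h\<bar> + \<epsilon> * \<bar>h\<bar>"
      proof -
        have "\<bar>kernel b a l (dist x0 y) - kernel b a l (dist x0 x) + h * ?k\<bar> \<le> \<epsilon> * \<bar>h\<bar>"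
          using d(2)[of "dist x0 y"] hd y by (simp add: h_def dist_commute mult.commute)
        moreover have "\<bar>h * ?k\<bar> = ?k * \<bar>h\<bar>" using k0 by (simp add: abs_mult)
        ultimately show ?thesis by linarith
      qed
      also have "\<dots> \<le> (?k + \<epsilon>) * dist x y"
        using hd k0 \<epsilon> by (simp add: distrib_right[symmetric] mult_left_mono)
      finally show ?thesis using y by (simp add: divide_le_eq)
    qed
    then have "\<forall>\<^sub>F y in at x. ereal (\<bar>?u y - ?u x\<bar> / dist x y) \<le> ereal (?k + \<epsilon>)"
      using d(1) by (auto simp: eventually_at intro!: exI[of _ d])
    then show "\<Lambda> \<le> ereal ?k + ereal \<epsilon>"
      unfolding \<Lambda>_def by (intro Limsup_bounded) simp
  qed
  \<comment> \<open>At a limit point the filter \<open>at x\<close> is nontrivial, so nonnegative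
    quotients have a nonnegative upper limit; with \<open>le\<close> it is finite and
    \<open>real_of_ereal\<close> keeps its value.\<close>
  have "0 \<le> \<Lambda>" if "x islimpt UNIV"
  proof -
    have "\<not> trivial_limit (at x)" using that by (simp add: trivial_limit_within)
    then show ?thesis unfolding \<Lambda>_def
      by (intro le_Limsup) (auto intro!: always_eventually)
  qed
  then have *: "x islimpt UNIV \<Longrightarrow> 0 \<le> real_of_ereal \<Lambda> \<and> real_of_ereal \<Lambda> \<le> ?k"
    using le by (cases \<Lambda>) auto
  show "0 \<le> local_lip ?u x" "local_lip ?u x \<le> ?k"
    using * k0 unfolding local_lip_def \<Lambda>_def[symmetric] by auto
qed

text \<open>Where \<open>W > w\<close>, the two relations force \<open>z < Z\<close>: otherwise
  \<open>w - l z \<le> W - l Z\<close>, and monotonicity in both factors gives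
  \<open>z^e < Z^e\<close>. So \<open>W - w\<close> decreases wherever it is positive, and it cannot
  be positive at \<open>l\<close> after the last point \<open>y0\<close> before \<open>l\<close>
  where it is at most 0.\<close>

lemma power_comparison:
  fixes w z :: "real \<Rightarrow> real" and K e s c d \<beta> \<beta>' :: real
  assumes w: "\<And>l. l > 0 \<Longrightarrow> (w has_real_derivative - s * z l) (at l)"
    and W: "\<And>l. l > 0 \<Longrightarrow> (W has_real_derivative - s * Z l) (at l)"
    and pos: "s > 0" "e > 0" "K \<ge> 0" "c \<ge> 0" "d \<ge> 0"
    and nonneg: "\<And>l. l > 0 \<Longrightarrow> w l \<ge> 0" "\<And>l. l > 0 \<Longrightarrow> Z l \<ge> 0" "\<And>l. l > 0 \<Longrightarrow> w l - l * z l \<ge> 0"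
    and sub: "\<And>l. l > 0 \<Longrightarrow> z l powr e \<le> K * (w l - l * z l) powr c * w l powr d"
    and super: "\<And>l. l > 0 \<Longrightarrow> Z l powr e > K * (W l - l * Z l) powr c * W l powr d"
    and start: "\<And>\<delta>. \<delta> > 0 \<Longrightarrow> \<exists>l. 0 < l \<and> l < \<delta> \<and> W l \<le> w l"
    and l: "l > 0"
  shows "W l \<le> w l"
proof (rule ccontr)
  assume "\<not> W l \<le> w l"
  define g where "g y = W y - w y" for y
  have gl: "g l > 0" using \<open>\<not> W l \<le> w l\<close> by (simp add: g_def)
  have dg: "(g has_real_derivative s * (z y - Z y)) (at y)" if "y > 0" for y
    unfolding g_def using DERIV_diff[OF W[OF that] w[OF that]] by (simp add: algebra_simps)
  obtain l0 where l0: "0 < l0" "l0 < l" "W l0 \<le> w l0" using start[OF l] by blast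
  have cont: "continuous_on {l0..l} g"
    by (rule continuous_at_imp_continuous_on) (use DERIV_isCont[OF dg] l0 in auto)
  define S where "S = {y \<in> {l0..l}. g y \<le> 0}"
  have "closed S" unfolding S_def by (intro continuous_on_closed_Collect_le cont continuous_intros closed_atLeastAtMost)
  moreover have "l0 \<in> S" using l0 by (simp add: S_def g_def)
  moreover have "bdd_above S" by (auto simp: S_def intro!: bdd_aboveI[of _ l])
  ultimately have sup: "Sup S \<in> S" by (metis closed_contains_Sup empty_iff)
  define y0 where "y0 = Sup S"
  have y0: "l0 \<le> y0" "y0 \<le> l" "g y0 \<le> 0" using sup by (auto simp: S_def y0_def)
  have above: "g y > 0" if "y0 < y" "y \<le> l" for y
  proof (rule ccontr)
    assume "\<not> g y > 0"
    then have "y \<in> S" using that y0 by (auto simp: S_def)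
    then have "y \<le> y0" unfolding y0_def using \<open>bdd_above S\<close> by (rule cSup_upper)
    then show False using that by simp
  qed
  have "y0 < l" using y0 gl by (cases "y0 = l") auto
  have "g l < g y0"
  proof (rule DERIV_neg_imp_decreasing_open[OF \<open>y0 < l\<close>])
    fix y assume y: "y0 < y" "y < l"
    then have yp: "y > 0" using y0 l0 by simp
    have wW: "w y < W y" using above[of y] y by (simp add: g_def)
    have "z y < Z y"
    proof (rule ccontr)
      assume "\<not> z y < Z y"
      then have zZ: "Z y \<le> z y" by simp
      have "K * (w y - y * z y) powr c * w y powr d \<le> K * (W y - y * Z y) powr c * W y powr d"
        using wW zZ yp pos nonneg[OF yp] by (intro mult_mono powr_mono2 diff_mono) auto
      also have "\<dots> < Z y powr e" by (rule super[OF yp])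
      also have "\<dots> \<le> z y powr e" using zZ nonneg[OF yp] pos by (intro powr_mono2) auto
      finally show False using sub[OF yp] by simp
    qed
    then show "\<exists>D. (g has_real_derivative D) (at y) \<and> D < 0"
      using dg[OF yp] pos by (intro exI conjI) (auto simp: mult_pos_neg)
  qed (use cont y0 in \<open>auto intro: continuous_on_subset\<close>)
  then show False using y0 gl by simp
qed

section \<open>Volume comparison\<close>

text \<open>Here \<open>C \<ge> 0\<close> stands in for \<open>C \<ge> \<Phi>\<close>; the
  comparison with \<open>\<Phi>\<close> is an assumption of those lemmas in which
  \<open>\<Phi>\<close> occurs.\<close>

locale gn_space = gn_exponents n p q for n p q +
  fixes M :: "'a::metric_space measure" and x0 :: 'a and C C0 \<omega> A B K :: real
    and dim :: "'n::finite itself"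
  assumes n: "n = CARD('n)"
    and mms: "metric_measure_space M"
    and proper: "\<And>S :: 'a set. closed S \<Longrightarrow> bounded S \<Longrightarrow> compact S"
    and C: "C \<ge> 0" and C0: "C0 \<ge> 1"
    and GN: "\<And>u. u \<in> Lip0 \<Longrightarrow> gn_inequality M p q r \<theta> C u (local_lip u)"
    and doubling: "\<And>x s R. 0 < s \<Longrightarrow> s < R \<Longrightarrow>
      measure M (ball x R) / measure M (ball x s) \<le> C0 * (R / s) ^ n"
    and density: "Liminf (at_right 0) (\<lambda>s. ereal
      (measure M (ball x0 s) / measure lborel (ball (0 :: real ^ 'n) s))) = 1"
  defines "\<omega> \<equiv> unit_ball_vol (real CARD('n))"
    and "A \<equiv> kernel_mass TYPE(real ^ 'n) (gn_exponents.b p) (gn_exponents.s p q)"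
    and "B \<equiv> kernel_mass TYPE(real ^ 'n) (gn_exponents.b p) (gn_exponents.m p q)"
    and "K \<equiv> gn_power_const TYPE(real ^ 'n) p q"
begin

lemma n_DIM: "n = DIM(real ^ 'n)" using n by simp

lemmas euclid = euclidean_constants[OF n_DIM, folded A_def B_def]

lemma n_pos: "n > 0" using p by simp

lemma sets_M: "sets M = sets borel"
  using mms by (simp add: metric_measure_space_def)

lemma space_M: "space M = UNIV"
  using sets_eq_imp_space_eq[OF sets_M] by simp

lemma ball_finite: "emeasure M (ball x t) < \<infinity>"
  using mms by (cases "ball x t = {}") (auto simp: metric_measure_space_def simp del: ball_eq_empty)

lemma emeasure_ball_M: "emeasure M (ball x t) = ennreal (measure M (ball x t))"
  using ball_finite[of x t] by (intro emeasure_eq_ennreal_measure) auto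

lemma ball_pos: "t > 0 \<Longrightarrow> measure M (ball x t) > 0"
  using mms unfolding metric_measure_space_def
  by (subst measure_def) (auto simp: enn2real_positive_iff)

lemma ball_mono: "ball x t \<subseteq> ball y t' \<Longrightarrow> measure M (ball x t) \<le> measure M (ball y t')"
  using ball_finite[of y t'] by (intro measure_mono_fmeasurable) (auto simp: sets_M fmeasurable_def)

lemma sigma_finite_M: "sigma_finite_measure M"
proof
  show "\<exists>\<A>. countable \<A> \<and> \<A> \<subseteq> sets M \<and> \<Union>\<A> = space M \<and> (\<forall>a\<in>\<A>. emeasure M a \<noteq> \<infinity>)"
  proof (intro exI[of _ "range (\<lambda>i::nat. ball x0 (real i))"] conjI ballI)
    show "\<Union>(range (\<lambda>i::nat. ball x0 (real i))) = space M"
      by (auto simp: space_M reals_Archimedean2)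
    show "emeasure M a \<noteq> \<infinity>" if "a \<in> range (\<lambda>i::nat. ball x0 (real i))" for a
      using that ball_finite by (auto simp: less_top)
  qed (auto simp: sets_M)
qed

lemma omega_pos: "\<omega> > 0" by (simp add: \<omega>_def)

lemma euclidean_ball: "t \<ge> 0 \<Longrightarrow> measure lborel (ball (0 :: real ^ 'n) t) = \<omega> * t ^ n"
  using content_ball[of t "0 :: real ^ 'n"] by (simp add: \<omega>_def n)

lemma emeasure_euclidean_ball: "t \<ge> 0 \<Longrightarrow> emeasure lborel (ball (0 :: real ^ 'n) t) = ennreal (\<omega> * t ^ n)"
  using emeasure_ball[of t "0 :: real ^ 'n"] by (simp add: \<omega>_def n)

section \<open>Small balls around \<open>x0\<close> and the upper volume bound\<close>

lemma density_lower:
  assumes "c < 1"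
  obtains \<delta> where "\<delta> > 0" "\<And>t. 0 < t \<Longrightarrow> t < \<delta> \<Longrightarrow> c * (\<omega> * t ^ n) \<le> measure M (ball x0 t)"
proof -
  have "ereal c < Liminf (at_right 0) (\<lambda>s. ereal
      (measure M (ball x0 s) / measure lborel (ball (0 :: real ^ 'n) s)))"
    unfolding density using assms by simp
  from less_LiminfD[OF this] obtain \<delta> where \<delta>: "\<delta> > 0"
    "\<And>t. 0 < t \<Longrightarrow> t < \<delta> \<Longrightarrow> c < measure M (ball x0 t) / measure lborel (ball (0 :: real ^ 'n) t)"
    by (auto simp: eventually_at_right_field)
  show thesis
  proof (rule that[OF \<delta>(1)])
    fix t :: real assume t: "0 < t" "t < \<delta>"
    then have "\<omega> * t ^ n > 0" using omega_pos by simp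
    then show "c * (\<omega> * t ^ n) \<le> measure M (ball x0 t)"
      using \<delta>(2)[OF t] t by (simp add: euclidean_ball pos_less_divide_eq less_imp_le)
  qed
qed

text \<open>A lower limit equal to 1 provides radii \<open>t\<close> below \<open>\<rho>\<close>
  whose balls have volume at most \<open>(1 + \<eta>) * (\<omega> * t ^ n)\<close>.
  \<open>doubling\<close> carries this from \<open>t\<close> to \<open>\<rho>\<close>, and the
  powers of \<open>t\<close> cancel.\<close>

lemma volume_upper:
  assumes \<rho>: "\<rho> > 0"
  shows "measure M (ball x0 \<rho>) \<le> C0 * \<omega> * \<rho> ^ n"
proof (rule field_le_epsilon)
  fix \<epsilon> :: real assume \<epsilon>: "\<epsilon> > 0"
  \<comment> \<open>Chosen so that the factor \<open>1 + \<eta>\<close> costs exactly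
    \<open>\<epsilon>\<close>.\<close>
  define \<eta> where "\<eta> = \<epsilon> / (C0 * \<omega> * \<rho> ^ n)"
  have pos: "C0 * \<omega> * \<rho> ^ n > 0" using C0 omega_pos \<rho> by simp
  have \<eta>: "\<eta> > 0" using \<epsilon> pos by (simp add: \<eta>_def)
  have "\<exists>t. 0 < t \<and> t < \<rho> \<and> measure M (ball x0 t) \<le> (1 + \<eta>) * (\<omega> * t ^ n)"
  proof (rule ccontr)
    assume neg: "\<not> ?thesis"
    have "ereal (1 + \<eta>) \<le> Liminf (at_right 0) (\<lambda>s. ereal
      (measure M (ball x0 s) / measure lborel (ball (0 :: real ^ 'n) s)))"
    proof (rule Liminf_bounded)
      show "\<forall>\<^sub>F t in at_right 0. ereal (1 + \<eta>) \<le> ereal (measure M (ball x0 t) / measure lborel (ball (0 :: real ^ 'n) t))"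
        unfolding eventually_at_right_field
      proof (intro exI[of _ \<rho>] conjI allI impI)
        fix t assume t: "0 < t" "t < \<rho>"
        then have "\<omega> * t ^ n > 0" using omega_pos by simp
        moreover have "(1 + \<eta>) * (\<omega> * t ^ n) \<le> measure M (ball x0 t)" using neg t by auto
        ultimately show "ereal (1 + \<eta>) \<le> ereal (measure M (ball x0 t) / measure lborel (ball (0 :: real ^ 'n) t))"
          using t by (simp add: euclidean_ball pos_le_divide_eq)
      qed (rule \<rho>)
    qed
    then show False using \<eta> by (simp add: density)
  qed
  then obtain t where t: "0 < t" "t < \<rho>" "measure M (ball x0 t) \<le> (1 + \<eta>) * (\<omega> * t ^ n)" by blast
  have "measure M (ball x0 \<rho>) \<le> C0 * (\<rho> / t) ^ n * measure M (ball x0 t)"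
    using doubling[OF t(1,2), of x0] ball_pos[OF t(1), of x0] by (simp add: divide_le_eq)
  also have "\<dots> \<le> C0 * (\<rho> / t) ^ n * ((1 + \<eta>) * (\<omega> * t ^ n))"
    using t \<rho> C0 by (intro mult_left_mono) auto
  also have "\<dots> = C0 * \<omega> * \<rho> ^ n + \<epsilon>"
    using t \<rho> C0 omega_pos by (simp add: \<eta>_def power_divide field_simps)
  finally show "measure M (ball x0 \<rho>) \<le> C0 * \<omega> * \<rho> ^ n + \<epsilon>" .
qed

lemma kernel_layer_M:
  assumes "a > 0" "l > 0"
  shows "(\<integral>\<^sup>+x. ennreal (kernel b a l (dist x0 x)) \<partial>M)
    = (\<integral>\<^sup>+t. ennreal (kernel_density b a l t) * ennreal (measure M (ball x0 t)) \<partial>lborel)"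
  using nn_integral_kernel[OF sigma_finite_M sets_M b_gt_1 assms] by (simp add: emeasure_ball_M)

lemma kernel_layer_E:
  assumes "a > 0" "l > 0"
  shows "(\<integral>\<^sup>+x. ennreal (kernel b a l (dist 0 x)) \<partial>(lborel :: (real ^ 'n) measure))
    = (\<integral>\<^sup>+t. ennreal (kernel_density b a l t) * emeasure lborel (ball (0 :: real ^ 'n) t) \<partial>lborel)"
  by (rule nn_integral_kernel[OF lborel.sigma_finite_measure_axioms sets_lborel b_gt_1 assms])

lemma measurable_ball [measurable]:
  "(\<lambda>t. measure M (ball x0 t)) \<in> borel_measurable borel"
  "(\<lambda>t. emeasure lborel (ball (0 :: real ^ 'n) t)) \<in> borel_measurable borel"
proof -
  have "mono (\<lambda>t. measure M (ball x0 t))" by (intro monoI ball_mono) auto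
  then show "(\<lambda>t. measure M (ball x0 t)) \<in> borel_measurable borel" by (rule borel_measurable_mono)
  have "(\<lambda>t. emeasure lborel (ball (0 :: real ^ 'n) t)) = (\<lambda>t. if t \<le> 0 then 0 else ennreal (\<omega> * t ^ n))"
    using emeasure_euclidean_ball emeasure_ball_le0 by fastforce
  then show "(\<lambda>t. emeasure lborel (ball (0 :: real ^ 'n) t)) \<in> borel_measurable borel" by simp
qed

definition "w l = (\<integral>x. kernel b s l (dist x0 x) \<partial>M)"
definition "z l = (\<integral>x. kernel b m l (dist x0 x) \<partial>M)"

lemma nn_kernel_E:
  assumes "l > 0"
  shows "(\<integral>\<^sup>+t. ennreal (kernel_density b s l t) * emeasure lborel (ball (0 :: real ^ 'n) t) \<partial>lborel) = ennreal (l powr (- e) * A)"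
  unfolding kernel_layer_E[OF s_pos assms, symmetric] euclid(6)[OF assms, symmetric]
  by (rule nn_integral_eq_integral[OF euclid(4)[OF assms]]) (simp add: less_imp_le kernel_pos assms)

text \<open>Through the layer-cake formula, \<open>volume_upper\<close> compares the integral with
  \<open>C0\<close> times its finite Euclidean counterpart.\<close>

lemma integrable_kernel_s:
  assumes l: "l > 0"
  shows "integrable M (\<lambda>x. kernel b s l (dist x0 x))"
proof (rule integrableI_nonneg)
  have "(\<integral>\<^sup>+x. ennreal (kernel b s l (dist x0 x)) \<partial>M)
     \<le> (\<integral>\<^sup>+t. ennreal C0 * (ennreal (kernel_density b s l t) * emeasure lborel (ball (0 :: real ^ 'n) t)) \<partial>lborel)"
    unfolding kernel_layer_M[OF s_pos l]
  proof (intro nn_integral_mono)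
    fix t :: real
    have "ennreal (measure M (ball x0 t)) \<le> ennreal C0 * emeasure lborel (ball (0 :: real ^ 'n) t)"
    proof (cases "t \<le> 0")
      case True
      then show ?thesis by (simp add: ball_empty)
    next
      case False
      then show ?thesis
        using volume_upper[of t] C0 omega_pos
        by (simp add: emeasure_euclidean_ball ennreal_mult[symmetric] mult.assoc ennreal_leI)
    qed
    then have "ennreal (kernel_density b s l t) * ennreal (measure M (ball x0 t))
       \<le> ennreal (kernel_density b s l t) * (ennreal C0 * emeasure lborel (ball (0 :: real ^ 'n) t))"
      by (intro mult_left_mono) auto
    then show "ennreal (kernel_density b s l t) * ennreal (measure M (ball x0 t))
       \<le> ennreal C0 * (ennreal (kernel_density b s l t) * emeasure lborel (ball (0 :: real ^ 'n) t))"
      by (simp add: mult_ac)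
  qed
  also have "\<dots> = ennreal C0 * ennreal (l powr (- e) * A)"
    by (subst nn_integral_cmult) (simp_all add: nn_kernel_E[OF l])
  also have "\<dots> < \<infinity>" by (simp add: ennreal_mult_less_top)
  finally show "(\<integral>\<^sup>+x. ennreal (kernel b s l (dist x0 x)) \<partial>M) < \<infinity>" .
qed (auto simp: less_imp_le kernel_pos l measurable_kernel_dist[OF sets_M])

lemma integrable_kernel_m: "l > 0 \<Longrightarrow> integrable M (\<lambda>x. kernel b m l (dist x0 x))"
  unfolding m_def by (rule has_derivative_integral_kernel(1)[OF sets_M s_pos _ integrable_kernel_s])

lemma w_derivative: "l > 0 \<Longrightarrow> (w has_real_derivative - s * z l) (at l)"
  unfolding w_def[abs_def] z_def m_def
  by (rule has_derivative_integral_kernel(2)[OF sets_M s_pos _ integrable_kernel_s])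

lemma nn_kernel_M:
  assumes "l > 0"
  shows "(\<integral>\<^sup>+t. ennreal (kernel_density b s l t) * ennreal (measure M (ball x0 t)) \<partial>lborel) = ennreal (w l)"
  unfolding kernel_layer_M[OF s_pos assms, symmetric] w_def
  by (rule nn_integral_eq_integral[OF integrable_kernel_s[OF assms]]) (simp add: less_imp_le kernel_pos assms)

text \<open>As \<open>l\<close> tends to 0 the Euclidean integral grows like
  \<open>l powr (- e)\<close>, while the radii beyond a fixed \<open>d\<close> contribute a bounded
  amount. So the volumes of small balls decide, and passing from \<open>c'\<close> to
  \<open>c\<close> absorbs the rest.\<close>

lemma w_near_0:
  assumes c: "0 < c" "c < 1" and \<delta>: "\<delta> > 0"
  shows "\<exists>l. 0 < l \<and> l < \<delta> \<and> c * (l powr (- e) * A) \<le> w l"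
proof -
  define c' where "c' = (1 + c) / 2"
  have c': "c < c'" "c' < 1" "c' > 0" using c by (auto simp: c'_def)
  obtain d where d: "d > 0" "\<And>t. 0 < t \<Longrightarrow> t < d \<Longrightarrow> c' * (\<omega> * t ^ n) \<le> measure M (ball x0 t)"
    using density_lower[OF c'(2)] by blast
  \<comment> \<open>For \<open>t \<ge> d\<close> one has
    \<open>1 + t^b \<le> (1 + d^(-b)) (l + t^b)\<close>. Hence \<open>R\<close> bounds the quotient
    of the densities for \<open>l\<close> and for 1, uniformly in \<open>l\<close>.\<close>
  define R where "R = (1 + d powr (- b)) powr (s + 1)"
  have lower: "c' * (l powr (- e) * A) \<le> w l + c' * R * A" if l: "0 < l" "l < 1" for l
  proof -
    have "ennreal c' * ennreal (l powr (- e) * A) = (\<integral>\<^sup>+t. ennreal c' * (ennreal (kernel_density b s l t) * emeasure lborel (ball (0 :: real ^ 'n) t)) \<partial>lborel)"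
      using nn_kernel_E[OF l(1)] by (subst nn_integral_cmult) simp_all
    also have "\<dots> \<le> (\<integral>\<^sup>+t. ennreal (kernel_density b s l t) * ennreal (measure M (ball x0 t))
        + ennreal (c' * R) * (ennreal (kernel_density b s 1 t) * emeasure lborel (ball (0 :: real ^ 'n) t)) \<partial>lborel)"
    proof (intro nn_integral_mono)
      fix t :: real
      consider "t \<le> 0" | "0 < t" "t < d" | "d \<le> t" by linarith
      then show "ennreal c' * (ennreal (kernel_density b s l t) * emeasure lborel (ball (0 :: real ^ 'n) t))
        \<le> ennreal (kernel_density b s l t) * ennreal (measure M (ball x0 t))
        + ennreal (c' * R) * (ennreal (kernel_density b s 1 t) * emeasure lborel (ball (0 :: real ^ 'n) t))"
      proof cases
        case 1
        then show ?thesis by (simp add: emeasure_ball_le0)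
      next
        case 2
        have "ennreal c' * emeasure lborel (ball (0 :: real ^ 'n) t) \<le> ennreal (measure M (ball x0 t))"
          using 2 d(2)[OF 2] c' omega_pos by (simp add: emeasure_euclidean_ball ennreal_mult[symmetric] ennreal_leI)
        then have "ennreal (kernel_density b s l t) * (ennreal c' * emeasure lborel (ball (0 :: real ^ 'n) t))
          \<le> ennreal (kernel_density b s l t) * ennreal (measure M (ball x0 t))" by (intro mult_left_mono) auto
        then show ?thesis by (simp add: mult_ac add_increasing2)
      next
        case 3
        then have t: "t > 0" using d by simp
        have "kernel_density b s l t \<le> R * kernel_density b s 1 t"
        proof -
          have tb: "t powr b > 0" using t by simp
          have "(1 + t powr b) \<le> (1 + d powr (- b)) * (l + t powr b)"
          proof -
            have "d powr b \<le> t powr b" using 3 d b_gt_1 by (intro powr_mono2) auto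
            then have "1 \<le> d powr (- b) * t powr b"
              using d by (simp add: powr_minus_divide pos_le_divide_eq)
            then have "1 + t powr b \<le> (1 + d powr (- b)) * t powr b" by (simp add: algebra_simps)
            also have "\<dots> \<le> (1 + d powr (- b)) * (l + t powr b)" using l by (intro mult_left_mono) auto
            finally show ?thesis .
          qed
          then have "((1 + d powr (- b)) * (l + t powr b)) powr (- s - 1) \<le> (1 + t powr b) powr (- s - 1)"
            using s_pos tb by (intro powr_mono2') (auto simp: add_pos_pos)
          then have "(l + t powr b) powr (- s - 1) * ((1 + d powr (- b)) powr (- s - 1)) \<le> (1 + t powr b) powr (- s - 1)"
            by (simp add: powr_mult mult.commute)
          moreover have "(1 + d powr (- b)) powr (- s - 1) * R = 1"
          proof -
            have "1 + d powr (- b) \<noteq> 0" using powr_ge_zero[of d "- b"] by linarith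
            then show ?thesis by (simp add: R_def powr_add[symmetric])
          qed
          ultimately have "(l + t powr b) powr (- s - 1) \<le> R * (1 + t powr b) powr (- s - 1)"
            using mult_left_mono[of "(l + t powr b) powr (- s - 1) * ((1 + d powr (- b)) powr (- s - 1))" "(1 + t powr b) powr (- s - 1)" R]
            by (simp add: mult_ac R_def)
          then have "s * b * t powr (b - 1) * (l + t powr b) powr (- s - 1) \<le> s * b * t powr (b - 1) * (R * (1 + t powr b) powr (- s - 1))"
            using s_pos b_gt_1 by (intro mult_left_mono) auto
          then show ?thesis by (simp add: kernel_density_def mult_ac)
        qed
        then have "c' * (kernel_density b s l t * (\<omega> * t ^ n)) \<le> c' * ((R * kernel_density b s 1 t) * (\<omega> * t ^ n))"
          using c' omega_pos t by (intro mult_left_mono mult_right_mono) auto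
        then have "ennreal c' * (ennreal (kernel_density b s l t) * emeasure lborel (ball (0 :: real ^ 'n) t))
           \<le> ennreal (c' * R) * (ennreal (kernel_density b s 1 t) * emeasure lborel (ball (0 :: real ^ 'n) t))"
          using t c' s_pos b_gt_1 omega_pos
          by (simp add: emeasure_euclidean_ball ennreal_mult[symmetric] kernel_density_nonneg R_def ennreal_leI mult_ac)
        then show ?thesis by (simp add: add_increasing)
      qed
    qed
    also have "\<dots> = ennreal (w l) + ennreal (c' * R) * ennreal (1 powr (- e) * A)"
      using nn_kernel_M[OF l(1)] nn_kernel_E[of 1]
      by (subst nn_integral_add) (simp_all add: nn_integral_cmult)
    finally have "ennreal (c' * (l powr (- e) * A)) \<le> ennreal (w l + c' * R * A)"
      using c' euclid(1) kernel_pos[of l b s] l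
      by (simp add: ennreal_mult[symmetric] ennreal_plus[symmetric] R_def w_def integral_nonneg_AE less_imp_le del: ennreal_plus)
    moreover have "w l + c' * R * A \<ge> 0"
      using c' euclid(1) kernel_pos[of l b s] l
      by (intro add_nonneg_nonneg) (auto simp: R_def w_def less_imp_le intro!: integral_nonneg_AE)
    ultimately show ?thesis by simp
  qed
  have "filterlim (\<lambda>l. (c' - c) * (l powr (- e) * A)) at_top (at_right 0)"
    using c' euclid(1) e_pos by real_asymp
  then have "\<forall>\<^sub>F l in at_right 0. (c' - c) * (l powr (- e) * A) \<ge> c' * R * A"
    by (simp add: filterlim_at_top)
  moreover have "\<forall>\<^sub>F l in at_right (0::real). 0 < l \<and> l < min \<delta> 1"
    using \<delta> by (auto simp: eventually_at_right_field intro!: exI[of _ "min \<delta> 1"])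
  ultimately have "\<forall>\<^sub>F l in at_right 0. (c' - c) * (l powr (- e) * A) \<ge> c' * R * A \<and> 0 < l \<and> l < min \<delta> 1"
    by eventually_elim auto
  then obtain l where l: "(c' - c) * (l powr (- e) * A) \<ge> c' * R * A" "0 < l" "l < min \<delta> 1"
    using eventually_happens[of _ "at_right (0::real)"] by auto
  have "c * (l powr (- e) * A) \<le> w l"
    using lower[of l] l by (simp add: algebra_simps)
  then show ?thesis using l by auto
qed

end

section \<open>Identities for the extremal profile\<close>

context gn_exponents
begin

lemma sigma_pos: "\<sigma> > 0" using p q by (simp add: \<sigma>_def)

text \<open>The \<open>p\<close>-th power of the slope is
  \<open>(\<sigma> b)^p t^b (l + t^b)^(-m)\<close>, and \<open>t^b = (l + t^b) - l\<close>. This is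
  how the gradient integral is expressed by \<open>w\<close> and \<open>z\<close>.\<close>

lemma kernel_density_sigma_powr:
  assumes l: "l > 0" and t: "t \<ge> 0"
  shows "kernel_density b \<sigma> l t powr p = (\<sigma> * b) powr p * (kernel b s l t - l * kernel b m l t)"
proof -
  have pos: "l + t powr b > 0" using l by (simp add: add_pos_nonneg)
  have e1: "(b - 1) * p = b" using p by (simp add: b_def field_simps)
  have e2: "(- \<sigma> - 1) * p = - m" using p q by (simp add: \<sigma>_def m_eq field_simps)
  have "kernel_density b \<sigma> l t powr p = (\<sigma> * b) powr p * (t powr b * kernel b m l t)"
    unfolding kernel_density_def powr_mult powr_powr e1 e2 by (simp add: kernel_def powr_mult)
  moreover have "kernel b s l t = (l + t powr b) * kernel b m l t"
    using pos by (simp add: kernel_def m_def powr_mult_base)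
  ultimately show ?thesis by (simp add: algebra_simps)
qed

text \<open>By \<open>theta_eq\<close> and \<open>one_minus_theta\<close> the claim is
  \<open>n / p + (m - n) - e = 1\<close>, which is \<open>n / p + n / b = n\<close>. The exponent in
  the theorem is therefore \<open>r * e\<close>.\<close>

lemma exponent_sum: "\<theta> / p + (1 - \<theta>) / q - 1 / r = 1 / (r * e)"
proof -
  have "real n / p + (m - real n) - e = 1" using n_conj by (simp add: m_def e_def)
  moreover have "\<theta> / p + (1 - \<theta>) / q - 1 / r = (real n / p + (m - real n) - e) / (r * e)"
    unfolding one_minus_theta using r_pos e_pos by (simp add: theta_eq add_divide_distrib diff_divide_distrib)
  ultimately show ?thesis by simp
qed

text \<open>Equality in the power form for the profile with \<open>l = 1\<close>, whose three
  integrals are \<open>B\<close>, \<open>(\<sigma> b)^p (A - B)\<close> and \<open>A\<close>. The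
  \<open>n\<close>-th powers cancel because \<open>\<sigma> * q = s\<close> and
  \<open>s * b * (A - B) = n * A\<close>.\<close>

lemma gn_power_const_extremal:
  assumes n: "n = DIM('a::euclidean_space)"
  defines "A \<equiv> kernel_mass TYPE('a) b s" and "B \<equiv> kernel_mass TYPE('a) b m"
  shows "gn_power_const TYPE('a) p q * (\<sigma> * b) powr n * (A - B) powr (n / p) * A powr (m - n) = B powr e"
proof -
  have AB: "A > 0" "B > 0" "A - B > 0" "s * b * (A - B) = n * A"
    using euclidean_constants(1,2)[OF n] kernel_mass_diff[OF n] by (auto simp: A_def B_def)
  have q0: "q > 0" and n0: "real n > 0" using p q by auto
  have "gn_power_const TYPE('a) p q = B powr e * q powr n * (A - B) powr (n / b) / (A powr m * n powr n)"
    by (simp add: gn_power_const_def Let_def A_def B_def n)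
  then have "gn_power_const TYPE('a) p q * (\<sigma> * b) powr n * (A - B) powr (n / p) * A powr (m - n)
    = B powr e * ((q powr n * (\<sigma> * b) powr n * ((A - B) powr (n / p) * (A - B) powr (n / b))) * (A powr (m - n) / A powr m) / n powr n)"
    by simp
  also have "(A - B) powr (n / p) * (A - B) powr (n / b) = (A - B) powr n"
    using n_conj by (simp add: powr_add[symmetric])
  also have "A powr (m - n) / A powr m = 1 / A powr n" using AB by (simp add: powr_diff)
  also have "q powr n * (\<sigma> * b) powr n * (A - B) powr n * (1 / A powr n) / n powr n = ((\<sigma> * q) * b * (A - B)) powr n / (n * A) powr n"
    by (simp add: powr_mult mult_ac)
  also have "\<dots> = 1" unfolding sigma_q AB(4) using n0 AB by simp
  finally show ?thesis by simp
qed

end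

section \<open>The inequality on \<open>X\<close> for kernels and its consequences for
  volumes\<close>

context gn_space
begin

lemma w_pos: "l > 0 \<Longrightarrow> w l > 0" and w_minus_z: "l > 0 \<Longrightarrow> w l - l * z l \<ge> 0"
proof -
  assume l: "l > 0"
  have "w l - l * z l = (\<integral>x. kernel b s l (dist x0 x) - l * kernel b m l (dist x0 x) \<partial>M)"
    using integrable_kernel_s[OF l] integrable_kernel_m[OF l] by (simp add: w_def z_def)
  also have "\<dots> \<ge> 0"
  proof (intro integral_nonneg_AE AE_I2)
    fix x
    have "0 \<le> kernel_density b \<sigma> l (dist x0 x) powr p" by simp
    then show "0 \<le> kernel b s l (dist x0 x) - l * kernel b m l (dist x0 x)"
      using sigma_pos b_gt_1 by (simp add: kernel_density_sigma_powr[OF l] zero_le_mult_iff)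
  qed
  finally show "w l - l * z l \<ge> 0" .
  have "w l \<ge> 0" unfolding w_def by (intro integral_nonneg_AE) (simp add: less_imp_le kernel_pos l)
  moreover have "w l \<noteq> 0"
  proof
    assume "w l = 0"
    then have "AE x in M. kernel b s l (dist x0 x) = 0"
      unfolding w_def using integrable_kernel_s[OF l] l
      by (subst (asm) integral_nonneg_eq_0_iff_AE) (auto simp: less_imp_le kernel_pos)
    then have "AE x in M. False"
      by eventually_elim (metis kernel_pos l less_irrefl)
    then have "emeasure M (space M) = 0" by (simp add: eventually_False ae_filter_eq_bot_iff)
    then have "emeasure M (ball x0 1) = 0"
      using emeasure_mono[of "ball x0 1" "space M" M] sets.top[of M] by (simp add: space_M)
    then show False using ball_pos[of 1 x0] by (simp add: measure_def)
  qed
  ultimately show "w l > 0" by simp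
qed

text \<open>The profile is approximated by its truncations. The left side converges by dominated
  convergence, while both integrals on the right are bounded by those of the full profile, so the
  right side does not depend on \<open>j\<close>.\<close>

lemma kernel_gn:
  assumes l: "l > 0"
  shows "z l powr e \<le> C powr (r * e) * (\<sigma> * b) powr n * (w l - l * z l) powr (n / p) * w l powr (m - n)"
proof -
  note [measurable] = measurable_kernel_dist[OF sets_M]
  define h where "h x = kernel b \<sigma> l (dist x0 x)" for x
  define u where "u j = trunc_kernel b \<sigma> l x0 (real j)" for j :: nat
  have hpos: "h x > 0" for x unfolding h_def by (rule kernel_pos[OF l])
  have hq: "h x powr q = kernel b s l (dist x0 x)" and hr: "h x powr r = kernel b m l (dist x0 x)" for x
    by (simp_all add: h_def kernel_powr sigma_q sigma_r)
  have u: "0 \<le> u j x" "u j x \<le> h x" for j x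
    using kernel_pos[OF l, of b \<sigma> "real j"] hpos[of x] by (auto simp: u_def trunc_kernel_def h_def)
  have [measurable]: "u j \<in> borel_measurable M" "h \<in> borel_measurable M" for j
    unfolding u_def trunc_kernel_def[abs_def] h_def[abs_def] by measurable
  have lim: "(\<lambda>j. u j x) \<longlonglongrightarrow> h x" for x
  proof -
    have "(\<lambda>j. kernel b \<sigma> l (real j)) \<longlonglongrightarrow> 0"
      using filterlim_compose[OF kernel_tendsto_0 filterlim_real_sequentially] sigma_pos b_gt_1 by simp
    then have "(\<lambda>j. max 0 (h x - kernel b \<sigma> l (real j))) \<longlonglongrightarrow> max 0 (h x - 0)"
      by (intro tendsto_intros)
    then show ?thesis using hpos[of x] by (simp add: u_def trunc_kernel_def h_def)
  qed
  have limr: "(\<lambda>j. \<integral>x. \<bar>u j x\<bar> powr r \<partial>M) \<longlonglongrightarrow> z l"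
    unfolding z_def
  proof (rule integral_dominated_convergence[OF _ _ integrable_kernel_m[OF l]])
    show "AE x in M. (\<lambda>j. \<bar>u j x\<bar> powr r) \<longlonglongrightarrow> kernel b m l (dist x0 x)"
    proof (intro AE_I2)
      fix x
      have "(\<lambda>j. \<bar>u j x\<bar> powr r) \<longlonglongrightarrow> \<bar>h x\<bar> powr r"
        using r_pos by (intro tendsto_powr2 tendsto_const tendsto_rabs lim) auto
      then show "(\<lambda>j. \<bar>u j x\<bar> powr r) \<longlonglongrightarrow> kernel b m l (dist x0 x)"
        using hpos[of x] by (simp add: hr)
    qed
    show "AE x in M. norm (\<bar>u j x\<bar> powr r) \<le> kernel b m l (dist x0 x)" for j
      unfolding hr[symmetric] using u[of j] r_pos by (intro AE_I2) (auto intro: powr_mono2)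
  qed measurable
  have qle: "(\<integral>x. \<bar>u j x\<bar> powr q \<partial>M) \<le> w l" for j
    unfolding w_def
  proof (rule integral_mono')
    show "\<bar>u j x\<bar> powr q \<le> kernel b s l (dist x0 x)" for x
      unfolding hq[symmetric] using u[of j] p q by (intro powr_mono2) auto
  qed (use integrable_kernel_s[OF l] in \<open>auto simp: less_imp_le kernel_pos l\<close>)
  have ple: "(\<integral>x. local_lip (u j) x powr p \<partial>M) \<le> (\<sigma> * b) powr p * (w l - l * z l)" for j
  proof -
    have "(\<integral>x. local_lip (u j) x powr p \<partial>M) \<le> (\<integral>x. (\<sigma> * b) powr p * (kernel b s l (dist x0 x) - l * kernel b m l (dist x0 x)) \<partial>M)"
    \<comment> \<open>This rule asks integrability of the majorant; if the left integrand is not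
      integrable, its Bochner integral is the default 0, which is below that of a nonnegative
      majorant.\<close>
    proof (rule integral_mono')
      show "local_lip (u j) x powr p \<le> (\<sigma> * b) powr p * (kernel b s l (dist x0 x) - l * kernel b m l (dist x0 x))" for x
        unfolding kernel_density_sigma_powr[OF l zero_le_dist, symmetric] u_def
        using local_lip_trunc_kernel[OF b_gt_1 l sigma_pos] p by (intro powr_mono2) auto
      show "0 \<le> (\<sigma> * b) powr p * (kernel b s l (dist x0 x) - l * kernel b m l (dist x0 x))" for x
        unfolding kernel_density_sigma_powr[OF l zero_le_dist, symmetric] by simp
    qed (use integrable_kernel_s[OF l] integrable_kernel_m[OF l] in auto)
    also have "\<dots> = (\<sigma> * b) powr p * (w l - l * z l)"
      using integrable_kernel_s[OF l] integrable_kernel_m[OF l] by (simp add: w_def z_def)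
    finally show ?thesis .
  qed
  have \<theta>0: "\<theta> > 0" using theta_eq r_pos e_pos n_pos by simp
  have \<theta>1: "(1 - \<theta>) / q \<ge> 0" unfolding one_minus_theta using m_ge_n r_pos e_pos by simp
  define c where "c = C * ((\<sigma> * b) powr p * (w l - l * z l)) powr (\<theta> / p) * w l powr ((1 - \<theta>) / q)"
  have bound: "(\<integral>x. \<bar>u j x\<bar> powr r \<partial>M) powr (1 / r) \<le> c" for j
  proof -
    have "u j \<in> Lip0" unfolding u_def by (intro trunc_kernel_Lip0 proper b_gt_1 l sigma_pos) auto
    from GN[OF this] have "(\<integral>x. \<bar>u j x\<bar> powr r \<partial>M) powr (1 / r)
      \<le> C * (\<integral>x. local_lip (u j) x powr p \<partial>M) powr (\<theta> / p) *
        (if \<theta> = 1 then 1 else (\<integral>x. \<bar>u j x\<bar> powr q \<partial>M) powr ((1 - \<theta>) / q))"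
      unfolding gn_inequality_def .
    also have "\<dots> \<le> c"
      unfolding c_def
    proof (intro mult_mono)
      show "(\<integral>x. local_lip (u j) x powr p \<partial>M) powr (\<theta> / p) \<le> ((\<sigma> * b) powr p * (w l - l * z l)) powr (\<theta> / p)"
        using ple \<theta>0 p by (intro powr_mono2) auto
      \<comment> \<open>For \<open>\<theta> = 1\<close> this reads
        \<open>1 \<le> w l powr 0\<close>, which is true because \<open>w l > 0\<close>.\<close>
      show "(if \<theta> = 1 then 1 else (\<integral>x. \<bar>u j x\<bar> powr q \<partial>M) powr ((1 - \<theta>) / q)) \<le> w l powr ((1 - \<theta>) / q)"
        using qle[of j] \<theta>1 w_pos[OF l] by (auto intro!: powr_mono2)
    qed (use C in auto)
    finally show ?thesis .
  qed
  have "(\<lambda>j. (\<integral>x. \<bar>u j x\<bar> powr r \<partial>M) powr (1 / r)) \<longlonglongrightarrow> z l powr (1 / r)"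
    using r_pos by (intro tendsto_powr2 limr tendsto_const) auto
  then have "z l powr (1 / r) \<le> c" by (rule LIMSEQ_le_const2) (use bound in auto)
  then have "(z l powr (1 / r)) powr (r * e) \<le> c powr (r * e)"
    using r_pos e_pos by (intro powr_mono2) auto
  also have "(z l powr (1 / r)) powr (r * e) = z l powr e" using r_pos by (simp add: powr_powr)
  also have "c powr (r * e) = C powr (r * e) * (\<sigma> * b) powr n * (w l - l * z l) powr (n / p) * w l powr (m - n)"
  proof -
    have 1: "\<theta> / p * (r * e) = n / p" using r_pos e_pos by (simp add: theta_eq)
    have 2: "(1 - \<theta>) / q * (r * e) = m - n" unfolding one_minus_theta using r_pos e_pos by simp
    have 3: "p * (n / p) = n" using p by simp
    have "(C * Y * W) powr (r * e) = C powr (r * e) * Y powr (r * e) * W powr (r * e)" for Y W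
      by (simp add: powr_mult)
    moreover have "(((\<sigma> * b) powr p * (w l - l * z l)) powr (\<theta> / p)) powr (r * e) = (\<sigma> * b) powr n * (w l - l * z l) powr (n / p)"
    proof -
      have "((S powr p * X) powr (\<theta> / p)) powr (r * e) = (S powr p * X) powr (n / p)" for S X
        by (simp only: powr_powr 1)
      moreover have "(S powr p * X) powr (n / p) = S powr n * X powr (n / p)" for S X
        by (simp only: powr_mult powr_powr 3)
      ultimately show ?thesis by (simp only:)
    qed
    moreover have "(w l powr ((1 - \<theta>) / q)) powr (r * e) = w l powr (m - n)"
      unfolding powr_powr 2 ..
    ultimately show ?thesis by (simp only: c_def mult.assoc)
  qed
  finally show ?thesis .
qed

lemma kernel_comparison:
  fixes c \<Phi> :: real
  assumes \<Phi>: "\<Phi> = gn_best_const TYPE('n) p q r \<theta>" "\<Phi> \<le> C"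
    and c: "0 < c" "c < (inverse C * \<Phi>) powr (r * e)" and l: "l > 0"
  shows "c * (l powr (- e) * A) \<le> w l"
proof -
  have re: "r * e > 0" using r_pos e_pos by simp
  \<comment> \<open>Positivity of \<open>\<Phi>\<close> is read off from \<open>c\<close>: for
    \<open>\<Phi> = 0\<close> the power bounding \<open>c\<close> would be 0.\<close>
  have \<Phi>0: "\<Phi> > 0" "C > 0"
  proof -
    have "\<Phi> \<ge> 0" unfolding \<Phi>(1) by (rule gn_best_const_le(2)[OF n])
    moreover have "\<Phi> \<noteq> 0" using c by auto
    ultimately show "\<Phi> > 0" "C > 0" using \<Phi>(2) by auto
  qed
  have "(inverse C * \<Phi>) powr (r * e) \<le> 1 powr (r * e)"
    using \<Phi>0 \<Phi>(2) re by (intro powr_mono2) (auto simp: field_simps)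
  then have c1: "c < 1" using c by simp
  have AB: "A > 0" "B > 0" "A - B > 0"
    using euclid(1,2) kernel_mass_diff(2)[OF n_DIM] by (auto simp: A_def B_def)
  define L where "L = C powr (r * e) * (\<sigma> * b) powr n"
  \<comment> \<open>The margin lies in \<open>c < (\<Phi> / C)^(r e)\<close> and
    \<open>\<Phi> powr (r * e) \<le> K\<close>; the equality for the profile then replaces
    \<open>K\<close> by \<open>B powr e\<close>.\<close>
  have strict: "L * c * (A - B) powr (n / p) * A powr (m - n) < B powr e"
  proof -
    have "c * C powr (r * e) < \<Phi> powr (r * e)"
    proof -
      have "(inverse C * \<Phi>) powr (r * e) = \<Phi> powr (r * e) / C powr (r * e)"
        by (simp add: powr_mult inverse_powr divide_inverse mult.commute)
      then show ?thesis using c(2) \<Phi>0 by (simp add: pos_less_divide_eq)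
    qed
    also have "\<dots> \<le> K"
    proof -
      have "\<Phi> powr (r * e) \<le> (K powr (1 / (r * e))) powr (r * e)"
        using gn_best_const_le(1)[OF n] re \<Phi>0 unfolding \<Phi>(1) K_def by (intro powr_mono2) auto
      then show ?thesis using r_pos e_pos gn_power_const_pos[OF n_DIM] by (simp add: powr_powr K_def)
    qed
    finally have "c * C powr (r * e) < K" .
    then have "(c * C powr (r * e)) * ((\<sigma> * b) powr n * (A - B) powr (n / p) * A powr (m - n))
      < K * ((\<sigma> * b) powr n * (A - B) powr (n / p) * A powr (m - n))"
      using AB sigma_pos b_gt_1 by (intro mult_strict_right_mono) auto
    also have "\<dots> = B powr e"
      using gn_power_const_extremal[OF n_DIM] by (simp add: A_def B_def K_def mult.assoc)
    finally show ?thesis by (simp add: L_def mult_ac)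
  qed
  show ?thesis
  proof (rule power_comparison[where w = w and z = z and Z = "\<lambda>l. c * (l powr (- e - 1) * B)" and s = s and K = L and e = e and c = "n / p" and d = "m - n"])
    fix l :: real assume l: "l > 0"
    show "(w has_real_derivative - s * z l) (at l)" by (rule w_derivative[OF l])
    have "((\<lambda>l. l powr (- e)) has_real_derivative - e * l powr (- e - 1)) (at l)"
      using l by (rule has_real_derivative_powr)
    then have "((\<lambda>l. c * (l powr (- e) * A)) has_real_derivative c * (- e * l powr (- e - 1) * A)) (at l)"
      by (intro DERIV_cmult DERIV_cmult_right)
    moreover have "c * (- e * l powr (- e - 1) * A) = - s * (c * (l powr (- e - 1) * B))"
    proof -
      have "c * (- e * l powr (- e - 1) * A) = - (c * l powr (- e - 1)) * (e * A)" by simp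
      also have "\<dots> = - (c * l powr (- e - 1)) * (s * B)" by (simp only: euclid(3))
      finally show ?thesis by simp
    qed
    ultimately show "((\<lambda>l. c * (l powr (- e) * A)) has_real_derivative - s * (c * (l powr (- e - 1) * B))) (at l)" by (simp only:)
    show "w l \<ge> 0" "w l - l * z l \<ge> 0" using w_pos[OF l] w_minus_z[OF l] by auto
    show "0 \<le> c * (l powr (- e - 1) * B)" using c AB by simp
    show "z l powr e \<le> L * (w l - l * z l) powr (n / p) * w l powr (m - n)"
      using kernel_gn[OF l] by (simp add: L_def)
    show "L * (c * (l powr (- e) * A) - l * (c * (l powr (- e - 1) * B))) powr (n / p) * (c * (l powr (- e) * A)) powr (m - n)
      < (c * (l powr (- e - 1) * B)) powr e"
    proof -
      have l1: "l * l powr (- e - 1) = l powr (- e)" using l by (simp add: powr_mult_base)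
      have "c * (l powr (- e) * A) - l * (c * (l powr (- e - 1) * B)) = c * l powr (- e) * A - c * (l * l powr (- e - 1)) * B"
        by (simp add: mult_ac)
      also have "\<dots> = c * l powr (- e) * (A - B)" unfolding l1 by (simp add: algebra_simps)
      finally have "L * (c * (l powr (- e) * A) - l * (c * (l powr (- e - 1) * B))) powr (n / p) * (c * (l powr (- e) * A)) powr (m - n)
        = L * ((c * l powr (- e)) powr (n / p) * (c * l powr (- e)) powr (m - n)) * (A - B) powr (n / p) * A powr (m - n)"
        by (simp add: powr_mult mult_ac)
      \<comment> \<open>The two exponents add up to \<open>e + 1\<close>. This is one power of
        \<open>c\<close> more than on the other side, and \<open>strict\<close> contains exactly
        this factor; the powers of \<open>l\<close> agree.\<close>
      also have "(c * l powr (- e)) powr (n / p) * (c * l powr (- e)) powr (m - n) = (c * l powr (- e)) powr (e + 1)"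
      proof -
        have "real n / p + (m - n) = e + 1" using n_conj by (simp add: m_def e_def)
        then show ?thesis by (simp add: powr_add[symmetric])
      qed
      also have "\<dots> = (c powr e * l powr ((- e - 1) * e)) * c"
      proof -
        have "- e * (e + 1) = (- e - 1) * e" by (simp add: algebra_simps)
        then have "(c * l powr (- e)) powr (e + 1) = c powr (e + 1) * l powr ((- e - 1) * e)"
          by (simp only: powr_mult powr_powr)
        then show ?thesis using c by (simp add: powr_add)
      qed
      also have "L * (c powr e * l powr ((- e - 1) * e) * c) * (A - B) powr (n / p) * A powr (m - n)
         = (c powr e * l powr ((- e - 1) * e)) * (L * c * (A - B) powr (n / p) * A powr (m - n))" by simp
      also have "\<dots> < (c powr e * l powr ((- e - 1) * e)) * B powr e"
        using strict c l by (intro mult_strict_left_mono) auto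
      also have "\<dots> = (c * (l powr (- e - 1) * B)) powr e" by (simp add: powr_mult powr_powr)
      finally show ?thesis .
    qed
  next
    fix \<delta> :: real assume "\<delta> > 0"
    then show "\<exists>l>0. l < \<delta> \<and> c * (l powr (- e) * A) \<le> w l" by (rule w_near_0[OF c(1) c1])
  qed (use s_pos e_pos p m_ge_n l in \<open>auto simp: L_def\<close>)
qed

text \<open>Radii below \<open>R\<close> contribute at most the volume of the ball of radius
  \<open>R\<close> times the integral of the density, which is the kernel at 0, that is
  \<open>l powr (- s)\<close>.\<close>

lemma w_upper:
  assumes l: "l > 0" and c: "c \<ge> 0" and R: "R > 0"
    and V: "\<And>t. t \<ge> R \<Longrightarrow> measure M (ball x0 t) \<le> c * (\<omega> * t ^ n)"
  shows "w l \<le> c * (l powr (- e) * A) + measure M (ball x0 R) * l powr (- s)"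
proof -
  have "ennreal (w l) = (\<integral>\<^sup>+t. ennreal (kernel_density b s l t) * ennreal (measure M (ball x0 t)) \<partial>lborel)"
    using nn_kernel_M[OF l] by simp
  also have "\<dots> \<le> (\<integral>\<^sup>+t. ennreal c * (ennreal (kernel_density b s l t) * emeasure lborel (ball (0 :: real ^ 'n) t))
      + ennreal (measure M (ball x0 R)) * (ennreal (kernel_density b s l t) * indicator {0<..} t) \<partial>lborel)"
  proof (intro nn_integral_mono)
    fix t :: real
    consider "t \<le> 0" | "0 < t" "t < R" | "R \<le> t" by linarith
    then show "ennreal (kernel_density b s l t) * ennreal (measure M (ball x0 t))
      \<le> ennreal c * (ennreal (kernel_density b s l t) * emeasure lborel (ball (0 :: real ^ 'n) t))
      + ennreal (measure M (ball x0 R)) * (ennreal (kernel_density b s l t) * indicator {0<..} t)"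
    proof cases
      case 1
      then show ?thesis by (simp add: ball_empty)
    next
      case 2
      have "measure M (ball x0 t) \<le> measure M (ball x0 R)" using 2 by (intro ball_mono) auto
      then have "ennreal (kernel_density b s l t) * ennreal (measure M (ball x0 t))
        \<le> ennreal (kernel_density b s l t) * ennreal (measure M (ball x0 R))"
        by (intro mult_left_mono ennreal_leI) auto
      then show ?thesis using 2 by (simp add: mult.commute add_increasing)
    next
      case 3
      then have "ennreal (measure M (ball x0 t)) \<le> ennreal c * emeasure lborel (ball (0 :: real ^ 'n) t)"
        using V[of t] R c omega_pos by (simp add: emeasure_euclidean_ball ennreal_mult[symmetric] ennreal_leI)
      then have "ennreal (kernel_density b s l t) * ennreal (measure M (ball x0 t))
        \<le> ennreal (kernel_density b s l t) * (ennreal c * emeasure lborel (ball (0 :: real ^ 'n) t))"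
        by (intro mult_left_mono) auto
      then show ?thesis by (simp add: mult_ac add_increasing2)
    qed
  qed
  also have "\<dots> = ennreal c * ennreal (l powr (- e) * A) + ennreal (measure M (ball x0 R)) * ennreal (kernel b s l 0)"
    using nn_kernel_E[OF l] kernel_layer[OF b_gt_1 s_pos l, of 0]
    by (subst nn_integral_add) (simp_all add: nn_integral_cmult)
  also have "\<dots> = ennreal (c * (l powr (- e) * A) + measure M (ball x0 R) * l powr (- s))"
    using c euclid(1) by (simp add: ennreal_mult[symmetric] ennreal_plus[symmetric] kernel_def del: ennreal_plus)
  finally have "ennreal (w l) \<le> ennreal (c * (l powr (- e) * A) + measure M (ball x0 R) * l powr (- s))" .
  moreover have "0 \<le> c * (l powr (- e) * A) + measure M (ball x0 R) * l powr (- s)" using c euclid(1) by simp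
  ultimately show ?thesis by (simp only: ennreal_le_iff)
qed

text \<open>If all large balls were smaller, \<open>kernel_comparison\<close> for some
  \<open>c' > c\<close> and \<open>w_upper\<close> would give
  \<open>(c' - c) * A * l powr (- e) \<le> V * l powr (- s)\<close> for every \<open>l > 0\<close>.
  As \<open>s - e = n / b\<close> is positive, this fails for large \<open>l\<close>.\<close>

lemma volume_at_infinity:
  fixes c \<Phi> :: real
  assumes \<Phi>: "\<Phi> = gn_best_const TYPE('n) p q r \<theta>" "\<Phi> \<le> C"
    and c: "0 \<le> c" "c < (inverse C * \<Phi>) powr (r * e)"
  shows "\<exists>t\<ge>R. t > 0 \<and> c * (\<omega> * t ^ n) < measure M (ball x0 t)"
proof (rule ccontr)
  assume neg: "\<not> ?thesis"
  obtain c' where c': "c < c'" "c' < (inverse C * \<Phi>) powr (r * e)" using c dense by blast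
  define R' where "R' = max R 1"
  define V where "V = measure M (ball x0 R')"
  have le: "(c' - c) * A * l powr (n / b) \<le> V" if l: "l > 0" for l
  proof -
    have "c' * (l powr (- e) * A) \<le> w l"
      by (rule kernel_comparison[OF \<Phi> _ c'(2) l]) (use c c' in auto)
    also have "\<dots> \<le> c * (l powr (- e) * A) + V * l powr (- s)"
      unfolding V_def by (rule w_upper[OF l c(1)]) (use neg in \<open>auto simp: R'_def not_less\<close>)
    finally have "(c' - c) * A * l powr (- e) \<le> V * l powr (- s)" by (simp add: algebra_simps)
    then have "(c' - c) * A * l powr (- e) * l powr s \<le> V * l powr (- s) * l powr s"
      by (rule mult_right_mono) simp
    moreover have "l powr (- e) * l powr s = l powr (n / b)" by (simp add: powr_add[symmetric] e_def)
    moreover have "l powr (- s) * l powr s = 1" using l by (simp add: powr_add[symmetric])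
    ultimately show ?thesis by (simp add: mult.assoc)
  qed
  have "filterlim (\<lambda>l. (c' - c) * A * l powr (n / b)) at_top at_top"
    using c' euclid(1) n_pos b_gt_1 by real_asymp
  then have "\<forall>\<^sub>F l in at_top. (c' - c) * A * l powr (n / b) > V"
    by (simp add: filterlim_at_top_dense)
  then have "\<forall>\<^sub>F l in at_top. (c' - c) * A * l powr (n / b) > V \<and> l > 0"
    using eventually_gt_at_top[of 0] by eventually_elim auto
  then obtain l where "(c' - c) * A * l powr (n / b) > V" "l > 0"
    using eventually_happens[of _ "at_top :: real filter"] by auto
  then show False using le[of l] by simp
qed

text \<open>The ball of radius \<open>T j\<close> around \<open>x0\<close> lies in a concentric
  enlargement around \<open>x\<close>, which \<open>doubling\<close> compares with radius
  \<open>\<rho>\<close>. Since \<open>T j\<close> tends to infinity, moving the centre costs nothing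
  in the limit; afterwards \<open>c\<close> tends to \<open>k\<close>.\<close>

lemma volume_lower:
  fixes \<Phi> :: real
  assumes \<Phi>: "\<Phi> = gn_best_const TYPE('n) p q r \<theta>" "\<Phi> \<le> C" and \<rho>: "\<rho> > 0"
  shows "inverse C0 * (inverse C * \<Phi>) powr (r * e) * (\<omega> * \<rho> ^ n) \<le> measure M (ball x \<rho>)"
proof -
  define k where "k = (inverse C * \<Phi>) powr (r * e)"
  have *: "inverse C0 * c * (\<omega> * \<rho> ^ n) \<le> measure M (ball x \<rho>)" if c: "0 \<le> c" "c < k" for c
  proof -
    define d where "d = dist x x0"
    have "\<forall>j::nat. \<exists>t. t \<ge> real j + \<rho> \<and> t > 0 \<and> c * (\<omega> * t ^ n) < measure M (ball x0 t)"
      using volume_at_infinity[OF \<Phi> c(1)] c(2) unfolding k_def by blast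
    from choice[OF this] obtain T where T: "\<And>j::nat. T j \<ge> real j + \<rho>" "\<And>j. T j > 0"
      "\<And>j. c * (\<omega> * T j ^ n) < measure M (ball x0 (T j))" by blast
    have bound: "inverse C0 * c * (\<omega> * \<rho> ^ n) * (T j / (T j + d + 1)) ^ n \<le> measure M (ball x \<rho>)" for j
    proof -
      \<comment> \<open>The distance \<open>d\<close> makes the balls nested; the summand 1 makes
        \<open>\<rho> < R\<close> strict, as \<open>doubling\<close> asks.\<close>
      define R where "R = T j + d + 1"
      have R: "R > \<rho>" "R > 0" 
        unfolding R_def d_def using T(1,2)[of j] zero_le_dist[of x x0] by linarith+
      have "c * (\<omega> * T j ^ n) \<le> measure M (ball x0 (T j))" using T(3)[of j] by simp
      also have "\<dots> \<le> measure M (ball x R)"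
      proof (intro ball_mono subsetI)
        fix y assume "y \<in> ball x0 (T j)"
        then show "y \<in> ball x R" using dist_triangle[of x y x0] by (simp add: R_def d_def)
      qed
      also have "\<dots> \<le> C0 * (R / \<rho>) ^ n * measure M (ball x \<rho>)"
        using doubling[OF \<rho> R(1), of x] ball_pos[OF \<rho>, of x] by (simp add: divide_le_eq)
      finally have "inverse C0 * (\<rho> / R) ^ n * (c * (\<omega> * T j ^ n)) \<le> inverse C0 * (\<rho> / R) ^ n * (C0 * (R / \<rho>) ^ n * measure M (ball x \<rho>))"
        using C0 \<rho> R by (intro mult_left_mono) auto
      also have "\<dots> = measure M (ball x \<rho>)"
        using C0 \<rho> R by (simp add: power_divide)
      finally show ?thesis by (simp add: R_def power_divide mult_ac)
    qed
    have "(\<lambda>j. T j / (T j + d + 1)) \<longlonglongrightarrow> 1"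
    proof -
      have Tlim: "filterlim T at_top sequentially"
        by (rule filterlim_at_top_mono[OF filterlim_real_sequentially]) (use T(1) \<rho> in \<open>auto intro!: always_eventually order_trans[OF _ T(1)]\<close>)
      have "((\<lambda>t. t / (t + d + 1)) \<longlongrightarrow> 1) at_top" by real_asymp
      from filterlim_compose[OF this Tlim] show ?thesis .
    qed
    then have "(\<lambda>j. inverse C0 * c * (\<omega> * \<rho> ^ n) * (T j / (T j + d + 1)) ^ n) \<longlonglongrightarrow> inverse C0 * c * (\<omega> * \<rho> ^ n) * 1 ^ n"
      by (intro tendsto_intros)
    from LIMSEQ_le_const2[OF this] bound show ?thesis by simp
  qed
  show ?thesis
  proof (cases "k > 0")
    case True
    have "((\<lambda>c. inverse C0 * c * (\<omega> * \<rho> ^ n)) \<longlongrightarrow> inverse C0 * k * (\<omega> * \<rho> ^ n)) (at_left k)"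
      by (intro tendsto_intros)
    then have "inverse C0 * k * (\<omega> * \<rho> ^ n) \<le> measure M (ball x \<rho>)"
    proof (rule tendsto_upperbound)
      show "\<forall>\<^sub>F c in at_left k. inverse C0 * c * (\<omega> * \<rho> ^ n) \<le> measure M (ball x \<rho>)"
        using * True by (auto simp: eventually_at_left_field intro!: exI[of _ 0])
    qed simp
    then show ?thesis by (simp add: k_def)
  next
    case False
    then have "k = 0" by (simp add: k_def)
    then show ?thesis by (simp add: k_def[symmetric])
  qed
qed

end

theorem theorem1p2:
  fixes M :: "'a::metric_space measure" and x\<^sub>0 :: 'a
    and n :: nat and p q r \<theta> \<Phi> C C\<^sub>0 :: real
  assumes n: "n = CARD('n::finite)" "n \<ge> 2"
    and p: "1 < p" "p < real n"
    and q: "p < q" "q \<le> p * (real n - 1) / (real n - p)"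
    and r: "r = p * ((q - 1) / (p - 1))"
    and \<theta>: "\<theta> = (q - p) * real n / ((q - 1) * (real n * p - (real n - p) * q))"
    and \<Phi>: "\<Phi> = gn_best_const TYPE('n) p q r \<theta>"
    and mms: "metric_measure_space M"
    and proper: "\<And>S :: 'a set. closed S \<Longrightarrow> bounded S \<Longrightarrow> compact S"
    and C: "C \<ge> \<Phi>" and C\<^sub>0: "C\<^sub>0 \<ge> 1"
    and GN: "\<And>u. u \<in> Lip0 \<Longrightarrow> gn_inequality M p q r \<theta> C u (local_lip u)"
    and doubling: "\<And>x s R. 0 < s \<Longrightarrow> s < R \<Longrightarrow>
      measure M (ball x R) / measure M (ball x s) \<le> C\<^sub>0 * (R / s) ^ n"
    and density: "Liminf (at_right 0) (\<lambda>s. ereal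
      (measure M (ball x\<^sub>0 s) / measure lborel (ball (0 :: real ^ 'n) s))) = 1"
  shows "(\<forall>x. \<forall>\<rho>>0. measure M (ball x \<rho>) \<ge>
        inverse C\<^sub>0 * (inverse C * \<Phi>) powr inverse (\<theta> / p + (1 - \<theta>) / q - 1 / r)
          * measure lborel (ball (0 :: real ^ 'n) \<rho>)) \<and>
    (\<forall>\<rho>>0.
        inverse C\<^sub>0 * (inverse C * \<Phi>) powr inverse (\<theta> / p + (1 - \<theta>) / q - 1 / r)
          * measure lborel (ball (0 :: real ^ 'n) 1) * \<rho> ^ n \<le> measure M (ball x\<^sub>0 \<rho>) \<and>
        measure M (ball x\<^sub>0 \<rho>) \<le> C\<^sub>0 * measure lborel (ball (0 :: real ^ 'n) 1) * \<rho> ^ n)"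
proof -
  interpret E: gn_exponents n p q by unfold_locales (use p q in auto)
  have r': "r = E.r" and \<theta>': "\<theta> = E.\<theta>" by (simp_all add: r \<theta> E.r_def E.\<theta>_def)
  have \<Phi>': "\<Phi> = gn_best_const TYPE('n) p q E.r E.\<theta>" by (simp add: \<Phi> r' \<theta>')
  \<comment> \<open>Together with \<open>C \<ge> \<Phi>\<close> this supplies
    \<open>C \<ge> 0\<close> for the locale.\<close>
  have "\<Phi> \<ge> 0" unfolding \<Phi>' by (rule E.gn_best_const_le(2)[OF n(1)])
  interpret S: gn_space n p q M x\<^sub>0 C C\<^sub>0 "unit_ball_vol (real CARD('n))"
    "kernel_mass TYPE(real ^ 'n) E.b E.s" "kernel_mass TYPE(real ^ 'n) E.b E.m" "gn_power_const TYPE(real ^ 'n) p q" "TYPE('n)"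
    by unfold_locales (use n mms proper C C\<^sub>0 GN doubling density \<open>\<Phi> \<ge> 0\<close> in \<open>auto simp: r' \<theta>'\<close>)
  have ex: "inverse (\<theta> / p + (1 - \<theta>) / q - 1 / r) = E.r * E.e"
    unfolding r' \<theta>' E.exponent_sum by simp
  have ball: "measure lborel (ball (0 :: real ^ 'n) t) = unit_ball_vol (real CARD('n)) * t ^ n" if "t \<ge> 0" for t
    using S.euclidean_ball[OF that] .
  show ?thesis
    unfolding ex using S.volume_lower[OF \<Phi>' C] S.volume_upper by (auto simp: ball mult_ac)
qed

end
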